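(* For every $C^\infty$ function $\eta:X\to(0,+\infty)$ on a compact complex Hermitian manifold $(X,\omega)$ with $\dim_{\mathbb C}X=n$ and for every $k\in\{0,\dots,2n\}$, the operator $D_\eta^\star:C^\infty_k(X,\mathbb C)\to C^\infty_{k-1}(X,\mathbb C)$ is given by $$D_\eta^\star=\theta_\eta T^\star_\eta\theta_\eta^{-1},$$ where $T^\star_\eta:C^\infty_k(X,\mathbb C)\to C^\infty_{k-1}(X,\mathbb C)$ is the linear operator $$T^\star_\eta\Big(\sum_{p+q=k}u^{p,q}\Big)=\sum_{p+q=k}T^\star_{p,\eta}(u^{p,q}),\qquad u^{p,q}\in C^\infty_{p,q}(X,\mathbb C),$$ and, for every bidegree $(p,q)$, $T^\star_{p,\eta}:C^\infty_{p,q}(X,\mathbb C)\to C^\infty_{p+q-1}(X,\mathbb C)$ is the linear operator $$T^\star_{p,\eta}=\frac1{\eta^{2p}}\bigg(d^\star_{\omega_\eta}-2(n-p)\Big[\Lambda,\ i\Big(\frac1\eta\,\partial\eta-\eta\,\bar\partial\eta\Big)\wedge\cdot\Big]\bigg)\circ\theta_\eta^2,$$ $d^\star_{\omega_\eta}$ being the formal adjoint of $d$ with respect to the twisted $L^2$-inner product $\langle\langle\cdot,\cdot\rangle\rangle_{\omega_\eta}$.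
   Context: $C^\infty_{p,q}(X,\mathbb C)$ and $C^\infty_k(X,\mathbb C)$ are the spaces of smooth $(p,q)$-forms and $k$-forms. The Hermitian metric is identified with its positive definite $(1,1)$-form $\omega$, normalized so that $\omega=i\sum_j\zeta_j\wedge\bar\zeta_j$ for a local orthonormal coframe of $(1,0)$-forms. $\Lambda=\Lambda_\omega$ is the adjoint (for $\omega$) of $\omega\wedge\cdot$; $[A,B]=AB-(-1)^{ab}BA$ is the graded commutator of operators of degrees $a,b$. $\theta_\eta$ acts on $(p,q)$-forms as multiplication by $\eta^p$ (extended linearly to $k$-forms), $D_\eta=\theta_\eta d\theta_\eta^{-1}$, and $D_\eta^\star$ is the formal adjoint of $D_\eta$ for the $L^2$-inner product $\langle\langle\cdot,\cdot\rangle\rangle_\omega$ induced by $\omega$. Twisted inner product: on $(p,q)$-forms, $\langle u,v\rangle_{\omega_\eta}:=\eta^{2p}\langle u,v\rangle_\omega$ (forms of different bidegrees being orthogonal), with twisted metric $\omega_\eta=\eta^{-2}\omega$ and volume form $dV_{\omega_\eta}=\eta^{-2n}dV_\omega$; thus for $(p,q)$-forms $$\langle\langle u,v\rangle\rangle_{\omega_\eta}=\int_X\langle u,v\rangle_{\omega_\eta}\,dV_{\omega_\eta}=\int_X\frac1{\eta^{2(n-p)}}\langle u,v\rangle_\omega\,dV_\omega.$$ *)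

theory Defs
  imports "HOL-Analysis.Analysis" "HOL-Library.Function_Algebras"
begin

section \<open>Exterior algebra of a complex vector space\<close>

text \<open>
  An element of the exterior algebra of (real-multilinear, complex-valued) alternating forms on
  \<open>V = complex^'n\<close> is a function on lists of vectors: its values on lists of length \<open>k\<close> are its
  component of degree \<open>k\<close>.  Addition is the pointwise one of \<open>Function_Algebras\<close>.
\<close>

type_synonym 'v alt = "'v list \<Rightarrow> complex"

definition alternating :: "'v::real_vector alt \<Rightarrow> bool" where
  "alternating \<alpha> \<longleftrightarrow>
     (\<forall>xs ys. linear (\<lambda>v. \<alpha> (xs @ v # ys))) \<and> (\<forall>vs. \<not> distinct vs \<longrightarrow> \<alpha> vs = 0)"

text \<open>Degrees are integers, so that a form of degree \<open>-1\<close> is zero.\<close>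

definition has_degree :: "int \<Rightarrow> 'v alt \<Rightarrow> bool" where
  "has_degree k \<alpha> \<longleftrightarrow> (\<forall>vs. int (length vs) \<noteq> k \<longrightarrow> \<alpha> vs = 0)"

text \<open>
  Shuffle formula; \<open>S\<close> is the set of positions whose vectors are inserted into \<open>\<alpha>\<close>.
  The normalisation is \<open>(a \<and> b)(v, w) = a v * b w - a w * b v\<close> for one-forms.
\<close>

definition wedge :: "'v alt \<Rightarrow> 'v alt \<Rightarrow> 'v alt" where
  "wedge \<alpha> \<beta> vs =
     (\<Sum>S\<in>Pow {..<length vs}.
        (-1) ^ card {(i, j). i \<in> S \<and> j \<in> {..<length vs} - S \<and> j < i}
          * \<alpha> (nths vs S) * \<beta> (nths vs (- S)))"

definition one_alt :: "'v alt" where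
  "one_alt vs = (if vs = [] then 1 else 0)"

definition oneform :: "('v \<Rightarrow> complex) \<Rightarrow> 'v alt" where
  "oneform a vs = (if length vs = 1 then a (hd vs) else 0)"

definition dz :: "'n::finite \<Rightarrow> (complex^'n) alt" where
  "dz j = oneform (\<lambda>v. v $ j)"

definition dzbar :: "'n::finite \<Rightarrow> (complex^'n) alt" where
  "dzbar j = oneform (\<lambda>v. cnj (v $ j))"

text \<open>
  The multi-indices are not required to be increasing; this only makes the coefficients
  non-unique.
\<close>

definition bidegree :: "nat \<Rightarrow> nat \<Rightarrow> (complex^'n::finite) alt \<Rightarrow> bool" where
  "bidegree p q \<alpha> \<longleftrightarrow>
     (\<exists>c. \<forall>vs. \<alpha> vs =
        (\<Sum>I | length I = p. \<Sum>J | length J = q.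
           c I J * foldr wedge (map dz I @ map dzbar J) one_alt vs))"

definition bidegree_part :: "nat \<Rightarrow> nat \<Rightarrow> (complex^'n::finite) alt \<Rightarrow> (complex^'n) alt" where
  "bidegree_part p q \<alpha> =
     (THE F. (\<forall>r s. bidegree r s (F r s)) \<and>
             \<alpha> = (\<Sum>r\<le>CARD('n). \<Sum>s\<le>CARD('n). F r s)) p q"

subsection \<open>Hermitian metrics on the fibre\<close>

text \<open>A Hermitian metric is given by its (1,1)-form \<open>w\<close>; multiplication by \<open>\<i>\<close> is the complex structure.\<close>

definition positive_11 :: "(complex^'n::finite) alt \<Rightarrow> bool" where
  "positive_11 w \<longleftrightarrow> alternating w \<and> bidegree 1 1 w \<and> (\<forall>u v. w [u, v] \<in> \<real>) \<and>
     (\<forall>v. v \<noteq> 0 \<longrightarrow> 0 < Re (w [v, \<i> *s v]))"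

definition riem :: "(complex^'n::finite) alt \<Rightarrow> complex^'n \<Rightarrow> complex^'n \<Rightarrow> real" where
  "riem w u v = Re (w [u, \<i> *s v])"

definition orthonormal_frame :: "(complex^'n::finite) alt \<Rightarrow> (complex^'n) set \<Rightarrow> bool" where
  "orthonormal_frame w B \<longleftrightarrow> finite B \<and> card B = 2 * CARD('n) \<and>
     (\<forall>u\<in>B. \<forall>v\<in>B. riem w u v = (if u = v then 1 else 0))"

definition frame_of :: "(complex^'n::finite) alt \<Rightarrow> (complex^'n) set" where
  "frame_of w = (SOME B. orthonormal_frame w B)"

text \<open>
  The Hermitian inner product on forms induced by the Riemannian metric \<open>w(\<cdot>, \<i> \<cdot>)\<close>: for a real
  orthonormal frame, the products of distinct elements of the dual coframe are orthonormal (the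
  factorial compensates for summing over all lists).  The normalisation is the one in which
  \<open>w = \<i> * (\<Sum>j. \<zeta> j \<and> cnj (\<zeta> j))\<close> for a coframe \<open>\<zeta>\<close> of (1,0)-forms means that \<open>\<zeta>\<close> is
  orthonormal: then \<open>w [v, \<i> v] = 2 * (\<Sum>j. (cmod (\<zeta> j v))\<^sup>2)\<close>, so the real and imaginary parts of
  \<open>\<zeta> j\<close> have squared norm 1/2.  Lemma \<open>unitary_coframe_orthonormal\<close> below checks this.
\<close>

definition inner_alt :: "(complex^'n::finite) alt \<Rightarrow> (complex^'n) alt \<Rightarrow> (complex^'n) alt \<Rightarrow> complex" where
  "inner_alt w \<alpha> \<beta> =
     (\<Sum>vs | set vs \<subseteq> frame_of w \<and> length vs \<le> 2 * CARD('n).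
        \<alpha> vs * cnj (\<beta> vs) / fact (length vs))"

lemma sum_orthonormal_basis:
  fixes C :: "'v::euclidean_space set"
  assumes fin: "finite C" and card: "card C = DIM('v)"
    and on: "\<And>u v. u \<in> C \<Longrightarrow> v \<in> C \<Longrightarrow> u \<bullet> v = (if u = v then 1 else 0)"
  shows "(\<Sum>b\<in>C. (x \<bullet> b) * (y \<bullet> b)) = x \<bullet> y"
proof -
  have "pairwise orthogonal C"
    using on by (auto simp: pairwise_def orthogonal_def)
  moreover have "0 \<notin> C"
    using on[of 0 0] by auto
  ultimately have ind: "independent C"
    by (rule pairwise_orthogonal_independent)
  have "UNIV \<subseteq> span C"
    by (rule card_ge_dim_independent) (auto simp: ind card)
  then have "x \<in> span C" by auto
  then obtain r where r: "x = (\<Sum>b\<in>C. r b *\<^sub>R b)"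
    using span_finite[OF fin] by auto
  have "x \<bullet> b = r b" if "b \<in> C" for b
    using that fin by (simp add: r inner_sum_left on if_distrib cong: if_cong)
  then have "(\<Sum>b\<in>C. (x \<bullet> b) * (y \<bullet> b)) = (\<Sum>b\<in>C. r b * (y \<bullet> b))"
    by simp
  also have "\<dots> = x \<bullet> y"
    by (subst r) (simp add: inner_sum_left inner_commute[of y])
  finally show ?thesis .
qed

lemma unitary_coframe_orthonormal:
  fixes w :: "(complex^'n::finite) alt" and \<zeta> :: "'n \<Rightarrow> complex^'n \<Rightarrow> complex"
  assumes add: "\<And>j u v. \<zeta> j (u + v) = \<zeta> j u + \<zeta> j v"
    and scale: "\<And>j a v. \<zeta> j (a *s v) = a * \<zeta> j v"
    and w: "\<And>u v. w [u, v] = \<i> * (\<Sum>j\<in>UNIV. \<zeta> j u * cnj (\<zeta> j v) - \<zeta> j v * cnj (\<zeta> j u))"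
    and pos: "positive_11 w"
  shows "inner_alt w (oneform (\<zeta> i)) (oneform (\<zeta> j)) = (if i = j then 1 else 0)"
proof -
  define P where "P u = (\<chi> k. complex_of_real (sqrt 2) * \<zeta> k u)" for u
  have PP: "riem w u v = P u \<bullet> P v" for u v
  proof -
    have "Re (\<i> * (\<zeta> k u * cnj (\<i> * \<zeta> k v) - \<i> * \<zeta> k v * cnj (\<zeta> k u)))
        = (complex_of_real (sqrt 2) * \<zeta> k u) \<bullet> (complex_of_real (sqrt 2) * \<zeta> k v)" for k
      by (simp add: inner_complex_def algebra_simps)
    then show ?thesis
      unfolding riem_def w scale P_def inner_vec_def sum_distrib_left Re_sum by simp
  qed
  have sR: "r *\<^sub>R v = complex_of_real r *s v" for r and v :: "complex^'n"
    unfolding vec_eq_iff vector_scaleR_component by (simp add: scaleR_conv_of_real)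
  have lin: "linear P"
    unfolding P_def sR
    by (rule linearI) (auto simp: vec_eq_iff add sR scale algebra_simps)
  have "u = 0" if "P u = 0" for u
    using pos PP[of u u] that unfolding positive_11_def riem_def by force
  then have inj: "inj P"
    using lin linear_injective_0 by blast
  then have bij: "bij P"
    using lin linear_injective_imp_surjective bij_def by blast
  have dim: "DIM(complex^'n) = 2 * CARD('n)"
    by simp
  have "orthonormal_frame w (inv P ` Basis)"
    unfolding orthonormal_frame_def
  proof (intro conjI ballI)
    show "card (inv P ` (Basis :: (complex^'n) set)) = 2 * CARD('n)"
      using dim bij by (metis bij_imp_bij_inv bij_is_inj card_image inj_on_subset subset_UNIV)
  next
    fix u v assume "u \<in> inv P ` Basis" "v \<in> inv P ` Basis"
    then obtain a b where ab: "u = inv P a" "v = inv P b" "a \<in> Basis" "b \<in> Basis"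
      by auto
    have "P u = a" "P v = b"
      using ab bij by (auto simp: bij_is_surj surj_f_inv_f)
    then show "riem w u v = (if u = v then 1 else 0)"
      using ab by (auto simp: PP inner_Basis)
  qed auto
  then have B: "orthonormal_frame w (frame_of w)"
    unfolding frame_of_def by (rule someI)
  let ?B = "frame_of w"
  have fin: "finite ?B" and cB: "card ?B = 2 * CARD('n)"
    using B by (auto simp: orthonormal_frame_def)
  have injB: "inj_on P ?B"
    using inj inj_on_subset by blast
  have par: "(\<Sum>f\<in>?B. (x \<bullet> P f) * (y \<bullet> P f)) = x \<bullet> y" for x y
  proof -
    have "(\<Sum>b\<in>P ` ?B. (x \<bullet> b) * (y \<bullet> b)) = x \<bullet> y"
      using fin cB injB B inj
      by (intro sum_orthonormal_basis)
        (auto simp: card_image orthonormal_frame_def PP[symmetric] inj_eq)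
    then show ?thesis
      by (simp add: sum.reindex[OF injB])
  qed
  let ?L = "{vs. set vs \<subseteq> ?B \<and> length vs \<le> 2 * CARD('n)}"
  have "inner_alt w (oneform (\<zeta> i)) (oneform (\<zeta> j))
      = (\<Sum>vs\<in>(\<lambda>f. [f]) ` ?B. oneform (\<zeta> i) vs * cnj (oneform (\<zeta> j) vs) / fact (length vs))"
    unfolding inner_alt_def
  proof (rule sum.mono_neutral_right)
    show "finite ?L"
      using fin finite_lists_length_le by blast
    have "1 \<le> CARD('n)"
      by (simp add: Suc_leI)
    then show "(\<lambda>f. [f]) ` ?B \<subseteq> ?L" by auto
    show "\<forall>vs\<in>?L - (\<lambda>f. [f]) ` ?B.
        oneform (\<zeta> i) vs * cnj (oneform (\<zeta> j) vs) / fact (length vs) = 0"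
      by (auto simp: oneform_def length_Suc_conv image_iff)
  qed
  also have "\<dots> = (\<Sum>f\<in>?B. \<zeta> i f * cnj (\<zeta> j f))"
    by (subst sum.reindex) (auto simp: oneform_def inj_on_def)
  also have "\<dots> = (\<Sum>f\<in>?B. (1/2) * (P f $ i * cnj (P f $ j)))"
  proof (rule sum.cong)
    fix f
    have s: "complex_of_real (sqrt 2) * complex_of_real (sqrt 2) = 2"
      by (metis of_real_mult of_real_numeral real_sqrt_mult_self abs_numeral)
    have "P f $ i * cnj (P f $ j)
        = (complex_of_real (sqrt 2) * complex_of_real (sqrt 2)) * (\<zeta> i f * cnj (\<zeta> j f))"
      by (simp add: P_def)
    then show "\<zeta> i f * cnj (\<zeta> j f) = (1/2) * (P f $ i * cnj (P f $ j))"
      by (simp add: s)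
  qed simp
  also have "\<dots> = (1/2) * (\<Sum>f\<in>?B. P f $ i * cnj (P f $ j))"
    by (simp add: sum_distrib_left)
  also have "(\<Sum>f\<in>?B. P f $ i * cnj (P f $ j)) = (if i = j then 2 else 0)"
  proof (rule complex_eqI)
    have c: "Re (P f $ k) = axis k 1 \<bullet> P f" "Im (P f $ k) = axis k \<i> \<bullet> P f" for f k
      by (simp_all add: inner_axis' inner_complex_def)
    show "Re (\<Sum>f\<in>?B. P f $ i * cnj (P f $ j)) = Re (if i = j then 2 else 0)"
      by (simp add: c sum.distrib par inner_axis_axis)
    show "Im (\<Sum>f\<in>?B. P f $ i * cnj (P f $ j)) = Im (if i = j then 2 else 0)"
      by (simp add: c sum.distrib sum_subtractf par inner_axis_axis inner_complex_def)
  qed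
  also have "(1/2) * (if i = j then 2 else 0) = (if i = j then 1 else (0::complex))"
    by simp
  finally show ?thesis .
qed

definition twisted_inner_alt ::
    "real \<Rightarrow> (complex^'n::finite) alt \<Rightarrow> (complex^'n) alt \<Rightarrow> (complex^'n) alt \<Rightarrow> complex" where
  "twisted_inner_alt t w \<alpha> \<beta> =
     (\<Sum>p\<le>CARD('n). \<Sum>q\<le>CARD('n).
        of_real (t ^ (2 * p)) * inner_alt w (bidegree_part p q \<alpha>) (bidegree_part p q \<beta>))"

definition Lambda_alt :: "(complex^'n::finite) alt \<Rightarrow> (complex^'n) alt \<Rightarrow> (complex^'n) alt" where
  "Lambda_alt w \<alpha> =
     (THE \<beta>. alternating \<beta> \<and>
        (\<forall>\<gamma>. alternating \<gamma> \<longrightarrow> inner_alt w (wedge w \<gamma>) \<alpha> = inner_alt w \<gamma> \<beta>))"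

text \<open>
  Density of the volume form with respect to Lebesgue measure on \<open>complex^'n\<close>: the square root of
  the Gram determinant of the real coordinate basis (which also equals the density of
  \<open>w\<^sup>n / n!\<close>).  The determinant is positive when \<open>w\<close> is.
\<close>

definition real_basis :: "'n::finite \<times> bool \<Rightarrow> complex^'n" where
  "real_basis b = axis (fst b) (if snd b then \<i> else 1)"

definition vol_density :: "(complex^'n::finite) alt \<Rightarrow> real" where
  "vol_density w =
     sqrt \<bar>det (\<chi> a b. riem w (real_basis a) (real_basis b) :: real^('n \<times> bool)^('n \<times> bool))\<bar>"

section \<open>Complex manifolds and differential forms\<close>

fun Ck_on :: "nat \<Rightarrow> 'v::real_normed_vector set \<Rightarrow> ('v \<Rightarrow> complex) \<Rightarrow> bool" where
  "Ck_on 0 S f \<longleftrightarrow> continuous_on S f"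
| "Ck_on (Suc k) S f \<longleftrightarrow> (\<forall>x\<in>S. f differentiable (at x)) \<and>
     (\<forall>v. Ck_on k S (\<lambda>x. frechet_derivative f (at x) v))"

text \<open>To be used on open sets only.\<close>

definition smooth_on :: "'v::real_normed_vector set \<Rightarrow> ('v \<Rightarrow> complex) \<Rightarrow> bool" where
  "smooth_on S f \<longleftrightarrow> (\<forall>k. Ck_on k S f)"

text \<open>A chart is its domain together with a coordinate map, relevant on the domain only.\<close>

type_synonym ('x, 'n) chart = "'x set \<times> ('x \<Rightarrow> complex^'n)"

abbreviation chart_inv :: "('x, 'n::finite) chart \<Rightarrow> complex^'n \<Rightarrow> 'x" where
  "chart_inv c \<equiv> inv_into (fst c) (snd c)"

abbreviation chart_image :: "('x, 'n::finite) chart \<Rightarrow> (complex^'n) set" where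
  "chart_image c \<equiv> snd c ` fst c"

definition transition ::
    "('x, 'n::finite) chart \<Rightarrow> ('x, 'n) chart \<Rightarrow> complex^'n \<Rightarrow> complex^'n" where
  "transition c c' = snd c' \<circ> chart_inv c"

definition holomorphic_at :: "(complex^'n \<Rightarrow> complex^'n) \<Rightarrow> complex^'n::finite \<Rightarrow> bool" where
  "holomorphic_at f z \<longleftrightarrow>
     (\<exists>L. (f has_derivative L) (at z) \<and> (\<forall>a v. L (a *s v) = a *s L v))"

text \<open>A holomorphic atlas (of complex dimension \<open>CARD('n)\<close>) on the whole space \<open>'x\<close>.\<close>

definition complex_atlas :: "('x::topological_space, 'n::finite) chart set \<Rightarrow> bool" where
  "complex_atlas A \<longleftrightarrow>
     (\<Union>c\<in>A. fst c) = UNIV \<and>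
     (\<forall>c\<in>A. open (fst c) \<and> open (chart_image c) \<and>
        homeomorphism (fst c) (chart_image c) (snd c) (chart_inv c)) \<and>
     (\<forall>c\<in>A. \<forall>c'\<in>A. \<forall>z \<in> snd c ` (fst c \<inter> fst c'). holomorphic_at (transition c c') z)"

text \<open>
  A differential form is the family \<open>u\<close> of its expressions in the charts: \<open>u c x\<close> is the value at
  \<open>x\<close>, the tangent space at \<open>x\<close> being identified with \<open>complex^'n\<close> by the chart \<open>c\<close>.  It is set to
  zero where \<open>c\<close> is not a chart around \<open>x\<close>, so that equality of forms is equality of functions.
\<close>

type_synonym ('x, 'n) dform = "('x, 'n) chart \<Rightarrow> 'x \<Rightarrow> (complex^'n) alt"

definition smooth_forms ::
    "('x::topological_space, 'n::finite) chart set \<Rightarrow> int \<Rightarrow> ('x, 'n) dform set" where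
  "smooth_forms A k = {u.
     (\<forall>c x. \<not> (c \<in> A \<and> x \<in> fst c) \<longrightarrow> u c x = 0) \<and>
     (\<forall>c x. alternating (u c x) \<and> has_degree k (u c x)) \<and>
     (\<forall>c\<in>A. \<forall>c'\<in>A. \<forall>x \<in> fst c \<inter> fst c'. \<forall>vs.
        u c x vs = u c' x (map (frechet_derivative (transition c c') (at (snd c x))) vs)) \<and>
     (\<forall>c\<in>A. \<forall>vs. smooth_on (chart_image c) (\<lambda>z. u c (chart_inv c z) vs))}"

definition smooth_pq_forms ::
    "('x::topological_space, 'n::finite) chart set \<Rightarrow> nat \<Rightarrow> nat \<Rightarrow> ('x, 'n) dform set" where
  "smooth_pq_forms A p q = {u \<in> smooth_forms A (int (p + q)). \<forall>c x. bidegree p q (u c x)}"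

definition function_form ::
    "('x, 'n::finite) chart set \<Rightarrow> ('x \<Rightarrow> complex) \<Rightarrow> ('x, 'n) dform" where
  "function_form A f = (\<lambda>c x vs. if c \<in> A \<and> x \<in> fst c \<and> vs = [] then f x else 0)"

definition smooth_function ::
    "('x::topological_space, 'n::finite) chart set \<Rightarrow> ('x \<Rightarrow> complex) \<Rightarrow> bool" where
  "smooth_function A f \<longleftrightarrow> (\<forall>c\<in>A. smooth_on (chart_image c) (\<lambda>z. f (chart_inv c z)))"

definition hermitian_metric ::
    "('x::topological_space, 'n::finite) chart set \<Rightarrow> ('x, 'n) dform \<Rightarrow> bool" where
  "hermitian_metric A \<omega> \<longleftrightarrow>
     \<omega> \<in> smooth_forms A 2 \<and> (\<forall>c\<in>A. \<forall>x\<in>fst c. positive_11 (\<omega> c x))"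

subsection \<open>Pointwise operators\<close>

definition fmult :: "('x \<Rightarrow> complex) \<Rightarrow> ('x, 'n::finite) dform \<Rightarrow> ('x, 'n) dform" where
  "fmult f u = (\<lambda>c x vs. f x * u c x vs)"

definition wedge_form ::
    "('x, 'n::finite) dform \<Rightarrow> ('x, 'n) dform \<Rightarrow> ('x, 'n) dform" where
  "wedge_form a u = (\<lambda>c x. wedge (a c x) (u c x))"

definition pq_part :: "nat \<Rightarrow> nat \<Rightarrow> ('x, 'n::finite) dform \<Rightarrow> ('x, 'n) dform" where
  "pq_part p q u = (\<lambda>c x. bidegree_part p q (u c x))"

definition theta :: "('x \<Rightarrow> real) \<Rightarrow> ('x, 'n::finite) dform \<Rightarrow> ('x, 'n) dform" where
  "theta \<eta> u = (\<Sum>p\<le>CARD('n). \<Sum>q\<le>CARD('n). fmult (\<lambda>x. of_real (\<eta> x ^ p)) (pq_part p q u))"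

definition theta_inv :: "('x \<Rightarrow> real) \<Rightarrow> ('x, 'n::finite) dform \<Rightarrow> ('x, 'n) dform" where
  "theta_inv \<eta> = theta (\<lambda>x. inverse (\<eta> x))"

definition Lambda ::
    "('x, 'n::finite) chart set \<Rightarrow> ('x, 'n) dform \<Rightarrow> ('x, 'n) dform \<Rightarrow> ('x, 'n) dform" where
  "Lambda A \<omega> u = (\<lambda>c x. if c \<in> A \<and> x \<in> fst c then Lambda_alt (\<omega> c x) (u c x) else 0)"

definition graded_commutator ::
    "int \<Rightarrow> int \<Rightarrow> (('x, 'n::finite) dform \<Rightarrow> ('x, 'n) dform) \<Rightarrow> (('x, 'n) dform \<Rightarrow> ('x, 'n) dform)
      \<Rightarrow> ('x, 'n) dform \<Rightarrow> ('x, 'n) dform" where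
  "graded_commutator a b P Q u =
     P (Q u) - fmult (\<lambda>_. if even (a * b) then 1 else -1) (Q (P u))"

subsection \<open>Exterior derivative\<close>

definition ext_d :: "('x, 'n::finite) chart set \<Rightarrow> ('x, 'n) dform \<Rightarrow> ('x, 'n) dform" where
  "ext_d A u = (\<lambda>c x vs. if c \<in> A \<and> x \<in> fst c then
     (\<Sum>j<length vs. (-1) ^ j *
        frechet_derivative (\<lambda>z. u c (chart_inv c z) (take j vs @ drop (Suc j) vs))
          (at (snd c x)) (vs ! j))
     else 0)"

definition del_function ::
    "('x, 'n::finite) chart set \<Rightarrow> ('x \<Rightarrow> complex) \<Rightarrow> ('x, 'n) dform" where
  "del_function A f = pq_part 1 0 (ext_d A (function_form A f))"

definition delbar_function ::
    "('x, 'n::finite) chart set \<Rightarrow> ('x \<Rightarrow> complex) \<Rightarrow> ('x, 'n) dform" where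
  "delbar_function A f = pq_part 0 1 (ext_d A (function_form A f))"

definition D_eta ::
    "('x, 'n::finite) chart set \<Rightarrow> ('x \<Rightarrow> real) \<Rightarrow> ('x, 'n) dform \<Rightarrow> ('x, 'n) dform" where
  "D_eta A \<eta> = theta \<eta> \<circ> ext_d A \<circ> theta_inv \<eta>"

subsection \<open>Integration and formal adjoints\<close>

text \<open>
  Integrals over a compact manifold are defined by a finite partition of unity subordinate to the
  atlas.  The value does not depend on its choice; continuous partitions suffice for integration.
\<close>

definition partition_of_unity ::
    "('x::topological_space, 'n::finite) chart set \<Rightarrow> (('x, 'n) chart \<Rightarrow> 'x \<Rightarrow> real) \<Rightarrow> bool" where
  "partition_of_unity A \<rho> \<longleftrightarrow>
     finite {c. \<rho> c \<noteq> 0} \<and> {c. \<rho> c \<noteq> 0} \<subseteq> A \<and>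
     (\<forall>c. continuous_on UNIV (\<rho> c) \<and> (\<forall>x. 0 \<le> \<rho> c x) \<and> closure {x. \<rho> c x \<noteq> 0} \<subseteq> fst c) \<and>
     (\<forall>x. (\<Sum>c | \<rho> c \<noteq> 0. \<rho> c x) = 1)"

text \<open>
  The integral of \<open>f\<close> against the volume form of \<open>\<omega>\<close>; \<open>f c\<close> is the expression of the integrand in
  the chart \<open>c\<close>.
\<close>

definition integral_vol ::
    "('x::topological_space, 'n::finite) chart set \<Rightarrow> ('x, 'n) dform \<Rightarrow>
      (('x, 'n) chart \<Rightarrow> 'x \<Rightarrow> complex) \<Rightarrow> complex" where
  "integral_vol A \<omega> f =
     (let \<rho> = (SOME \<rho>. partition_of_unity A \<rho>) in
      \<Sum>c | \<rho> c \<noteq> 0. set_lebesgue_integral lborel (chart_image c)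
        (\<lambda>z. let x = chart_inv c z in of_real (\<rho> c x * vol_density (\<omega> c x)) * f c x))"

definition L2_inner ::
    "('x::topological_space, 'n::finite) chart set \<Rightarrow> ('x, 'n) dform \<Rightarrow>
      ('x, 'n) dform \<Rightarrow> ('x, 'n) dform \<Rightarrow> complex" where
  "L2_inner A \<omega> u v = integral_vol A \<omega> (\<lambda>c x. inner_alt (\<omega> c x) (u c x) (v c x))"

text \<open>The factor \<open>1 / \<eta>\<^sup>2\<^sup>n\<close> turns the volume form of \<open>\<omega>\<close> into that of \<open>\<omega> / \<eta>\<^sup>2\<close>.\<close>

definition twisted_L2_inner ::
    "('x::topological_space, 'n::finite) chart set \<Rightarrow> ('x, 'n) dform \<Rightarrow> ('x \<Rightarrow> real) \<Rightarrow>
      ('x, 'n) dform \<Rightarrow> ('x, 'n) dform \<Rightarrow> complex" where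
  "twisted_L2_inner A \<omega> \<eta> u v =
     integral_vol A \<omega> (\<lambda>c x. twisted_inner_alt (\<eta> x) (\<omega> c x) (u c x) (v c x)
                              * of_real (1 / \<eta> x ^ (2 * CARD('n))))"

definition linear_operator ::
    "('x, 'n::finite) dform set \<Rightarrow> ('x, 'n) dform set \<Rightarrow> (('x, 'n) dform \<Rightarrow> ('x, 'n) dform) \<Rightarrow> bool" where
  "linear_operator V W T \<longleftrightarrow> (\<forall>u\<in>V. T u \<in> W) \<and>
     (\<forall>u\<in>V. \<forall>v\<in>V. T (u + v) = T u + T v) \<and>
     (\<forall>a. \<forall>u\<in>V. T (fmult (\<lambda>_. a) u) = fmult (\<lambda>_. a) (T u))"

text \<open>
  \<open>Q\<close> is, in degree \<open>k\<close>, the formal adjoint of the operator \<open>P\<close> from forms of degree \<open>k - 1\<close> to forms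
  of degree \<open>k\<close>.
\<close>

definition formal_adjoint ::
    "('x::topological_space, 'n::finite) chart set \<Rightarrow>
      (('x, 'n) dform \<Rightarrow> ('x, 'n) dform \<Rightarrow> complex) \<Rightarrow> int \<Rightarrow>
      (('x, 'n) dform \<Rightarrow> ('x, 'n) dform) \<Rightarrow> (('x, 'n) dform \<Rightarrow> ('x, 'n) dform) \<Rightarrow> bool" where
  "formal_adjoint A ip k P Q \<longleftrightarrow>
     linear_operator (smooth_forms A k) (smooth_forms A (k - 1)) Q \<and>
     (\<forall>u \<in> smooth_forms A (k - 1). \<forall>v \<in> smooth_forms A k. ip (P u) v = ip u (Q v))"

subsection \<open>The operators in the formula for the adjoint\<close>

text \<open>\<open>dstar\<close> stands for the formal adjoint of \<open>d\<close> for the twisted \<open>L\<^sup>2\<close>-inner product.\<close>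

definition T_p_star ::
    "('x, 'n::finite) chart set \<Rightarrow> ('x, 'n) dform \<Rightarrow> ('x \<Rightarrow> real) \<Rightarrow>
      (('x, 'n) dform \<Rightarrow> ('x, 'n) dform) \<Rightarrow> nat \<Rightarrow> ('x, 'n) dform \<Rightarrow> ('x, 'n) dform" where
  "T_p_star A \<omega> \<eta> dstar p u =
     (let h = (\<lambda>x. complex_of_real (\<eta> x));
          a = fmult (\<lambda>_. \<i>) (fmult (\<lambda>x. 1 / h x) (del_function A h) - fmult h (delbar_function A h));
          w = theta \<eta> (theta \<eta> u)
      in fmult (\<lambda>x. 1 / h x ^ (2 * p))
           (dstar w - fmult (\<lambda>_. 2 * (of_nat CARD('n) - of_nat p))
              (graded_commutator (-2) 1 (Lambda A \<omega>) (wedge_form a) w)))"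

definition T_star ::
    "('x, 'n::finite) chart set \<Rightarrow> ('x, 'n) dform \<Rightarrow> ('x \<Rightarrow> real) \<Rightarrow>
      (('x, 'n) dform \<Rightarrow> ('x, 'n) dform) \<Rightarrow> nat \<Rightarrow> ('x, 'n) dform \<Rightarrow> ('x, 'n) dform" where
  "T_star A \<omega> \<eta> dstar k u = (\<Sum>p\<le>k. T_p_star A \<omega> \<eta> dstar p (pq_part p (k - p) u))"

end

theory Submission
  imports Defs
begin

text \<open>
  Since \<open>dV\<^sub>\<omega> = \<eta>\<^sup>2\<^sup>n dV\<close> for the twisted volume form \<open>dV\<close> and \<open>\<theta>\<^sub>\<eta>\<close> is pointwise
  self-adjoint, the adjoint of \<open>\<theta>\<^sub>\<eta> d \<theta>\<^sub>\<eta>\<^sup>-\<^sup>1\<close> is \<open>\<theta>\<^sub>\<eta> T \<theta>\<^sub>\<eta>\<^sup>-\<^sup>1\<close> with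
  \<open>T = \<eta>\<^sup>-\<^sup>2\<^sup>n d\<^sup>\<star> \<eta>\<^sup>2\<^sup>n\<close>, where \<open>d\<^sup>\<star>\<close> is the twisted adjoint of \<open>d\<close>.  On forms of type
  \<open>(p, q)\<close> the factor \<open>\<eta>\<^sup>2\<^sup>n\<close> is \<open>f \<theta>\<^sub>\<eta>\<^sup>2\<close> with \<open>f = \<eta>\<^sup>2\<^sup>(\<^sup>n\<^sup>-\<^sup>p\<^sup>)\<close>, and the Leibniz rule
  \<open>d\<^sup>\<star> (f v) = f d\<^sup>\<star> v - (df \<and>)\<^sup>\<star> v\<close> produces the commutator: by the pointwise identities
  \<open>[\<Lambda>, \<i> \<alpha> \<and>] = (cnj \<alpha> \<and>)\<^sup>\<star>\<close> and \<open>[\<Lambda>, \<i> cnj \<alpha> \<and>] = - (\<alpha> \<and>)\<^sup>\<star>\<close> for \<open>\<alpha>\<close> of type \<open>(1, 0)\<close>,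
  it is the twisted adjoint of \<open>(d\<eta> / \<eta>) \<and>\<close>.

  The Leibniz rule and the uniqueness of the adjoint both reduce to the vanishing of a smooth form
  orthogonal to all smooth forms, hence to itself.  No bump forms are needed, but the contraction
  \<open>(df \<and>)\<^sup>\<star>\<close> has to be smooth; in real coordinates it involves the inverse Gram matrix of the
  metric, given by Cramer's rule.
\<close>

section \<open>The exterior algebra\<close>

text \<open>The pointwise identities are proved by induction on the list of arguments: contraction
  with the first vector is a graded derivation of the wedge product (\<open>wedge_Cons\<close>), and
  the inner product is an iterated sum of contractions (\<open>frame_sum\<close>). The shuffle signs
  are computed once.

  The metric enters through a frame chosen by \<open>SOME\<close> at each point, which need not vary
  continuously. What is computed with it is therefore recognised as a trace of a bilinear form,
  which is independent of the frame and has an expression in fixed coordinates.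

  Bidegree parts are a definite description, so existence and uniqueness of the decomposition
  precede every use of \<open>theta\<close>. The weights of the circle action supply explicit
  projections, and these commute with the complex linear derivatives of chart changes.

  The operator \<open>dstar\<close> is any operator with the adjoint identity in degree k, so it is
  accessible only by pairing with test forms. Derivatives of test forms occur only under the
  integral, where alternating values and continuous coefficients suffice.\<close>

definition ctr :: "'v \<Rightarrow> 'v alt \<Rightarrow> 'v alt" where
  "ctr v \<alpha> = (\<lambda>vs. \<alpha> (v # vs))"

definition smul :: "complex \<Rightarrow> 'v alt \<Rightarrow> 'v alt" where
  "smul c \<alpha> = (\<lambda>vs. c * \<alpha> vs)"

text \<open>The grading involution. Carrying the sign as an operator lets the derivation rule
  \<open>ctr_wedge\<close> be stated for forms that are not homogeneous.\<close>

definition hat :: "'v alt \<Rightarrow> 'v alt" where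
  "hat \<alpha> = (\<lambda>vs. (-1) ^ length vs * \<alpha> vs)"

lemma ctr_apply: "ctr v \<alpha> vs = \<alpha> (v # vs)"
  and smul_apply: "smul c \<alpha> vs = c * \<alpha> vs"
  and hat_apply: "hat \<alpha> vs = (-1) ^ length vs * \<alpha> vs"
  by (simp_all add: ctr_def smul_def hat_def)

lemma sum_fun_apply: "(\<Sum>i\<in>I. f i) x = (\<Sum>i\<in>I. f i x)"
  for f :: "'i \<Rightarrow> 'a \<Rightarrow> 'b::comm_monoid_add"
  by (induction I rule: infinite_finite_induct) auto

lemma ctr_add: "ctr v (\<alpha> + \<beta>) = ctr v \<alpha> + ctr v \<beta>"
  and ctr_diff: "ctr v (\<alpha> - \<beta>) = ctr v \<alpha> - ctr v \<beta>"
  and ctr_smul: "ctr v (smul c \<alpha>) = smul c (ctr v \<alpha>)"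
  and ctr_hat: "ctr v (hat \<alpha>) = - hat (ctr v \<alpha>)"
  and ctr_zero: "ctr v 0 = 0"
  by (auto simp: ctr_def smul_def hat_def fun_eq_iff)

lemma hat_hat [simp]: "hat (hat \<alpha>) = \<alpha>"
  by (auto simp: hat_def fun_eq_iff mult.assoc[symmetric] power_mult_distrib[symmetric])

section \<open>The wedge product and contraction by the first argument\<close>

lemma wedge_Nil: "wedge \<alpha> \<beta> [] = \<alpha> [] * \<beta> []"
proof -
  have "{(i, j). i \<in> ({}::nat set) \<and> j \<in> ({}::nat set) \<and> j < i} = {}" by auto
  then show ?thesis by (simp add: wedge_def)
qed

text \<open>Split the position sets \<open>S\<close> by whether the first vector goes into \<alpha>.
  If it does, shifting the other positions preserves the inversions. If it does not, each of the
  \<open>card S\<close> positions in \<open>S\<close> gains one inversion with position 0, and this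
  is the sign in \<open>hat \<alpha>\<close>.\<close>

lemma wedge_Cons:
  "wedge \<alpha> \<beta> (v # vs) = wedge (ctr v \<alpha>) \<beta> vs + wedge (hat \<alpha>) (ctr v \<beta>) vs"
proof -
  let ?n = "length vs"
  define inv where "inv n S = {(i, j). i \<in> S \<and> j \<in> {..<n} - S \<and> j < i}" for n and S :: "nat set"
  define g where "g S = (-1) ^ card (inv (Suc ?n) S)
          * \<alpha> (nths (v # vs) S) * \<beta> (nths (v # vs) (- S))" for S
  have inj: "inj_on (map_prod Suc Suc) I" for I
    by (rule inj_on_subset[of _ UNIV]) (auto simp: prod.inj_map)
  have fin: "finite (inv n S)" if "finite S" for n S
    by (rule finite_subset[of _ "S \<times> {..<n}"]) (auto simp: inv_def that)
  have "wedge \<alpha> \<beta> (v # vs) = sum g (Pow {..<Suc ?n})"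
    unfolding wedge_def g_def inv_def by simp
  also have "Pow {..<Suc ?n} = (image Suc) ` Pow {..<?n} \<union> (\<lambda>S. insert 0 (Suc ` S)) ` Pow {..<?n}"
    unfolding lessThan_Suc_eq_insert_0 Pow_insert image_Pow_surj[OF refl, of Suc "{..<?n}", symmetric]
    by (simp add: image_image)
  also have "sum g \<dots> = sum g ((image Suc) ` Pow {..<?n}) + sum g ((\<lambda>S. insert 0 (Suc ` S)) ` Pow {..<?n})"
    by (rule sum.union_disjoint) auto
  also have "sum g ((image Suc) ` Pow {..<?n}) = (\<Sum>S\<in>Pow {..<?n}. g (Suc ` S))"
    by (subst sum.reindex) (auto simp: inj_on_def inj_image_eq_iff)
  also have "sum g ((\<lambda>S. insert 0 (Suc ` S)) ` Pow {..<?n}) = (\<Sum>S\<in>Pow {..<?n}. g (insert 0 (Suc ` S)))"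
  proof (subst sum.reindex)
    show "inj_on (\<lambda>S. insert 0 (Suc ` S)) (Pow {..<?n})"
      by (rule inj_onI) (metis Zero_not_Suc image_iff insert_ident inj_Suc inj_image_eq_iff)
  qed auto
  also have "(\<Sum>S\<in>Pow {..<?n}. g (insert 0 (Suc ` S))) = wedge (ctr v \<alpha>) \<beta> vs"
    unfolding wedge_def
  proof (rule sum.cong[OF refl])
    fix S assume "S \<in> Pow {..<?n}"
    have "inv (Suc ?n) (insert 0 (Suc ` S)) = map_prod Suc Suc ` inv ?n S"
    proof (rule set_eqI, clarify)
      fix i j
      show "(i, j) \<in> inv (Suc ?n) (insert 0 (Suc ` S)) \<longleftrightarrow> (i, j) \<in> map_prod Suc Suc ` inv ?n S"
        by (cases i; cases j) (auto simp: inv_def)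
    qed
    then have "card (inv (Suc ?n) (insert 0 (Suc ` S))) = card (inv ?n S)"
      by (simp add: card_image inj)
    moreover have "nths (v # vs) (insert 0 (Suc ` S)) = v # nths vs S"
      by (simp add: nths_Cons image_iff)
    moreover have "nths (v # vs) (- insert 0 (Suc ` S)) = nths vs (- S)"
      by (auto simp: nths_Cons intro!: arg_cong[of _ _ "nths vs"])
    ultimately show "g (insert 0 (Suc ` S)) = (- 1) ^ card {(i, j). i \<in> S \<and> j \<in> {..<?n} - S \<and> j < i} *
         ctr v \<alpha> (nths vs S) * \<beta> (nths vs (- S))"
      by (simp add: g_def ctr_def inv_def)
  qed
  also have "(\<Sum>S\<in>Pow {..<?n}. g (Suc ` S)) = wedge (hat \<alpha>) (ctr v \<beta>) vs"
    unfolding wedge_def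
  proof (rule sum.cong[OF refl])
    fix S assume S: "S \<in> Pow {..<?n}"
    then have fS: "finite S" using finite_subset by auto
    have "inv (Suc ?n) (Suc ` S) = map_prod Suc Suc ` inv ?n S \<union> (\<lambda>i. (Suc i, 0)) ` S"
    proof (rule set_eqI, clarify)
      fix i j
      show "(i, j) \<in> inv (Suc ?n) (Suc ` S)
        \<longleftrightarrow> (i, j) \<in> map_prod Suc Suc ` inv ?n S \<union> (\<lambda>i. (Suc i, 0)) ` S"
        by (cases i; cases j) (auto simp: inv_def)
    qed
    moreover have "card (map_prod Suc Suc ` inv ?n S \<union> (\<lambda>i. (Suc i, 0)) ` S) = card (inv ?n S) + card S"
      by (subst card_Un_disjoint) (auto simp: fS fin card_image[OF inj] card_image inj_on_def)
    ultimately have "card (inv (Suc ?n) (Suc ` S)) = card (inv ?n S) + card S"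
      by simp
    moreover have "nths (v # vs) (Suc ` S) = nths vs S"
      by (simp add: nths_Cons image_iff)
    moreover have "nths (v # vs) (- Suc ` S) = v # nths vs (- S)"
      by (auto simp: nths_Cons intro!: arg_cong[of _ _ "nths vs"])
    moreover have "{i. i < ?n \<and> i \<in> S} = S" using S by auto
    ultimately show "g (Suc ` S) = (- 1) ^ card {(i, j). i \<in> S \<and> j \<in> {..<?n} - S \<and> j < i} *
         hat \<alpha> (nths vs S) * ctr v \<beta> (nths vs (- S))"
      by (simp add: g_def ctr_def inv_def hat_def length_nths power_add)
  qed
  finally show ?thesis by (simp add: add.commute)
qed

lemma ctr_wedge: "ctr v (wedge \<alpha> \<beta>) = wedge (ctr v \<alpha>) \<beta> + wedge (hat \<alpha>) (ctr v \<beta>)"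
  by (simp add: fun_eq_iff ctr_apply wedge_Cons)

lemma wedge_add_left: "wedge (\<alpha> + \<beta>) \<gamma> = wedge \<alpha> \<gamma> + wedge \<beta> \<gamma>"
  and wedge_add_right: "wedge \<gamma> (\<alpha> + \<beta>) = wedge \<gamma> \<alpha> + wedge \<gamma> \<beta>"
  and wedge_smul_left: "wedge (smul c \<alpha>) \<gamma> = smul c (wedge \<alpha> \<gamma>)"
  and wedge_smul_right: "wedge \<gamma> (smul c \<alpha>) = smul c (wedge \<gamma> \<alpha>)"
  and wedge_zero_left [simp]: "wedge 0 \<gamma> = 0"
  and wedge_zero_right [simp]: "wedge \<gamma> 0 = 0"
  by (simp_all add: fun_eq_iff wedge_def smul_def sum.distrib sum_distrib_left algebra_simps)

lemma wedge_minus_left: "wedge (- \<alpha>) \<gamma> = - wedge \<alpha> \<gamma>"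
  and wedge_minus_right: "wedge \<gamma> (- \<alpha>) = - wedge \<gamma> \<alpha>"
  by (simp_all add: fun_eq_iff wedge_def sum_negf)

lemma wedge_sum_left: "wedge (\<Sum>i\<in>I. f i) \<gamma> = (\<Sum>i\<in>I. wedge (f i) \<gamma>)"
  using sum_comp_morphism[of "\<lambda>\<alpha>. wedge \<alpha> \<gamma>" f I] by (simp add: wedge_add_left comp_def)

lemma wedge_sum_right: "wedge \<gamma> (\<Sum>i\<in>I. f i) = (\<Sum>i\<in>I. wedge \<gamma> (f i))"
  using sum_comp_morphism[of "wedge \<gamma>" f I] by (simp add: wedge_add_right comp_def)

lemma hat_wedge: "hat (wedge \<alpha> \<beta>) = wedge (hat \<alpha>) (hat \<beta>)"
proof
  fix vs
  show "hat (wedge \<alpha> \<beta>) vs = wedge (hat \<alpha>) (hat \<beta>) vs"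
  proof (induction vs arbitrary: \<alpha> \<beta>)
    case (Cons v vs)
    have "hat (wedge \<alpha> \<beta>) (v # vs) = - (hat (wedge (ctr v \<alpha>) \<beta>) vs + hat (wedge (hat \<alpha>) (ctr v \<beta>)) vs)"
      by (simp add: hat_apply wedge_Cons algebra_simps)
    also have "\<dots> = wedge (hat \<alpha>) (hat \<beta>) (v # vs)"
      by (simp add: Cons wedge_Cons ctr_hat wedge_minus_left wedge_minus_right)
    finally show ?case .
  qed (simp add: hat_apply wedge_Nil)
qed

text \<open>Both sides obey the same recursion under contraction by the first vector, so induction
  on the arguments replaces the combinatorics of iterated shuffles.\<close>

lemma wedge_assoc: "wedge (wedge \<alpha> \<beta>) \<gamma> = wedge \<alpha> (wedge \<beta> \<gamma>)"
proof
  fix vs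
  show "wedge (wedge \<alpha> \<beta>) \<gamma> vs = wedge \<alpha> (wedge \<beta> \<gamma>) vs"
    by (induction vs arbitrary: \<alpha> \<beta> \<gamma>)
      (simp_all add: wedge_Nil wedge_Cons ctr_wedge wedge_add_left wedge_add_right hat_wedge)
qed

lemma one_alt_wedge [simp]: "wedge one_alt \<beta> = \<beta>"
proof
  fix vs
  have c: "ctr v one_alt = 0" and h: "hat one_alt = one_alt" for v :: 'a
    by (auto simp: ctr_def one_alt_def hat_def fun_eq_iff)
  show "wedge one_alt \<beta> vs = \<beta> vs"
    by (induction vs arbitrary: \<beta>) (simp_all add: wedge_Nil one_alt_def wedge_Cons c h ctr_apply)
qed

lemma ctr_oneform: "ctr v (oneform a) = smul (a v) one_alt"
  and hat_oneform: "hat (oneform a) = - oneform a"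
  by (auto simp: ctr_def oneform_def smul_def one_alt_def hat_def fun_eq_iff)

lemma oneform_wedge_Nil [simp]: "wedge (oneform a) \<beta> [] = 0"
  by (simp add: wedge_Nil oneform_def)

lemma oneform_wedge_Cons:
  "wedge (oneform a) \<beta> (v # vs) = a v * \<beta> vs - wedge (oneform a) (ctr v \<beta>) vs"
  by (simp add: wedge_Cons ctr_oneform hat_oneform wedge_smul_left wedge_minus_left smul_apply)

lemma ctr_oneform_wedge:
  "ctr v (wedge (oneform a) \<beta>) = smul (a v) \<beta> - wedge (oneform a) (ctr v \<beta>)"
  by (simp add: fun_eq_iff ctr_apply oneform_wedge_Cons smul_apply)

lemma oneform_wedge_anticomm:
  "wedge (oneform a) (wedge (oneform b) \<gamma>) = - wedge (oneform b) (wedge (oneform a) \<gamma>)"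
proof
  fix vs
  show "wedge (oneform a) (wedge (oneform b) \<gamma>) vs = (- wedge (oneform b) (wedge (oneform a) \<gamma>)) vs"
  proof (induction vs arbitrary: \<gamma>)
    case (Cons v vs)
    have s: "wedge \<alpha> (\<beta> - \<beta>') = wedge \<alpha> \<beta> - wedge \<alpha> \<beta>'" for \<alpha> \<beta> \<beta>' :: "'a alt"
      by (metis diff_conv_add_uminus wedge_add_right wedge_minus_right)
    show ?case
      using Cons[of "ctr v \<gamma>"]
      by (simp add: oneform_wedge_Cons ctr_oneform_wedge s wedge_smul_right smul_apply)
  qed simp
qed

lemma oneform_wedge_self [simp]: "wedge (oneform a) (wedge (oneform a) \<gamma>) = 0"
proof
  fix vs
  have "wedge (oneform a) (wedge (oneform a) \<gamma>) vs = - wedge (oneform a) (wedge (oneform a) \<gamma>) vs"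
    using fun_cong[OF oneform_wedge_anticomm[of a a \<gamma>], of vs] by simp
  then show "wedge (oneform a) (wedge (oneform a) \<gamma>) vs = 0 vs"
    by simp
qed

text \<open>The summation has the shape of \<open>ext_d\<close>, so that the Leibniz rule for d
  becomes a termwise comparison.\<close>

lemma oneform_wedge_sum:
  "wedge (oneform a) \<beta> vs = (\<Sum>j<length vs. (-1) ^ j * a (vs ! j) * \<beta> (take j vs @ drop (Suc j) vs))"
proof (induction vs arbitrary: \<beta>)
  case (Cons v vs)
  show ?case
    by (simp add: oneform_wedge_Cons Cons sum.lessThan_Suc_shift ctr_apply sum_negf del: sum.lessThan_Suc)
qed simp

section \<open>Alternating and homogeneous forms\<close>

lemma alternating_linear: "alternating \<alpha> \<Longrightarrow> linear (\<lambda>v. \<alpha> (xs @ v # ys))"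
  by (auto simp: alternating_def)

lemma alternating_head_linear: "alternating \<alpha> \<Longrightarrow> linear (\<lambda>v. \<alpha> (v # ys))"
  using alternating_linear[of \<alpha> "[]"] by simp

text \<open>Inserting \<open>u + v\<close> into two adjacent slots gives the sign of an adjacent
  swap, and swaps bring any two equal arguments together. Adjacent repetitions are the ones that
  recursion on the first argument can reach.\<close>

lemma alternatingI_adjacent:
  assumes lin: "\<And>xs ys. linear (\<lambda>v. \<alpha> (xs @ v # ys))"
    and adj: "\<And>xs v ys. \<alpha> (xs @ v # v # ys) = 0"
  shows "alternating \<alpha>"
proof -
  have swap: "\<alpha> (xs @ u # v # ys) = - \<alpha> (xs @ v # u # ys)" for xs u v ys
  proof -
    have A: "\<alpha> (xs @ (u + v) # z # ys) = \<alpha> (xs @ u # z # ys) + \<alpha> (xs @ v # z # ys)" for z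
      using linear_add[OF lin] by blast
    have B: "\<alpha> (xs @ z # (u + v) # ys) = \<alpha> (xs @ z # u # ys) + \<alpha> (xs @ z # v # ys)" for z
      using linear_add[OF lin[of "xs @ [z]"]] by simp
    have "\<alpha> (xs @ u # v # ys) + \<alpha> (xs @ v # u # ys) = 0"
      using adj[of xs "u + v" ys] unfolding A B by (simp add: adj add.commute)
    then show ?thesis
      by (simp add: eq_neg_iff_add_eq_0)
  qed
  have "\<alpha> (xs @ y # ys @ y # zs) = 0" for xs y ys zs
  proof (induction ys arbitrary: xs)
    case (Cons a ys)
    then show ?case using Cons[of "xs @ [a]"] swap[of xs y a] by simp
  qed (simp add: adj)
  then show ?thesis
    unfolding alternating_def using lin by (metis append_Cons append_Nil append_assoc not_distinct_decomp)
qed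

lemma alternating_zero [simp]: "alternating 0"
  by (auto simp: alternating_def zero_fun_def linear_zero)

lemma alternating_add: "alternating \<alpha> \<Longrightarrow> alternating \<beta> \<Longrightarrow> alternating (\<alpha> + \<beta>)"
  by (auto simp: alternating_def intro!: linear_compose_add)

lemma alternating_smul: "alternating \<alpha> \<Longrightarrow> alternating (smul c \<alpha>)"
  by (auto simp: alternating_def smul_def linear_iff algebra_simps)

lemma alternating_diff: "alternating \<alpha> \<Longrightarrow> alternating \<beta> \<Longrightarrow> alternating (\<alpha> - \<beta>)"
  by (auto simp: alternating_def intro!: linear_compose_sub)

lemma alternating_sum: "(\<And>i. i \<in> I \<Longrightarrow> alternating (f i)) \<Longrightarrow> alternating (\<Sum>i\<in>I. f i)"
  by (induction I rule: infinite_finite_induct) (auto intro: alternating_add)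

lemma alternating_ctr:
  assumes "alternating \<alpha>" shows "alternating (ctr v \<alpha>)"
  unfolding alternating_def
proof (intro conjI allI impI)
  fix xs ys show "linear (\<lambda>u. ctr v \<alpha> (xs @ u # ys))"
    using alternating_linear[OF assms, of "v # xs" ys] by (simp add: ctr_def)
qed (use assms in \<open>auto simp: alternating_def ctr_def\<close>)

lemma alternating_hat: "alternating \<alpha> \<Longrightarrow> alternating (hat \<alpha>)"
  by (auto simp: alternating_def hat_def linear_iff algebra_simps)

lemma ctr_linear:
  assumes "alternating \<alpha>"
  shows "ctr (u + v) \<alpha> = ctr u \<alpha> + ctr v \<alpha>" "ctr (r *\<^sub>R v) \<alpha> = smul (of_real r) (ctr v \<alpha>)"
    "ctr (- v) \<alpha> = - ctr v \<alpha>" "ctr 0 \<alpha> = 0"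
  using linear_add[OF alternating_head_linear[OF assms]] linear_scale[OF alternating_head_linear[OF assms]]
    linear_neg[OF alternating_head_linear[OF assms]] linear_0[OF alternating_head_linear[OF assms]]
  by (auto simp: fun_eq_iff ctr_apply smul_apply scaleR_conv_of_real)

lemma ctr_sum_vec:
  "alternating \<alpha> \<Longrightarrow> ctr (\<Sum>i\<in>I. r i *\<^sub>R f i) \<alpha> = (\<Sum>i\<in>I. smul (of_real (r i)) (ctr (f i) \<alpha>))"
  by (induction I rule: infinite_finite_induct) (auto simp: ctr_linear)

lemma ctr_ctr_same:
  assumes "alternating \<alpha>" shows "ctr v (ctr v \<alpha>) = 0"
  using assms by (auto simp: fun_eq_iff ctr_apply alternating_def)

lemma ctr_anticomm:
  assumes "alternating \<alpha>" shows "ctr u (ctr v \<alpha>) = - ctr v (ctr u \<alpha>)"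
proof -
  have "ctr (u + v) (ctr (u + v) \<alpha>) = 0"
    by (rule ctr_ctr_same[OF assms])
  then show ?thesis
    by (simp add: ctr_linear assms alternating_ctr ctr_add ctr_ctr_same eq_neg_iff_add_eq_0 add.commute)
qed

lemma alternating_wedge:
  assumes "alternating \<alpha>" "alternating \<beta>" shows "alternating (wedge \<alpha> \<beta>)"
proof (rule alternatingI_adjacent)
  fix xs ys
  show "linear (\<lambda>v. wedge \<alpha> \<beta> (xs @ v # ys))"
    using assms
  proof (induction xs arbitrary: \<alpha> \<beta>)
    case Nil
    then show ?case
      by (auto simp: linear_iff wedge_Cons ctr_linear wedge_add_left wedge_add_right
        wedge_smul_left wedge_smul_right smul_apply scaleR_conv_of_real algebra_simps)
  next
    case (Cons x xs)
    then show ?case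
      by (auto simp: wedge_Cons intro!: linear_compose_add alternating_ctr alternating_hat)
  qed
next
  fix xs v ys
  show "wedge \<alpha> \<beta> (xs @ v # v # ys) = 0"
    using assms
  proof (induction xs arbitrary: \<alpha> \<beta>)
    \<comment> \<open>The two terms with one \<open>v\<close> in each factor cancel by the sign in
      \<open>ctr_hat\<close>; the other two contain a repeated contraction.\<close>
    case Nil
    then show ?case
      by (simp add: wedge_Cons ctr_ctr_same ctr_hat wedge_minus_left)
  next
    case (Cons x xs)
    then show ?case
      by (simp add: wedge_Cons alternating_ctr alternating_hat)
  qed
qed

lemma alternating_oneform:
  assumes "linear a" shows "alternating (oneform a)"
proof (rule alternatingI_adjacent)
  fix xs ys :: "'a list"
  show "linear (\<lambda>v. oneform a (xs @ v # ys))"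
    using assms by (cases "xs = [] \<and> ys = []") (auto simp: oneform_def linear_zero)
qed (auto simp: oneform_def)

lemma alternating_one_alt: "alternating one_alt"
  by (rule alternatingI_adjacent) (auto simp: one_alt_def linear_zero)

text \<open>Wedging back what was contracted counts the degree. It rebuilds a form of positive
  degree from its contractions, which drives the induction for the bidegree decomposition, and in
  degree 2 it expands the metric form in a frame.\<close>

lemma euler_identity:
  assumes "finite I" and "\<And>v. v = (\<Sum>i\<in>I. \<epsilon> i v *\<^sub>R e i)" and "alternating \<alpha>"
  shows "(\<Sum>i\<in>I. wedge (oneform (\<lambda>v. of_real (\<epsilon> i v))) (ctr (e i) \<alpha>)) vs = of_nat (length vs) * \<alpha> vs"
  using assms(3)
proof (induction vs arbitrary: \<alpha>)
  case Nil
  then show ?case by (simp add: sum_fun_apply)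
next
  case (Cons v vs)
  have 1: "(\<Sum>i\<in>I. of_real (\<epsilon> i v) * ctr (e i) \<alpha> vs) = \<alpha> (v # vs)"
    using fun_cong[OF ctr_sum_vec[OF Cons(2), of "\<lambda>i. \<epsilon> i v" e I], of vs]
    by (simp add: assms(2)[of v, symmetric] sum_fun_apply smul_apply ctr_apply[of v])
  have "(\<Sum>i\<in>I. wedge (oneform (\<lambda>v. of_real (\<epsilon> i v))) (ctr v (ctr (e i) \<alpha>)) vs)
    = - (\<Sum>i\<in>I. wedge (oneform (\<lambda>v. of_real (\<epsilon> i v))) (ctr (e i) (ctr v \<alpha>))) vs"
    by (simp add: ctr_anticomm[OF Cons(2), of v] wedge_minus_right sum_fun_apply sum_negf)
  also have "\<dots> = - (of_nat (length vs) * \<alpha> (v # vs))"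
    by (subst Cons(1)) (auto simp: alternating_ctr Cons ctr_apply)
  finally show ?case
    by (simp only: sum_fun_apply oneform_wedge_Cons sum_subtractf 1) (simp add: algebra_simps)
qed

lemma has_degree_ctr: "has_degree k \<alpha> \<Longrightarrow> has_degree (k - 1) (ctr v \<alpha>)"
  by (auto simp: has_degree_def ctr_def)

lemma has_degree_zero [simp]: "has_degree k 0"
  and has_degree_add: "has_degree k \<alpha> \<Longrightarrow> has_degree k \<beta> \<Longrightarrow> has_degree k (\<alpha> + \<beta>)"
  and has_degree_smul: "has_degree k \<alpha> \<Longrightarrow> has_degree k (smul c \<alpha>)"
  by (auto simp: has_degree_def smul_def)

lemma has_degree_sum: "(\<And>i. i \<in> I \<Longrightarrow> has_degree k (f i)) \<Longrightarrow> has_degree k (\<Sum>i\<in>I. f i)"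
  by (induction I rule: infinite_finite_induct) (auto intro: has_degree_add)

lemma has_degree_oneform_wedge:
  assumes "has_degree k \<beta>" shows "has_degree (k + 1) (wedge (oneform a) \<beta>)"
  using assms unfolding has_degree_def oneform_wedge_sum
  by (intro allI impI sum.neutral ballI) auto

lemma has_degree_one_alt: "has_degree 0 one_alt"
  by (auto simp: has_degree_def one_alt_def)

lemma has_degree_1_oneform:
  assumes "has_degree 1 \<alpha>" shows "\<alpha> = oneform (\<lambda>v. \<alpha> [v])"
proof
  fix vs show "\<alpha> vs = oneform (\<lambda>v. \<alpha> [v]) vs"
    using assms by (cases vs) (auto simp: has_degree_def oneform_def)
qed

section \<open>Pull-back of forms\<close>

definition pull :: "('v \<Rightarrow> 'w) \<Rightarrow> 'w alt \<Rightarrow> 'v alt" where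
  "pull L \<alpha> = (\<lambda>vs. \<alpha> (map L vs))"

lemma pull_apply: "pull L \<alpha> vs = \<alpha> (map L vs)"
  by (simp add: pull_def)

lemma ctr_pull: "ctr v (pull L \<alpha>) = pull L (ctr (L v) \<alpha>)"
  and hat_pull: "hat (pull L \<alpha>) = pull L (hat \<alpha>)"
  and pull_add: "pull L (\<alpha> + \<beta>) = pull L \<alpha> + pull L \<beta>"
  and pull_smul: "pull L (smul c \<alpha>) = smul c (pull L \<alpha>)"
  and pull_zero [simp]: "pull L 0 = 0"
  and pull_oneform: "pull L (oneform a) = oneform (a \<circ> L)"
  and pull_one_alt: "pull L one_alt = one_alt"
  by (auto simp: pull_def ctr_def hat_def smul_def oneform_def one_alt_def fun_eq_iff hd_map length_Suc_conv)

lemma pull_sum: "pull L (\<Sum>i\<in>I. f i) = (\<Sum>i\<in>I. pull L (f i))"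
  using sum_comp_morphism[of "pull L" f I] by (simp add: pull_add comp_def)

lemma pull_wedge: "pull L (wedge \<alpha> \<beta>) = wedge (pull L \<alpha>) (pull L \<beta>)"
proof
  fix vs
  show "pull L (wedge \<alpha> \<beta>) vs = wedge (pull L \<alpha>) (pull L \<beta>) vs"
    by (induction vs arbitrary: \<alpha> \<beta>)
      (simp_all add: wedge_Nil wedge_Cons ctr_pull hat_pull, simp_all add: pull_apply wedge_Nil wedge_Cons)
qed

lemma smul_sum: "smul c (\<Sum>i\<in>I. f i) = (\<Sum>i\<in>I. smul c (f i))"
  by (simp add: fun_eq_iff smul_apply sum_fun_apply sum_distrib_left)

lemma smul_smul: "smul a (smul b \<alpha>) = smul (a * b) \<alpha>"
  and smul_add: "smul a (\<alpha> + \<beta>) = smul a \<alpha> + smul a \<beta>"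
  and smul_minus: "smul a (- \<alpha>) = smul (- a) \<alpha>"
  and smul_add_left: "smul (a + b) \<alpha> = smul a \<alpha> + smul b \<alpha>"
  and smul_one [simp]: "smul 1 \<alpha> = \<alpha>"
  and smul_zero_left [simp]: "smul 0 \<alpha> = 0"
  and smul_zero [simp]: "smul a 0 = 0"
  by (simp_all add: smul_def fun_eq_iff algebra_simps)

lemma linear_smult: "linear ((*s) (l::complex) :: complex^'n \<Rightarrow> complex^'n::finite)"
  by (rule linearI) (simp_all add: vec_eq_iff vector_scaleR_component scaleR_conv_of_real algebra_simps)

section \<open>Bidegrees\<close>

text \<open>An intrinsic substitute for the coefficient expansion in \<open>bidegree\<close>: degree
  and weight together determine p and q for a nonzero form. The two notions agree by
  \<open>bidegree_has_type\<close> and \<open>has_type_bidegree\<close>.\<close>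

definition has_type :: "nat \<Rightarrow> nat \<Rightarrow> (complex^'n::finite) alt \<Rightarrow> bool" where
  "has_type p q \<alpha> \<longleftrightarrow> alternating \<alpha> \<and> has_degree (int (p + q)) \<alpha> \<and>
     (\<forall>l. pull ((*s) l) \<alpha> = smul (l ^ p * cnj l ^ q) \<alpha>)"

lemma has_type_zero [simp]: "has_type p q 0"
  and has_type_add: "has_type p q \<alpha> \<Longrightarrow> has_type p q \<beta> \<Longrightarrow> has_type p q (\<alpha> + \<beta>)"
  and has_type_smul: "has_type p q \<alpha> \<Longrightarrow> has_type p q (smul c \<alpha>)"
  by (simp_all add: has_type_def alternating_add has_degree_add pull_add smul_add alternating_smul
      has_degree_smul pull_smul smul_smul mult.commute)

lemma has_type_sum: "(\<And>i. i \<in> I \<Longrightarrow> has_type p q (f i)) \<Longrightarrow> has_type p q (\<Sum>i\<in>I. f i)"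
  by (induction I rule: infinite_finite_induct) (auto intro: has_type_add)

lemma has_type_alternating: "has_type p q \<alpha> \<Longrightarrow> alternating \<alpha>"
  and has_type_degree: "has_type p q \<alpha> \<Longrightarrow> has_degree (int (p + q)) \<alpha>"
  and has_type_pull: "has_type p q \<alpha> \<Longrightarrow> pull ((*s) l) \<alpha> = smul (l ^ p * cnj l ^ q) \<alpha>"
  by (simp_all add: has_type_def)

lemma has_type_oneform_wedge:
  assumes lin: "linear a" and ty: "has_type p q \<beta>"
  shows "(\<And>l v. a (l *s v) = l * a v) \<Longrightarrow> has_type (Suc p) q (wedge (oneform a) \<beta>)"
    and "(\<And>l v. a (l *s v) = cnj l * a v) \<Longrightarrow> has_type p (Suc q) (wedge (oneform a) \<beta>)"
proof -
  have alt: "alternating (wedge (oneform a) \<beta>)"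
    using assms by (intro alternating_wedge alternating_oneform) (auto simp: has_type_def)
  have deg: "has_degree (int (Suc p + q)) (wedge (oneform a) \<beta>)" "has_degree (int (p + Suc q)) (wedge (oneform a) \<beta>)"
    using has_degree_oneform_wedge[OF has_type_degree[OF ty], of a] by (simp_all add: ac_simps)
  have s: "oneform (\<lambda>v. c * a v) = smul c (oneform a)" for c
    by (auto simp: oneform_def smul_def)
  show "has_type (Suc p) q (wedge (oneform a) \<beta>)" if "\<And>l v. a (l *s v) = l * a v"
    using alt deg that
    by (simp add: has_type_def pull_wedge pull_oneform comp_def s wedge_smul_left wedge_smul_right
        has_type_pull[OF ty] smul_smul mult_ac)
  show "has_type p (Suc q) (wedge (oneform a) \<beta>)" if "\<And>l v. a (l *s v) = cnj l * a v"
    using alt deg that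
    by (simp add: has_type_def pull_wedge pull_oneform comp_def s wedge_smul_left wedge_smul_right
        has_type_pull[OF ty] smul_smul mult_ac)
qed

lemma linear_component: "linear (\<lambda>v::complex^'n::finite. v $ j)"
  and linear_cnj_component: "linear (\<lambda>v::complex^'n::finite. cnj (v $ j))"
  by (auto intro!: linearI simp: vector_scaleR_component complex_cnj_scaleR)

lemma has_type_one_alt: "has_type 0 0 one_alt"
  by (simp add: has_type_def alternating_one_alt has_degree_one_alt pull_one_alt)

lemma has_type_dz_wedge: "has_type p q \<beta> \<Longrightarrow> has_type (Suc p) q (wedge (dz j) \<beta>)"
  unfolding dz_def by (rule has_type_oneform_wedge) (auto simp: linear_component)

lemma has_type_dzbar_wedge: "has_type p q \<beta> \<Longrightarrow> has_type p (Suc q) (wedge (dzbar j) \<beta>)"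
  unfolding dzbar_def by (rule has_type_oneform_wedge) (auto simp: linear_cnj_component)

text \<open>The projection is discrete Fourier analysis of the circle action on the forms of degree \<open>p + q\<close>.\<close>

definition type_proj :: "nat \<Rightarrow> nat \<Rightarrow> (complex^'n::finite) alt \<Rightarrow> (complex^'n) alt" where
  "type_proj p q \<alpha> = (\<lambda>vs. if length vs = p + q then
     (\<Sum>m<2 * (p + q) + 1. let l = cis (2 * pi * real m / real (2 * (p + q) + 1)) in
        cnj l ^ p * l ^ q * \<alpha> (map ((*s) l) vs)) / of_nat (2 * (p + q) + 1) else 0)"

lemma type_proj_add: "type_proj p q (\<alpha> + \<beta>) = type_proj p q \<alpha> + type_proj p q \<beta>"
  and type_proj_smul: "type_proj p q (smul c \<alpha>) = smul c (type_proj p q \<alpha>)"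
  and type_proj_zero [simp]: "type_proj p q 0 = 0"
  by (auto simp: type_proj_def fun_eq_iff smul_def sum.distrib sum_distrib_left Let_def
      add_divide_distrib algebra_simps)

lemma type_proj_sum: "type_proj p q (\<Sum>i\<in>I. f i) = (\<Sum>i\<in>I. type_proj p q (f i))"
  using sum_comp_morphism[of "type_proj p q" f I] by (simp add: type_proj_add comp_def)

lemma type_proj_pull:
  assumes "\<And>l v. L (l *s v) = l *s L v"
  shows "type_proj p q (pull L \<alpha>) = pull L (type_proj p q \<alpha>)"
  by (simp add: type_proj_def pull_def fun_eq_iff comp_def assms)

lemma sum_root_of_unity_powers:
  assumes "N > 0" "d \<noteq> 0" "\<bar>d\<bar> < int N"
  shows "(\<Sum>m<N. cis (2 * pi * real m / real N * of_int d)) = 0"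
proof -
  let ?x = "cis (2 * pi * of_int d / real N)"
  have ne: "?x \<noteq> 1"
  proof
    assume "?x = 1"
    then have "cos (2 * pi * of_int d / real N) = 1"
      by (metis cis.simps(1) one_complex.simps(1))
    then obtain n :: int where "2 * pi * of_int d / real N = of_int n * 2 * pi"
      using cos_one_2pi_int by blast
    then have "of_int d = (of_int (n * int N) :: real)"
      using assms(1) by (simp add: field_simps)
    then have "d = n * int N" by (simp only: of_int_eq_iff)
    then show False using assms(2,3)
      by (simp add: abs_mult mult_less_cancel_right2) 
  qed
  have "real N * (2 * pi * of_int d / real N) = 2 * pi * of_int d"
    using assms(1) by simp
  then have "?x ^ N = cis (2 * pi * of_int d)"
    by (simp only: Complex.DeMoivre)
  also have "\<dots> = 1"
    by (rule cis_multiple_2pi) simp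
  finally have "(\<Sum>m<N. ?x ^ m) = 0"
    using ne by (simp add: sum_gp_strict)
  then show ?thesis by (simp add: Complex.DeMoivre mult_ac)
qed

text \<open>On a form of type (r, s) with r + s = p + q the average runs over roots of unity raised
  to the power \<open>2 * (r - p)\<close>. Its absolute value is at most \<open>2 * (p + q)\<close>,
  so with \<open>2 * (p + q) + 1\<close> roots only the exponent 0 survives.\<close>

lemma type_proj_has_type:
  assumes "has_type r s \<alpha>"
  shows "type_proj p q \<alpha> = (if p = r \<and> q = s then \<alpha> else 0)"
proof
  fix vs
  show "type_proj p q \<alpha> vs = (if p = r \<and> q = s then \<alpha> else 0) vs"
  proof (cases "length vs = p + q \<and> r + s = p + q")
    case False
    have d: "length us \<noteq> r + s \<Longrightarrow> \<alpha> us = 0" for us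
      using has_type_degree[OF assms] by (auto simp: has_degree_def)
    from False show ?thesis
      by (auto simp: type_proj_def d)
  next
    case True
    define N where "N = 2 * (p + q) + 1"
    have a: "\<alpha> (map ((*s) l) vs) = l ^ r * cnj l ^ s * \<alpha> vs" for l
      using fun_cong[OF has_type_pull[OF assms], of l vs] by (simp add: pull_apply smul_apply)
    have c: "cnj (cis t) ^ p * cis t ^ q * (cis t ^ r * cnj (cis t) ^ s) = cis (t * of_int (2 * (int r - int p)))" for t
    proof -
      have "real r + real s = real p + real q"
        using conjunct2[OF True] by (metis of_nat_add)
      then have e: "real q - real p + real r - real s = 2 * (real r - real p)" by simp
      have "cnj (cis t) ^ p * cis t ^ q * (cis t ^ r * cnj (cis t) ^ s) = cis (t * (real q - real p + real r - real s))"
        by (simp only: cis_cnj Complex.DeMoivre cis_mult) (simp add: algebra_simps)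
      then show ?thesis unfolding e by simp
    qed
    have "type_proj p q \<alpha> vs = (\<Sum>m<N. cis (2 * pi * real m / real N * of_int (2 * (int r - int p)))) * \<alpha> vs / of_nat N"
      unfolding type_proj_def Let_def a N_def[symmetric] using True
      by (simp add: sum_distrib_right mult.assoc[symmetric] c[unfolded mult.assoc[symmetric]])
    also have "\<dots> = (if p = r \<and> q = s then \<alpha> else 0) vs"
    proof (cases "p = r")
      case eq: True
      have "(of_nat N :: complex) \<noteq> 0" unfolding N_def of_nat_eq_0_iff by simp
      then show ?thesis using eq True by simp
    next
      case False
      have "(\<Sum>m<N. cis (2 * pi * real m / real N * of_int (2 * (int r - int p)))) = 0"
        using False True by (intro sum_root_of_unity_powers) (auto simp: N_def)
      then show ?thesis using False by simp
    qed
    finally show ?thesis .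
  qed
qed

section \<open>Monomials in the coordinate one-forms\<close>

abbreviation dzs :: "'n list \<Rightarrow> 'n list \<Rightarrow> (complex^'n::finite) alt" where
  "dzs I J \<equiv> foldr wedge (map dz I @ map dzbar J) one_alt"

lemma finite_length_lists: "finite {I :: 'n::finite list. length I = p}"
  using finite_lists_length_eq[of "UNIV :: 'n set" p] by simp

lemma bidegree_expand:
  "bidegree p q \<alpha> \<longleftrightarrow> (\<exists>c. \<alpha> = (\<Sum>I | length I = p. \<Sum>J | length J = q. smul (c I J) (dzs I J)))"
  by (simp add: bidegree_def fun_eq_iff sum_fun_apply smul_apply)

lemma has_type_dzs: "has_type (length I) (length J) (dzs I J)"
proof -
  have "has_type 0 (length J) (foldr wedge (map dzbar J) one_alt)"
    by (induction J) (auto simp: has_type_one_alt has_type_dzbar_wedge)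
  then show ?thesis
    by (induction I) (auto simp: has_type_dz_wedge)
qed

lemma bidegree_has_type: "bidegree p q \<alpha> \<Longrightarrow> has_type p q \<alpha>"
  unfolding bidegree_expand using has_type_dzs by (fastforce intro!: has_type_sum has_type_smul)

lemma bidegree_zero: "bidegree p q 0"
  unfolding bidegree_def by (rule exI[of _ "\<lambda>_ _. 0"]) simp

lemma bidegree_smul:
  assumes "bidegree p q \<alpha>" shows "bidegree p q (smul b \<alpha>)"
proof -
  obtain c where "\<alpha> = (\<Sum>I | length I = p. \<Sum>J | length J = q. smul (c I J) (dzs I J))"
    using assms unfolding bidegree_expand by auto
  then show ?thesis
    unfolding bidegree_expand by (intro exI[of _ "\<lambda>I J. b * c I J"]) (simp add: smul_sum smul_smul)
qed

lemma bidegree_add: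
  assumes "bidegree p q \<alpha>" "bidegree p q \<beta>" shows "bidegree p q (\<alpha> + \<beta>)"
proof -
  obtain c d where "\<alpha> = (\<Sum>I | length I = p. \<Sum>J | length J = q. smul (c I J) (dzs I J))"
    "\<beta> = (\<Sum>I | length I = p. \<Sum>J | length J = q. smul (d I J) (dzs I J))"
    using assms unfolding bidegree_expand by auto
  then show ?thesis
    unfolding bidegree_expand
    by (intro exI[of _ "\<lambda>I J. c I J + d I J"]) (simp add: smul_add_left sum.distrib)
qed

lemma bidegree_sum: "(\<And>i. i \<in> I \<Longrightarrow> bidegree p q (f i)) \<Longrightarrow> bidegree p q (\<Sum>i\<in>I. f i)"
  by (induction I rule: infinite_finite_induct) (auto intro: bidegree_add bidegree_zero)

lemma bidegree_dzs: "bidegree (length I) (length J) (dzs I J)"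
  unfolding bidegree_def
proof (intro exI allI)
  fix vs
  show "dzs I J vs = (\<Sum>I' | length I' = length I. \<Sum>J' | length J' = length J.
     (if I' = I then if J' = J then 1 else 0 else 0) * dzs I' J' vs)"
  proof -
    have "(\<Sum>J' | length J' = length J. (if I' = I then if J' = J then 1 else 0 else 0) * dzs I' J' vs)
      = (if I' = I then dzs I J vs else 0)" for I'
      by (cases "I' = I") (simp_all add: if_distrib[of "\<lambda>x. x * _"] finite_length_lists sum.delta cong: if_cong)
    then show ?thesis
      by (simp add: finite_length_lists sum.delta)
  qed
qed

text \<open>Carries a one-form past a block of one-forms; in this way a \<open>dzbar\<close> wedged
  from the left reaches the antiholomorphic block of a monomial.\<close>

lemma oneform_wedge_foldr:
  assumes "\<And>x. \<exists>b. g x = oneform b"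
  shows "wedge (oneform a) (foldr wedge (map g I) \<gamma>)
    = smul ((-1) ^ length I) (foldr wedge (map g I) (wedge (oneform a) \<gamma>))"
proof (induction I)
  case (Cons x I)
  obtain b where b: "g x = oneform b" using assms by blast
  show ?case
    by (simp add: b oneform_wedge_anticomm[of a] Cons wedge_smul_right flip: smul_minus)
      (simp add: smul_def fun_eq_iff)
qed simp

lemma oneform_wedge_foldr_zero:
  assumes "\<And>x. \<exists>b. g x = oneform b" "x \<in> set I"
  shows "wedge (g x) (foldr wedge (map g I) \<gamma>) = 0"
  using assms(2)
proof (induction I)
  case (Cons y I)
  obtain a b where ab: "g x = oneform a" "g y = oneform b" using assms(1) by metis
  show ?case
  proof (cases "x = y")
    case True
    then show ?thesis by (simp add: ab)
  next
    case False
    then have "wedge (oneform a) (foldr wedge (map g I) \<gamma>) = 0"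
      using Cons ab by (metis set_ConsD)
    then have "wedge (oneform a) (wedge (oneform b) (foldr wedge (map g I) \<gamma>)) = 0"
      unfolding oneform_wedge_anticomm[of a] by (metis minus_zero wedge_zero_right)
    then show ?thesis
      by (simp only: ab list.map foldr.simps comp_apply)
  qed
qed simp

lemma foldr_wedge_not_distinct:
  assumes "\<And>x. \<exists>b. g x = oneform b" "\<not> distinct I"
  shows "foldr wedge (map g I) \<gamma> = 0"
  using assms(2)
proof (induction I)
  case (Cons x I)
  have e: "foldr wedge (map g (x # I)) \<gamma> = wedge (g x) (foldr wedge (map g I) \<gamma>)" by simp
  show ?case
  proof (cases "x \<in> set I")
    case True
    then show ?thesis unfolding e by (rule oneform_wedge_foldr_zero[OF assms(1)])
  next
    case False
    then have "foldr wedge (map g I) \<gamma> = 0" using Cons by auto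
    then show ?thesis unfolding e by (simp only: wedge_zero_right)
  qed
qed simp

lemma dz_oneform: "\<exists>b. dz x = oneform b" and dzbar_oneform: "\<exists>b. dzbar x = oneform b"
  by (auto simp: dz_def dzbar_def)

lemma long_not_distinct: "CARD('n) < length I \<Longrightarrow> \<not> distinct (I :: 'n::finite list)"
  by (metis card_mono distinct_card finite leD subset_UNIV)

text \<open>An index list longer than the dimension repeats an index, and a repeated one-form kills
  the monomial.\<close>

lemma bidegree_large:
  fixes \<alpha> :: "(complex^'n::finite) alt"
  assumes "bidegree p q \<alpha>" "CARD('n) < p \<or> CARD('n) < q"
  shows "\<alpha> = 0"
proof -
  have "dzs I J = 0" if "length I = p" "length J = q" for I J :: "'n list"
  proof (cases "CARD('n) < p")
    case True
    then show ?thesis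
      using foldr_wedge_not_distinct[of dz I] dz_oneform long_not_distinct that by auto
  next
    case False
    then have "foldr wedge (map dzbar J) one_alt = 0"
      using assms(2) foldr_wedge_not_distinct[of dzbar J] dzbar_oneform long_not_distinct that by blast
    moreover have "foldr wedge (map dz K) 0 = 0" for K :: "'n list"
      by (induction K) (simp_all add: zero_fun_def[symmetric])
    ultimately show ?thesis by simp
  qed
  then show ?thesis
    using assms(1) unfolding bidegree_expand by auto
qed

section \<open>Decomposition of alternating forms into bidegrees\<close>

lemma wedge_dz_bidegree:
  assumes "bidegree p q \<alpha>" shows "bidegree (Suc p) q (wedge (dz j) \<alpha>)"
proof -
  obtain c where \<alpha>: "\<alpha> = (\<Sum>I | length I = p. \<Sum>J | length J = q. smul (c I J) (dzs I J))"
    using assms unfolding bidegree_expand by auto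
  show ?thesis
    unfolding \<alpha> wedge_sum_right wedge_smul_right
  proof (intro bidegree_sum bidegree_smul)
    fix I J assume "I \<in> {I :: 'a list. length I = p}" "J \<in> {J :: 'a list. length J = q}"
    then show "bidegree (Suc p) q (wedge (dz j) (dzs I J))"
      using bidegree_dzs[of "j # I" J] by simp
  qed
qed

lemma wedge_dzbar_bidegree:
  assumes "bidegree p q \<alpha>" shows "bidegree p (Suc q) (wedge (dzbar j) \<alpha>)"
proof -
  obtain c where \<alpha>: "\<alpha> = (\<Sum>I | length I = p. \<Sum>J | length J = q. smul (c I J) (dzs I J))"
    using assms unfolding bidegree_expand by auto
  show ?thesis
    unfolding \<alpha> wedge_sum_right wedge_smul_right
  proof (intro bidegree_sum bidegree_smul)
    fix I J assume IJ: "I \<in> {I :: 'a list. length I = p}" "J \<in> {J :: 'a list. length J = q}"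
    have "wedge (dzbar j) (dzs I J) = smul ((-1) ^ length I) (dzs I (j # J))"
      using oneform_wedge_foldr[OF dz_oneform, where I = I] by (simp add: dzbar_def)
    then show "bidegree p (Suc q) (wedge (dzbar j) (dzs I J))"
      using bidegree_smul[OF bidegree_dzs[of I "j # J"]] IJ by simp
  qed
qed

text \<open>The existence half of the definite description in \<open>bidegree_part\<close>, with the
  explicit candidates \<open>type_proj p q \<alpha>\<close>.\<close>

definition decomposable :: "(complex^'n::finite) alt \<Rightarrow> bool" where
  "decomposable \<alpha> \<longleftrightarrow> (\<forall>p q. bidegree p q (type_proj p q \<alpha>)) \<and>
     \<alpha> = (\<Sum>p\<le>CARD('n). \<Sum>q\<le>CARD('n). type_proj p q \<alpha>)"

lemma decomposable_zero: "decomposable 0"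
  by (simp add: decomposable_def bidegree_zero)

lemma decomposable_add: "decomposable \<alpha> \<Longrightarrow> decomposable \<beta> \<Longrightarrow> decomposable (\<alpha> + \<beta>)"
  unfolding decomposable_def type_proj_add by (simp add: bidegree_add sum.distrib)

lemma decomposable_smul: "decomposable \<alpha> \<Longrightarrow> decomposable (smul c \<alpha>)"
  unfolding decomposable_def type_proj_smul by (simp add: bidegree_smul flip: smul_sum)

lemma decomposable_sum: "(\<And>i. i \<in> I \<Longrightarrow> decomposable (f i)) \<Longrightarrow> decomposable (\<Sum>i\<in>I. f i)"
  by (induction I rule: infinite_finite_induct) (auto intro: decomposable_add decomposable_zero)

lemma decomposable_bidegree:
  fixes \<alpha> :: "(complex^'n::finite) alt"
  assumes "bidegree p q \<alpha>" shows "decomposable \<alpha>"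
proof (cases "CARD('n) < p \<or> CARD('n) < q")
  case True
  then show ?thesis using bidegree_large[OF assms] by (simp add: decomposable_zero)
next
  case False
  have "(\<Sum>r\<le>CARD('n). \<Sum>s\<le>CARD('n). if r = p \<and> s = q then \<alpha> else 0)
      = (\<Sum>r\<le>CARD('n). if r = p then \<Sum>s\<le>CARD('n). if s = q then \<alpha> else 0 else 0)"
    by (intro sum.cong) auto
  also have "\<dots> = \<alpha>" using False by simp
  finally show ?thesis
    using assms unfolding decomposable_def type_proj_has_type[OF bidegree_has_type[OF assms]]
    by (auto simp: bidegree_zero)
qed

lemma decomposable_wedge_dz: 
  fixes \<alpha> :: "(complex^'n::finite) alt"
  assumes "decomposable \<alpha>"
  shows "decomposable (wedge (dz j) \<alpha>)" "decomposable (wedge (dzbar j) \<alpha>)"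
proof -
  have d: "\<alpha> = (\<Sum>p\<le>CARD('n). \<Sum>q\<le>CARD('n). type_proj p q \<alpha>)" and b: "bidegree p q (type_proj p q \<alpha>)" for p q
    using assms by (auto simp: decomposable_def)
  show "decomposable (wedge (dz j) \<alpha>)" "decomposable (wedge (dzbar j) \<alpha>)"
    unfolding arg_cong[OF d, of "wedge (dz j)"] arg_cong[OF d, of "wedge (dzbar j)"] wedge_sum_right
    using b by (blast intro: decomposable_sum decomposable_bidegree wedge_dz_bidegree wedge_dzbar_bidegree)+
qed

lemma vec_real_expansion:
  "v = (\<Sum>j\<in>UNIV. Re (v $ j) *\<^sub>R axis j 1) + (\<Sum>j\<in>UNIV. Im (v $ j) *\<^sub>R axis j \<i>)"
  for v :: "complex^'n::finite"
proof (rule vec_eq_iff[THEN iffD2], rule allI)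
  fix i
  have "(\<Sum>j\<in>UNIV. (r j *\<^sub>R axis j c) $ i) = r i *\<^sub>R c" for r :: "'n \<Rightarrow> real" and c :: complex
    by (simp add: axis_def vector_scaleR_component if_distrib[of "\<lambda>x. _ *\<^sub>R x"] cong: if_cong)
  then show "v $ i = ((\<Sum>j\<in>UNIV. Re (v $ j) *\<^sub>R axis j 1) + (\<Sum>j\<in>UNIV. Im (v $ j) *\<^sub>R axis j \<i>)) $ i"
    by (simp add: complex_eq_iff)
qed

lemma real_basis_expansion:
  "v = (\<Sum>b\<in>UNIV. (if snd b then Im (v $ fst b) else Re (v $ fst b)) *\<^sub>R real_basis b)"
  for v :: "complex^'n::finite"
proof -
  have "(\<Sum>b\<in>UNIV. (if snd b then Im (v $ fst b) else Re (v $ fst b)) *\<^sub>R real_basis b)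
    = (\<Sum>j\<in>UNIV. \<Sum>t\<in>UNIV. (if t then Im (v $ j) else Re (v $ j)) *\<^sub>R real_basis (j, t))"
    unfolding UNIV_Times_UNIV[symmetric] sum.cartesian_product[symmetric] 
    by (simp add: sum.cartesian_product split_def)
  also have "\<dots> = v"
    by (subst (3) vec_real_expansion) (simp add: UNIV_bool real_basis_def sum.distrib)
  finally show ?thesis by simp
qed

text \<open>By \<open>euler_identity\<close> a form of positive degree is, up to division by the
  degree, a sum of real coordinate forms wedged with contractions of lower degree. Each real
  coordinate form is a combination of a \<open>dz\<close> and a \<open>dzbar\<close>, which preserve
  decomposability.\<close>

lemma decomposable_homogeneous:
  fixes \<alpha> :: "(complex^'n::finite) alt"
  assumes "alternating \<alpha>" "has_degree (int k) \<alpha>"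
  shows "decomposable \<alpha>"
  using assms
proof (induction k arbitrary: \<alpha>)
  case 0
  have "\<alpha> = smul (\<alpha> []) (dzs [] [])"
    using 0 by (auto simp: fun_eq_iff smul_apply one_alt_def has_degree_def)
  then show ?case
    using decomposable_smul[OF decomposable_bidegree[OF bidegree_dzs[of "[]" "[]"]], of "\<alpha> []"] by metis
next
  case (Suc k)
  let ?\<epsilon> = "\<lambda>(b::'n \<times> bool) (v::complex^'n). if snd b then Im (v $ fst b) else Re (v $ fst b)"
  let ?S = "\<Sum>b\<in>UNIV. wedge (oneform (\<lambda>v. of_real (?\<epsilon> b v))) (ctr (real_basis b) \<alpha>)"
  have "\<alpha> = smul (1 / of_nat (Suc k)) ?S"
  proof
    fix vs
    have "?S vs = of_nat (length vs) * \<alpha> vs"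
      by (rule euler_identity) (auto intro: real_basis_expansion Suc)
    moreover have "length vs \<noteq> Suc k \<Longrightarrow> \<alpha> vs = 0"
      using Suc by (auto simp: has_degree_def)
    moreover have "(of_nat (Suc k) :: complex) \<noteq> 0"
      by (metis of_nat_eq_0_iff nat.distinct(1))
    ultimately show "\<alpha> vs = smul (1 / of_nat (Suc k)) ?S vs"
      unfolding smul_apply by (cases "length vs = Suc k") auto
  qed
  moreover have "decomposable (wedge (oneform (\<lambda>v. of_real (?\<epsilon> b v))) (ctr (real_basis b) \<alpha>))" for b
  proof -
    have d: "decomposable (ctr (real_basis b) \<alpha>)"
      using has_degree_ctr[OF Suc(3), of "real_basis b"] by (intro Suc(1) alternating_ctr Suc(2)) simp
    have "oneform (\<lambda>v. of_real (?\<epsilon> b v)) =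
      (if snd b then smul (- \<i> / 2) (dz (fst b)) + smul (\<i> / 2) (dzbar (fst b))
       else smul (1 / 2) (dz (fst b)) + smul (1 / 2) (dzbar (fst b)))"
      by (auto simp: fun_eq_iff oneform_def smul_apply dz_def dzbar_def complex_eq_iff)
    then show ?thesis
      using d by (auto simp: wedge_add_left wedge_smul_left
        intro!: decomposable_add decomposable_smul decomposable_wedge_dz)
  qed
  ultimately show ?case
    by (metis (no_types, lifting) decomposable_smul decomposable_sum)
qed

lemma type_proj_degree: "length vs \<noteq> p + q \<Longrightarrow> type_proj p q \<alpha> vs = 0"
  by (simp add: type_proj_def)

lemma alternating_restrict:
  assumes "alternating \<alpha>" shows "alternating (\<lambda>us. if length us = k then \<alpha> us else 0)"
  unfolding alternating_def
proof (intro conjI allI impI)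
  fix xs ys
  show "linear (\<lambda>v. if length (xs @ v # ys) = k then \<alpha> (xs @ v # ys) else 0)"
    using assms by (cases "length (xs @ undefined # ys) = k") (auto simp: alternating_def linear_zero)
qed (use assms in \<open>auto simp: alternating_def\<close>)

text \<open>The bidegree decomposition only involves p and q up to n, hence degrees up to 2n.
  Restricting \<alpha> to the length of \<open>vs\<close> makes it homogeneous, so that the
  decomposition applies.\<close>

lemma alternating_long_zero:
  fixes \<alpha> :: "(complex^'n::finite) alt"
  assumes "alternating \<alpha>" "2 * CARD('n) < length vs"
  shows "\<alpha> vs = 0"
proof -
  define \<beta> where "\<beta> us = (if length us = length vs then \<alpha> us else 0)" for us
  have "alternating \<beta>"
    using alternating_restrict[OF assms(1)] unfolding \<beta>_def .
  then have "decomposable \<beta>"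
    by (rule decomposable_homogeneous[of _ "length vs"]) (auto simp: has_degree_def \<beta>_def)
  then have "\<beta> vs = (\<Sum>p\<le>CARD('n). \<Sum>q\<le>CARD('n). type_proj p q \<beta> vs)"
    unfolding decomposable_def by (metis (no_types, lifting) sum.cong sum_fun_apply)
  also have "\<dots> = 0"
    using assms(2) by (intro sum.neutral ballI type_proj_degree) auto
  finally show ?thesis by (simp add: \<beta>_def)
qed

lemma alternating_decomposable:
  fixes \<alpha> :: "(complex^'n::finite) alt"
  assumes "alternating \<alpha>"
  shows "decomposable \<alpha>"
proof -
  define \<beta> where "\<beta> k us = (if length us = k then \<alpha> us else 0)" for us k
  have "alternating (\<beta> k)" for k
    using alternating_restrict[OF assms(1)] unfolding \<beta>_def .
  then have "decomposable (\<beta> k)" for k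
    by (rule decomposable_homogeneous[of _ k]) (auto simp: has_degree_def \<beta>_def)
  moreover have "\<alpha> = (\<Sum>k\<le>2 * CARD('n). \<beta> k)"
    using alternating_long_zero[OF assms] by (auto simp: fun_eq_iff sum_fun_apply \<beta>_def not_le)
  ultimately show ?thesis
    by (metis decomposable_sum)
qed

text \<open>Uniqueness: applying \<open>type_proj p q\<close> to any competing decomposition
  \<open>F\<close> picks out \<open>F p q\<close>. Components with p or q above n lie outside the
  sum, but they vanish by \<open>bidegree_large\<close>.\<close>

lemma bidegree_part_eq:
  fixes \<alpha> :: "(complex^'n::finite) alt"
  assumes "alternating \<alpha>"
  shows "bidegree_part p q \<alpha> = type_proj p q \<alpha>"
proof -
  have d: "\<alpha> = (\<Sum>p\<le>CARD('n). \<Sum>q\<le>CARD('n). type_proj p q \<alpha>)" and b: "bidegree p q (type_proj p q \<alpha>)" for p q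
    using alternating_decomposable[OF assms] by (auto simp: decomposable_def)
  have "(THE F. (\<forall>r s. bidegree r s (F r s)) \<and> \<alpha> = (\<Sum>r\<le>CARD('n). \<Sum>s\<le>CARD('n). F r s)) = (\<lambda>p q. type_proj p q \<alpha>)"
  proof (rule the_equality)
    show "(\<forall>r s. bidegree r s (type_proj r s \<alpha>)) \<and> \<alpha> = (\<Sum>r\<le>CARD('n). \<Sum>s\<le>CARD('n). type_proj r s \<alpha>)"
      using d b by blast
  next
    fix F assume F: "(\<forall>r s. bidegree r s (F r s)) \<and> \<alpha> = (\<Sum>r\<le>CARD('n). \<Sum>s\<le>CARD('n). F r s)"
    have "F p q = type_proj p q \<alpha>" for p q
    proof -
      have "type_proj p q \<alpha> = (\<Sum>r\<le>CARD('n). \<Sum>s\<le>CARD('n). type_proj p q (F r s))"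
        using F by (simp only: type_proj_sum[symmetric])
      also have "\<dots> = (\<Sum>r\<le>CARD('n). \<Sum>s\<le>CARD('n). if p = r \<and> q = s then F r s else 0)"
        using F by (intro sum.cong refl type_proj_has_type bidegree_has_type) auto
      also have "\<dots> = (\<Sum>r\<le>CARD('n). if p = r then \<Sum>s\<le>CARD('n). if q = s then F r s else 0 else 0)"
        by (intro sum.cong) auto
      also have "\<dots> = F p q"
        using bidegree_large[of p q "F p q"] F by (auto simp: not_le)
      finally show ?thesis by simp
    qed
    then show "F = (\<lambda>p q. type_proj p q \<alpha>)" by (simp add: fun_eq_iff)
  qed
  then show ?thesis by (simp add: bidegree_part_def)
qed

lemma type_proj_bidegree: "alternating \<alpha> \<Longrightarrow> bidegree p q (type_proj p q \<alpha>)"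
  using alternating_decomposable by (auto simp: decomposable_def)

lemma type_proj_type: "alternating \<alpha> \<Longrightarrow> has_type p q (type_proj p q \<alpha>)"
  by (intro bidegree_has_type type_proj_bidegree)

lemma type_proj_decomposition:
  "alternating \<alpha> \<Longrightarrow> (\<Sum>p\<le>CARD('n). \<Sum>q\<le>CARD('n). type_proj p q \<alpha>) = \<alpha>"
  for \<alpha> :: "(complex^'n::finite) alt"
  using alternating_decomposable[of \<alpha>] unfolding decomposable_def by simp

lemma has_type_bidegree: "has_type p q \<alpha> \<Longrightarrow> bidegree p q \<alpha>"
  by (metis has_type_alternating type_proj_bidegree type_proj_has_type)

section \<open>Positive definite real bilinear forms\<close>

lemma bilinear_sum_left: "bilinear h \<Longrightarrow> h (\<Sum>i\<in>I. f i) y = (\<Sum>i\<in>I. h (f i) y)"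
  and bilinear_sum_right: "bilinear h \<Longrightarrow> h x (\<Sum>i\<in>I. f i) = (\<Sum>i\<in>I. h x (f i))"
  using linear_sum[of "\<lambda>x. h x y" f I] linear_sum[of "h x" f I] by (simp_all add: bilinear_def)

lemma orthonormal_independent:
  fixes g :: "'v::euclidean_space \<Rightarrow> 'v \<Rightarrow> real"
  assumes "bilinear g" "finite B" "\<And>u v. u \<in> B \<Longrightarrow> v \<in> B \<Longrightarrow> g u v = (if u = v then 1 else 0)"
  shows "independent B"
proof -
  have "r v = 0" if "(\<Sum>b\<in>B. r b *\<^sub>R b) = 0" "v \<in> B" for r v
  proof -
    have "0 = g (\<Sum>b\<in>B. r b *\<^sub>R b) v"
      using that bilinear_lzero[OF assms(1)] by simp
    also have "\<dots> = (\<Sum>b\<in>B. r b * g b v)"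
      using assms(1) by (simp add: bilinear_sum_left bilinear_lmul)
    also have "\<dots> = (\<Sum>b\<in>B. if b = v then r b else 0)"
      using that by (intro sum.cong) (auto simp: assms(3))
    also have "\<dots> = r v"
      using that assms(2) by simp
    finally show ?thesis by simp
  qed
  then show ?thesis
    using dependent_finite[OF assms(2)] by blast
qed

lemma orthonormal_expansion:
  fixes g :: "'v::euclidean_space \<Rightarrow> 'v \<Rightarrow> real"
  assumes "bilinear g" "finite B" "\<And>u v. u \<in> B \<Longrightarrow> v \<in> B \<Longrightarrow> g u v = (if u = v then 1 else 0)"
    and "card B = DIM('v)"
  shows "(\<Sum>b\<in>B. g v b *\<^sub>R b) = v"
proof -
  have "UNIV \<subseteq> span B"
    by (rule card_ge_dim_independent) (auto simp: orthonormal_independent[OF assms(1-3)] assms(4))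
  then obtain r where r: "v = (\<Sum>b\<in>B. r b *\<^sub>R b)"
    using span_finite[OF assms(2)] by auto
  have "g v c = r c" if "c \<in> B" for c
  proof -
    have "g v c = (\<Sum>b\<in>B. r b * g b c)"
      unfolding r using assms(1) by (simp add: bilinear_sum_left bilinear_lmul)
    also have "\<dots> = (\<Sum>b\<in>B. if b = c then r b else 0)"
      using that by (intro sum.cong) (auto simp: assms(3))
    finally show ?thesis using that assms(2) by simp
  qed
  then show ?thesis using r by simp
qed

text \<open>Gram-Schmidt for an arbitrary positive definite form: fewer than \<open>DIM('v)\<close>
  vectors do not span, so a vector outside the span can be projected off it and normalised.\<close>

lemma orthonormal_exists:
  fixes g :: "'v::euclidean_space \<Rightarrow> 'v \<Rightarrow> real"
  assumes bil: "bilinear g" and sym: "\<And>u v. g u v = g v u" and pos: "\<And>v. v \<noteq> 0 \<Longrightarrow> 0 < g v v"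
  shows "k \<le> DIM('v) \<Longrightarrow>
    \<exists>B. finite B \<and> card B = k \<and> (\<forall>u\<in>B. \<forall>v\<in>B. g u v = (if u = v then 1 else 0))"
proof (induction k)
  case 0
  then show ?case by (intro exI[of _ "{}"]) auto
next
  case (Suc k)
  then obtain B where B: "finite B" "card B = k" "\<And>u v. u \<in> B \<Longrightarrow> v \<in> B \<Longrightarrow> g u v = (if u = v then 1 else 0)"
    by auto
  have "span B \<noteq> UNIV"
    using Suc.prems B(1,2) by (metis dim_UNIV dim_le_card' dim_span not_less_eq_eq)
  then obtain v where v: "v \<notin> span B" by blast
  define u where "u = v - (\<Sum>b\<in>B. g v b *\<^sub>R b)"
  have "u \<noteq> 0"
    using v span_sum[of B "\<lambda>b. g v b *\<^sub>R b" B] by (auto simp: u_def span_base span_scale)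
  then have gu: "0 < g u u" by (rule pos)
  have ub: "g u b = 0" if "b \<in> B" for b
  proof -
    have "g u b = g v b - (\<Sum>c\<in>B. g v c * g c b)"
      unfolding u_def using bil by (simp add: bilinear_sum_left bilinear_lmul bilinear_lsub)
    also have "(\<Sum>c\<in>B. g v c * g c b) = (\<Sum>c\<in>B. if c = b then g v c else 0)"
      using that by (intro sum.cong) (auto simp: B(3))
    finally show ?thesis using that B(1) by simp
  qed
  define e where "e = (1 / sqrt (g u u)) *\<^sub>R u"
  have eb: "g e b = 0" "g b e = 0" if "b \<in> B" for b
    using ub[OF that] sym[of b e] bil by (simp_all add: e_def bilinear_lmul)
  have ee: "g e e = 1"
    using gu bil by (simp add: e_def bilinear_lmul bilinear_rmul field_simps)
  have "e \<notin> B"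
    using ee eb by fastforce
  then show ?case
    using B eb ee by (intro exI[of _ "insert e B"]) auto
qed

section \<open>Hermitian linear algebra of forms\<close>

text \<open>A form of type (1, 1) is invariant under multiplication of both arguments by
  \<open>\<i>\<close>; together with antisymmetry this makes the associated real form symmetric. The
  last clause recovers \<open>w\<close> from the metric.\<close>

lemma positive_11_props:
  assumes "positive_11 w"
  shows "bilinear (riem w)" "riem w u v = riem w v u" "v \<noteq> 0 \<Longrightarrow> 0 < riem w v v"
    "w [u, v] = of_real (riem w (\<i> *s u) v)"
proof -
  have alt: "alternating w" and ty: "has_type 1 1 w" and re: "w [u, v] \<in> \<real>" for u v
    using assms bidegree_has_type by (auto simp: positive_11_def)
  have J: "w [\<i> *s u, \<i> *s v] = w [u, v]" for u v
    using fun_cong[OF has_type_pull[OF ty, of \<i>], of "[u, v]"] by (simp add: pull_apply smul_apply)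
  have i: "\<i> *s (\<i> *s v) = - v" for v :: "complex^'a"
    by (simp add: vec_eq_iff flip: mult.assoc)
  have anti: "w [u, v] = - w [v, u]" for u v
    using fun_cong[OF ctr_anticomm[OF alt, of v u], of "[]"] by (simp add: ctr_apply)
  have neg: "w [u, - v] = - w [u, v]" for u v
    using linear_neg[OF alternating_linear[OF alt, of "[u]" "[]"]] by simp
  show sym: "riem w u v = riem w v u" for u v
  proof -
    have "w [u, \<i> *s v] = w [\<i> *s u, - v]"
      using J[of u "\<i> *s v"] unfolding i by (rule sym)
    also have "\<dots> = - w [\<i> *s u, v]" by (rule neg)
    also have "\<dots> = w [v, \<i> *s u]" using anti[of v "\<i> *s u"] by (rule sym)
    finally show ?thesis by (simp only: riem_def)
  qed
  have l: "linear (\<lambda>u. riem w u v)" for v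
    using linear_compose[OF alternating_linear[OF alt, of "[]" "[\<i> *s v]"] bounded_linear.linear[OF bounded_linear_Re]]
    by (simp add: riem_def comp_def)
  moreover have "riem w u = (\<lambda>v. riem w v u)" for u
    using sym by blast
  ultimately show "bilinear (riem w)"
    unfolding bilinear_def by metis
  show "0 < riem w v v" if "v \<noteq> 0"
    using assms that by (simp add: riem_def positive_11_def)
  show "w [u, v] = of_real (riem w (\<i> *s u) v)"
    using re by (simp add: riem_def J)
qed

lemma orthonormal_frame_of:
  fixes w :: "(complex^'n::finite) alt"
  assumes "positive_11 w"
  shows "orthonormal_frame w (frame_of w)"
proof -
  have "\<exists>B. orthonormal_frame w B"
    using orthonormal_exists[OF positive_11_props(1-3)[OF assms], of "2 * CARD('n)"]
    by (simp add: orthonormal_frame_def)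
  then show ?thesis
    unfolding frame_of_def by (rule someI_ex)
qed

lemma frame_expansion:
  fixes w :: "(complex^'n::finite) alt"
  assumes "positive_11 w" "orthonormal_frame w B"
  shows "(\<Sum>b\<in>B. riem w v b *\<^sub>R b) = v"
  using assms(2)
  by (intro orthonormal_expansion[OF positive_11_props(1)[OF assms(1)]]) (auto simp: orthonormal_frame_def)

lemma orthonormal_frame_image:
  fixes L :: "complex^'n::finite \<Rightarrow> complex^'n"
  assumes B: "orthonormal_frame w B" and w: "positive_11 w'"
    and L: "linear L" and iso: "\<And>u v. riem w' (L u) (L v) = riem w u v"
    and w0: "positive_11 w"
  shows "orthonormal_frame w' (L ` B)" "inj_on L B"
proof -
  have "inj L"
  proof (subst linear_injective_0[OF L], intro allI impI)
    fix v assume "L v = 0"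
    then have "riem w v v = 0"
      using iso[of v v] bilinear_lzero[OF positive_11_props(1)[OF w]] by simp
    then show "v = 0"
      using positive_11_props(3)[OF w0, of v] by force
  qed
  then show inj: "inj_on L B"
    by (rule inj_on_subset) simp
  show "orthonormal_frame w' (L ` B)"
    using B inj by (auto simp: orthonormal_frame_def card_image iso inj_on_eq_iff)
qed

text \<open>Unit complex scalars are isometries because \<open>w\<close> has weight
  \<open>l * cnj l\<close>, which is 1. Rotating the frame is the source of the orthogonality of
  bidegrees and of the commutator formula for \<open>Lambda_alt\<close>.\<close>

lemma orthonormal_frame_rotate:
  assumes "orthonormal_frame w B" "positive_11 w" "cmod l = 1"
  shows "orthonormal_frame w ((*s) l ` B)" "inj_on ((*s) l) B"
proof -
  have "has_type 1 1 w"
    using assms(2) bidegree_has_type by (auto simp: positive_11_def)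
  then have r: "w [l *s u, l *s v] = of_real ((cmod l)\<^sup>2) * w [u, v]" for u v
    using fun_cong[OF has_type_pull[of 1 1 w l], of "[u, v]"]
    by (simp add: pull_apply smul_apply complex_norm_square del: of_real_power)
  have "riem w (l *s u) (l *s v) = riem w u v" for u v
  proof -
    have "\<i> *s (l *s v) = l *s (\<i> *s v)"
      by (simp add: vec_eq_iff)
    then show ?thesis
      using assms(3) by (simp only: riem_def r) simp
  qed
  then show "orthonormal_frame w ((*s) l ` B)" "inj_on ((*s) l) B"
    using orthonormal_frame_image[OF assms(1,2) linear_smult _ assms(2)] by blast+
qed

section \<open>The inverse Gram matrix and traces over frames\<close>

abbreviation rcoord :: "'n \<times> bool \<Rightarrow> complex^'n::finite \<Rightarrow> real" where
  "rcoord b v \<equiv> if snd b then Im (v $ fst b) else Re (v $ fst b)"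

lemma linear_rcoord: "linear (rcoord b)"
  by (auto intro!: linearI simp: vector_scaleR_component)

lemma rcoord_real_basis: "rcoord a (real_basis b) = (if a = b then 1 else 0)"
  by (cases a; cases b) (auto simp: real_basis_def axis_def)

definition gram :: "(complex^'n::finite) alt \<Rightarrow> real^('n \<times> bool)^('n \<times> bool)" where
  "gram w = (\<chi> a b. riem w (real_basis a) (real_basis b))"

definition gram_inv :: "(complex^'n::finite) alt \<Rightarrow> 'n \<times> bool \<Rightarrow> 'n \<times> bool \<Rightarrow> real" where
  "gram_inv w j l = det (\<chi> a b. if b = j then axis l 1 $ a else gram w $ a $ b) / det (gram w)"

text \<open>Expanding the coordinate vectors in the frame shows that the matrix \<open>P\<close> of
  the frame sums is a right inverse of \<open>gram w\<close>. A quantity defined through a chosen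
  frame is thereby determined by the metric alone.\<close>

lemma gram_inverse:
  assumes w: "positive_11 w" and B: "orthonormal_frame w B"
  shows "det (gram w) \<noteq> 0" "(\<Sum>b\<in>B. rcoord j b * rcoord l b) = gram_inv w j l"
proof -
  define P :: "real^('a \<times> bool)^('a \<times> bool)" where "P = (\<chi> j l. \<Sum>b\<in>B. rcoord j b * rcoord l b)"
  have bil: "bilinear (riem w)" using positive_11_props(1)[OF w] .
  have row: "(\<Sum>j\<in>UNIV. riem w (real_basis i) (real_basis j) * rcoord j b) = riem w (real_basis i) b" for i b
  proof -
    have "riem w (real_basis i) b = riem w (real_basis i) (\<Sum>j\<in>UNIV. rcoord j b *\<^sub>R real_basis j)"
      using real_basis_expansion[of b] by simp
    also have "\<dots> = (\<Sum>j\<in>UNIV. rcoord j b * riem w (real_basis i) (real_basis j))"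
      using bil by (simp add: bilinear_sum_right bilinear_rmul)
    finally show ?thesis by (simp add: mult.commute)
  qed
  have "(gram w ** P) $ i $ l = mat 1 $ i $ l" for i l
  proof -
    have "(gram w ** P) $ i $ l = (\<Sum>b\<in>B. (\<Sum>j\<in>UNIV. riem w (real_basis i) (real_basis j) * rcoord j b) * rcoord l b)"
      unfolding matrix_matrix_mult_def P_def gram_def
      by (simp add: sum_distrib_left sum_distrib_right mult.assoc) (subst sum.swap, simp)
    also have "\<dots> = (\<Sum>b\<in>B. riem w (real_basis i) b * rcoord l b)"
      by (simp only: row)
    also have "\<dots> = rcoord l (\<Sum>b\<in>B. riem w (real_basis i) b *\<^sub>R b)"
      by (simp only: linear_sum[OF linear_rcoord] linear_cmul[OF linear_rcoord] real_scaleR_def)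
    also have "\<dots> = rcoord l (real_basis i)"
      by (simp only: frame_expansion[OF w B])
    also have "\<dots> = mat 1 $ i $ l"
      by (auto simp: rcoord_real_basis mat_def)
    finally show ?thesis .
  qed
  then have GP: "gram w ** P = mat 1"
    by (simp add: vec_eq_iff)
  then show d: "det (gram w) \<noteq> 0"
    by (metis det_I det_mul mult_zero_left zero_neq_one)
  have "gram w *v column l P = axis l 1"
    using GP by (metis matrix_vector_mul_assoc matrix_vector_mul_lid matrix_vector_mult_basis)
  then have "column l P $ j = gram_inv w j l"
    unfolding cramer[OF d] gram_inv_def by simp
  then show "(\<Sum>b\<in>B. rcoord j b * rcoord l b) = gram_inv w j l"
    by (simp add: column_def P_def)
qed

text \<open>Contractions over an orthonormal frame depend smoothly on the metric and not on the frame.\<close>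

lemma frame_trace:
  fixes Q :: "complex^'n::finite \<Rightarrow> complex^'n \<Rightarrow> complex"
  assumes w: "positive_11 w" and B: "orthonormal_frame w B" and Q: "bilinear Q"
  shows "(\<Sum>b\<in>B. Q b b) = (\<Sum>j\<in>UNIV. \<Sum>l\<in>UNIV. of_real (gram_inv w j l) * Q (real_basis j) (real_basis l))"
proof -
  have "Q b b = (\<Sum>j\<in>UNIV. \<Sum>l\<in>UNIV. of_real (rcoord j b * rcoord l b) * Q (real_basis j) (real_basis l))" for b
  proof -
    have "Q b b = Q (\<Sum>j\<in>UNIV. rcoord j b *\<^sub>R real_basis j) (\<Sum>l\<in>UNIV. rcoord l b *\<^sub>R real_basis l)"
      using real_basis_expansion[of b] by simp
    also have "\<dots> = (\<Sum>j\<in>UNIV. \<Sum>l\<in>UNIV. of_real (rcoord j b * rcoord l b) * Q (real_basis j) (real_basis l))"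
      by (simp only: bilinear_sum_left[OF Q] bilinear_sum_right[OF Q] bilinear_lmul[OF Q] bilinear_rmul[OF Q]
          scaleR_sum_right scaleR_scaleR) (subst sum.swap, simp only: scaleR_conv_of_real mult.commute[of "rcoord _ b" "rcoord _ b"])
    finally show ?thesis .
  qed
  then have "(\<Sum>b\<in>B. Q b b) = (\<Sum>b\<in>B. \<Sum>j\<in>UNIV. \<Sum>l\<in>UNIV. of_real (rcoord j b * rcoord l b) * Q (real_basis j) (real_basis l))"
    by (rule sum.cong[OF refl])
  also have "\<dots> = (\<Sum>j\<in>UNIV. \<Sum>b\<in>B. \<Sum>l\<in>UNIV. of_real (rcoord j b * rcoord l b) * Q (real_basis j) (real_basis l))"
    by (rule sum.swap)
  also have "\<dots> = (\<Sum>j\<in>UNIV. \<Sum>l\<in>UNIV. \<Sum>b\<in>B. of_real (rcoord j b * rcoord l b) * Q (real_basis j) (real_basis l))"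
    by (rule sum.cong[OF refl], rule sum.swap)
  also have "\<dots> = (\<Sum>j\<in>UNIV. \<Sum>l\<in>UNIV. of_real (gram_inv w j l) * Q (real_basis j) (real_basis l))"
    by (simp only: sum_distrib_right[symmetric] of_real_sum[symmetric] gram_inverse(2)[OF w B])
  finally show ?thesis .
qed

lemma frame_trace_unique:
  fixes Q :: "complex^'n::finite \<Rightarrow> complex^'n \<Rightarrow> complex"
  assumes "positive_11 w" "orthonormal_frame w B" "orthonormal_frame w B'" "bilinear Q"
  shows "(\<Sum>b\<in>B. Q b b) = (\<Sum>b\<in>B'. Q b b)"
  by (simp only: frame_trace[OF assms(1,2,4)] frame_trace[OF assms(1,3,4)])

text \<open>The degree k part of \<open>inner_alt\<close>, apart from the factor 1/k!, written as k
  nested traces so that induction on k applies.\<close>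

primrec frame_sum :: "'v set \<Rightarrow> nat \<Rightarrow> 'v alt \<Rightarrow> 'v alt \<Rightarrow> complex" where
  "frame_sum B 0 \<alpha> \<beta> = \<alpha> [] * cnj (\<beta> [])"
| "frame_sum B (Suc k) \<alpha> \<beta> = (\<Sum>b\<in>B. frame_sum B k (ctr b \<alpha>) (ctr b \<beta>))"

lemma frame_sum_lists:
  assumes "finite B"
  shows "frame_sum B k \<alpha> \<beta> = (\<Sum>vs | set vs \<subseteq> B \<and> length vs = k. \<alpha> vs * cnj (\<beta> vs))"
proof (induction k arbitrary: \<alpha> \<beta>)
  case 0
  have "{vs. set vs \<subseteq> B \<and> vs = []} = {[]}" by auto
  then show ?case by simp
next
  case (Suc k)
  have "(\<Sum>vs | set vs \<subseteq> B \<and> length vs = Suc k. \<alpha> vs * cnj (\<beta> vs)) =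
    (\<Sum>(vs, b)\<in>{vs. set vs \<subseteq> B \<and> length vs = k} \<times> B. \<alpha> (b # vs) * cnj (\<beta> (b # vs)))"
    unfolding lists_length_Suc_eq by (subst sum.reindex) (auto simp: inj_on_def split_def)
  also have "\<dots> = (\<Sum>b\<in>B. \<Sum>vs | set vs \<subseteq> B \<and> length vs = k. \<alpha> (b # vs) * cnj (\<beta> (b # vs)))"
    unfolding sum.cartesian_product[symmetric] by (rule sum.swap)
  finally show ?case by (simp add: Suc ctr_apply)
qed

lemma frame_sum_add:
  "frame_sum B k (\<alpha> + \<alpha>') \<beta> = frame_sum B k \<alpha> \<beta> + frame_sum B k \<alpha>' \<beta>"
  "frame_sum B k \<alpha> (\<beta> + \<beta>') = frame_sum B k \<alpha> \<beta> + frame_sum B k \<alpha> \<beta>'"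
  by (induction k arbitrary: \<alpha> \<alpha>' \<beta> \<beta>') (simp_all add: ctr_add sum.distrib algebra_simps)

lemma frame_sum_smul:
  "frame_sum B k (smul c \<alpha>) \<beta> = c * frame_sum B k \<alpha> \<beta>"
  "frame_sum B k \<alpha> (smul c \<beta>) = cnj c * frame_sum B k \<alpha> \<beta>"
  by (induction k arbitrary: \<alpha> \<beta>) (simp_all add: ctr_smul smul_apply sum_distrib_left)

lemma frame_sum_zero [simp]: "frame_sum B k 0 \<beta> = 0" "frame_sum B k \<beta> 0 = 0"
  using frame_sum_smul(1)[of B k 0 0 \<beta>] frame_sum_smul(2)[of B k \<beta> 0 0] by simp_all

lemma frame_sum_minus: "frame_sum B k (- \<alpha>) \<beta> = - frame_sum B k \<alpha> \<beta>"
  "frame_sum B k \<alpha> (- \<beta>) = - frame_sum B k \<alpha> \<beta>"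
proof -
  have "- \<gamma> = smul (-1) \<gamma>" for \<gamma> :: "'a alt"
    by (simp add: smul_def fun_eq_iff)
  then show "frame_sum B k (- \<alpha>) \<beta> = - frame_sum B k \<alpha> \<beta>"
    "frame_sum B k \<alpha> (- \<beta>) = - frame_sum B k \<alpha> \<beta>"
    by (simp_all only: frame_sum_smul) simp_all
qed

lemma frame_sum_sum: "frame_sum B k \<alpha> (\<Sum>i\<in>I. f i) = (\<Sum>i\<in>I. frame_sum B k \<alpha> (f i))"
  using sum_comp_morphism[of "frame_sum B k \<alpha>" f I] by (simp add: frame_sum_add comp_def)

lemma bilinear_frame_sum:
  assumes "alternating \<alpha>" "alternating \<beta>"
  shows "bilinear (\<lambda>u v. frame_sum B k (ctr u \<alpha>) (ctr v \<beta>))"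
  unfolding bilinear_def using assms
  by (auto intro!: linearI simp: ctr_linear frame_sum_add frame_sum_smul scaleR_conv_of_real)

text \<open>The frame is exchanged slot by slot: the induction hypothesis treats the inner slots,
  and the outermost sum is the trace of a bilinear form.\<close>

lemma frame_sum_unique:
  assumes "positive_11 w" "orthonormal_frame w B" "orthonormal_frame w B'" "alternating \<alpha>" "alternating \<beta>"
  shows "frame_sum B k \<alpha> \<beta> = frame_sum B' k \<alpha> \<beta>"
  using assms(4,5)
proof (induction k arbitrary: \<alpha> \<beta>)
  case (Suc k)
  have "frame_sum B (Suc k) \<alpha> \<beta> = (\<Sum>b\<in>B. frame_sum B' k (ctr b \<alpha>) (ctr b \<beta>))"
    using Suc by (simp add: alternating_ctr)
  also have "\<dots> = (\<Sum>b\<in>B'. frame_sum B' k (ctr b \<alpha>) (ctr b \<beta>))"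
    by (rule frame_trace_unique[OF assms(1-3) bilinear_frame_sum]) (use Suc in auto)
  finally show ?case by simp
qed simp

lemma frame_sum_pull:
  assumes "inj_on L B"
  shows "frame_sum B k (pull L \<alpha>) (pull L \<beta>) = frame_sum (L ` B) k \<alpha> \<beta>"
  by (induction k arbitrary: \<alpha> \<beta>) (simp_all add: ctr_pull sum.reindex[OF assms], simp_all add: pull_apply)

lemma inner_alt_frame_sum:
  fixes w :: "(complex^'n::finite) alt"
  assumes "positive_11 w"
  shows "inner_alt w \<alpha> \<beta> = (\<Sum>k\<le>2 * CARD('n). frame_sum (frame_of w) k \<alpha> \<beta> / fact k)"
proof -
  let ?B = "frame_of w"
  have fin: "finite ?B"
    using orthonormal_frame_of[OF assms] by (simp add: orthonormal_frame_def)
  have "(\<Sum>k\<le>2 * CARD('n). frame_sum ?B k \<alpha> \<beta> / fact k) =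
    (\<Sum>k\<in>{..2 * CARD('n)}. \<Sum>vs | vs \<in> {vs. set vs \<subseteq> ?B \<and> length vs \<le> 2 * CARD('n)} \<and> length vs = k.
      \<alpha> vs * cnj (\<beta> vs) / fact (length vs))"
    by (intro sum.cong refl) (auto simp: frame_sum_lists[OF fin] sum_divide_distrib intro!: sum.cong)
  also have "\<dots> = inner_alt w \<alpha> \<beta>"
    unfolding inner_alt_def by (rule sum.group) (auto simp: finite_lists_length_le[OF fin])
  finally show ?thesis by simp
qed

lemma inner_alt_add:
  "inner_alt w (\<alpha> + \<alpha>') \<beta> = inner_alt w \<alpha> \<beta> + inner_alt w \<alpha>' \<beta>"
  "inner_alt w \<alpha> (\<beta> + \<beta>') = inner_alt w \<alpha> \<beta> + inner_alt w \<alpha> \<beta>'"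
  by (simp_all add: inner_alt_def sum.distrib algebra_simps add_divide_distrib)

lemma inner_alt_smul:
  "inner_alt w (smul c \<alpha>) \<beta> = c * inner_alt w \<alpha> \<beta>"
  "inner_alt w \<alpha> (smul c \<beta>) = cnj c * inner_alt w \<alpha> \<beta>"
  by (simp_all add: inner_alt_def smul_apply sum_distrib_left mult_ac)

lemma inner_alt_zero [simp]: "inner_alt w 0 \<beta> = 0" "inner_alt w \<beta> 0 = 0"
  by (simp_all add: inner_alt_def)

lemma inner_alt_sum:
  "inner_alt w (\<Sum>i\<in>I. f i) \<beta> = (\<Sum>i\<in>I. inner_alt w (f i) \<beta>)"
  "inner_alt w \<alpha> (\<Sum>i\<in>I. f i) = (\<Sum>i\<in>I. inner_alt w \<alpha> (f i))"
  using sum_comp_morphism[of "inner_alt w \<alpha>" f I] sum_comp_morphism[of "\<lambda>\<alpha>. inner_alt w \<alpha> \<beta>" f I]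
  by (simp_all add: inner_alt_add comp_def)

lemma inner_alt_diff:
  "inner_alt w \<alpha> (\<beta> - \<beta>') = inner_alt w \<alpha> \<beta> - inner_alt w \<alpha> \<beta>'"
  using inner_alt_add(2)[of w \<alpha> "\<beta> - \<beta>'" \<beta>'] by simp

lemma inner_alt_nonneg: "inner_alt w \<alpha> \<alpha> \<in> \<real>" "0 \<le> Re (inner_alt w \<alpha> \<alpha>)"
proof -
  let ?r = "\<Sum>vs | set vs \<subseteq> frame_of w \<and> length vs \<le> 2 * CARD('a). (cmod (\<alpha> vs))\<^sup>2 / fact (length vs)"
  have r: "inner_alt w \<alpha> \<alpha> = of_real ?r"
    unfolding inner_alt_def complex_norm_square[symmetric] of_real_sum by (intro sum.cong) auto
  show "inner_alt w \<alpha> \<alpha> \<in> \<real>" "0 \<le> Re (inner_alt w \<alpha> \<alpha>)"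
    unfolding r Re_complex_of_real by (rule Reals_of_real, intro sum_nonneg) auto
qed

lemma alternating_frame_zero:
  assumes w: "positive_11 w" and B: "orthonormal_frame w B"
    and "alternating \<alpha>" "\<And>vs. set vs \<subseteq> B \<Longrightarrow> length vs = k \<Longrightarrow> \<alpha> vs = 0" "length us = k"
  shows "\<alpha> us = 0"
  using assms(3-5)
proof (induction us arbitrary: k \<alpha>)
  case (Cons u us)
  have "\<alpha> (u # us) = (\<Sum>b\<in>B. smul (of_real (riem w u b)) (ctr b \<alpha>)) us"
    using ctr_sum_vec[OF Cons(2), of "riem w u" "\<lambda>b. b" B] frame_expansion[OF w B, of u] by (metis ctr_apply)
  also have "\<dots> = (\<Sum>b\<in>B. of_real (riem w u b) * ctr b \<alpha> us)"
    by (simp only: sum_fun_apply smul_apply)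
  also have "\<dots> = 0"
  proof (intro sum.neutral ballI)
    fix b assume b: "b \<in> B"
    have "ctr b \<alpha> vs = 0" if "set vs \<subseteq> B" "length vs = length us" for vs
      using Cons(3)[of "b # vs"] Cons(4) that b by (simp add: ctr_apply)
    then have "ctr b \<alpha> us = 0"
      using Cons(1)[OF alternating_ctr[OF Cons(2)]] by blast
    then show "of_real (riem w u b) * ctr b \<alpha> us = 0" by simp
  qed
  finally show ?case .
qed simp

lemma inner_alt_definite:
  assumes w: "positive_11 w" and "alternating \<alpha>" "inner_alt w \<alpha> \<alpha> = 0"
  shows "\<alpha> = 0"
proof
  fix us
  let ?L = "{vs. set vs \<subseteq> frame_of w \<and> length vs \<le> 2 * CARD('a)}"
  have B: "orthonormal_frame w (frame_of w)" by (rule orthonormal_frame_of[OF w])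
  then have fin: "finite ?L"
    by (simp add: finite_lists_length_le orthonormal_frame_def)
  define R where "R = (\<Sum>vs\<in>?L. (cmod (\<alpha> vs))\<^sup>2 / fact (length vs))"
  have "inner_alt w \<alpha> \<alpha> = of_real R"
    unfolding R_def inner_alt_def complex_norm_square[symmetric] of_real_sum by (intro sum.cong) auto
  then have "R = 0"
    using assms(3) by simp
  then have z: "\<alpha> vs = 0" if "vs \<in> ?L" for vs
    using that fin unfolding R_def by (subst (asm) sum_nonneg_eq_0_iff) auto
  show "\<alpha> us = 0 us"
  proof (cases "length us \<le> 2 * CARD('a)")
    case True
    then show ?thesis
      using alternating_frame_zero[OF w B assms(2) z, of "length us" us] by auto
  next
    case False
    then show ?thesis using alternating_long_zero[OF assms(2), of us] by simp
  qed
qed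

lemma inner_alt_eqI:
  assumes "positive_11 w" "alternating \<alpha>" "alternating \<beta>"
    and "\<And>\<gamma>. alternating \<gamma> \<Longrightarrow> inner_alt w \<gamma> \<alpha> = inner_alt w \<gamma> \<beta>"
  shows "\<alpha> = \<beta>"
  using inner_alt_definite[OF assms(1) alternating_diff[OF assms(2,3)]] assms(4)[OF alternating_diff[OF assms(2,3)]]
  by (simp add: inner_alt_diff)

text \<open>In different total degrees no argument list sees both forms. In equal degree, rotation
  by a unit scalar preserves the inner product but multiplies it by a phase, and the scalar can be
  chosen so that the phase is -1.\<close>

lemma inner_alt_type_orthogonal:
  assumes w: "positive_11 w" and \<alpha>: "has_type p q \<alpha>" and \<beta>: "has_type r s \<beta>" and ne: "p \<noteq> r \<or> q \<noteq> s"
  shows "inner_alt w \<alpha> \<beta> = 0"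
proof (cases "p + q = r + s")
  case False
  have "\<alpha> vs * cnj (\<beta> vs) = 0" for vs
  proof -
    have "int (length vs) \<noteq> int (p + q) \<or> int (length vs) \<noteq> int (r + s)"
      using False by (metis of_nat_eq_iff)
    then show ?thesis
      using has_type_degree[OF \<alpha>] has_type_degree[OF \<beta>] by (auto simp only: has_degree_def mult_zero_left complex_cnj_zero mult_zero_right)
  qed
  then show ?thesis by (simp only: inner_alt_def div_0 sum.neutral_const)
next
  case True
  \<comment> \<open>The phase has exponent \<open>p - q - (r - s)\<close> times the angle. This
    exponent is nonzero since the total degrees agree while the types differ, so dividing
    \<open>pi\<close> by it makes the phase -1.\<close>
  define t where "t = pi / (real p - real q - (real r - real s))"
  define l where "l = cis t"
  have ne': "real p - real q - (real r - real s) \<noteq> 0"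
    using True ne by linarith
  have B: "orthonormal_frame w (frame_of w)" by (rule orthonormal_frame_of[OF w])
  have l: "cmod l = 1" by (simp add: l_def)
  have alt: "alternating \<alpha>" "alternating \<beta>" using \<alpha> \<beta> by (auto simp: has_type_def)
  have "inner_alt w (pull ((*s) l) \<alpha>) (pull ((*s) l) \<beta>) = inner_alt w \<alpha> \<beta>"
    unfolding inner_alt_frame_sum[OF w] frame_sum_pull[OF orthonormal_frame_rotate(2)[OF B w l]]
    using frame_sum_unique[OF w orthonormal_frame_rotate(1)[OF B w l] B alt] by simp
  moreover have "inner_alt w (pull ((*s) l) \<alpha>) (pull ((*s) l) \<beta>)
     = l ^ p * cnj l ^ q * (cnj l ^ r * l ^ s) * inner_alt w \<alpha> \<beta>"
    by (simp add: has_type_pull[OF \<alpha>] has_type_pull[OF \<beta>] inner_alt_smul)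
  moreover have "l ^ p * cnj l ^ q * (cnj l ^ r * l ^ s)
     = cis ((real p - real q - (real r - real s)) * t)"
    unfolding l_def by (simp only: cis_cnj Complex.DeMoivre cis_mult) (simp add: algebra_simps)
  moreover have "\<dots> = -1" using ne' by (simp add: t_def)
  ultimately show ?thesis by simp
qed

section \<open>The weight operator on the fibre and the twisted inner product\<close>

definition theta_alt :: "real \<Rightarrow> (complex^'n::finite) alt \<Rightarrow> (complex^'n) alt" where
  "theta_alt t \<alpha> = (\<Sum>p\<le>CARD('n). \<Sum>q\<le>CARD('n). smul (of_real (t ^ p)) (type_proj p q \<alpha>))"

lemma theta_alt_add: "theta_alt t (\<alpha> + \<beta>) = theta_alt t \<alpha> + theta_alt t \<beta>"
  and theta_alt_smul: "theta_alt t (smul c \<alpha>) = smul c (theta_alt t \<alpha>)"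
  by (simp_all add: theta_alt_def type_proj_add type_proj_smul smul_add smul_sum sum.distrib smul_smul mult.commute)

lemma theta_alt_zero [simp]: "theta_alt t 0 = 0"
  by (simp add: theta_alt_def)

lemma theta_alt_sum: "theta_alt t (\<Sum>i\<in>I. f i) = (\<Sum>i\<in>I. theta_alt t (f i))"
  using sum_comp_morphism[of "theta_alt t" f I] by (simp add: theta_alt_add comp_def)

lemma theta_alt_alternating: "alternating \<alpha> \<Longrightarrow> alternating (theta_alt t \<alpha>)"
  unfolding theta_alt_def
  by (intro alternating_sum alternating_smul has_type_alternating[OF type_proj_type])

lemma theta_alt_has_type:
  fixes \<alpha> :: "(complex^'n::finite) alt"
  assumes "has_type p q \<alpha>"
  shows "theta_alt t \<alpha> = smul (of_real (t ^ p)) \<alpha>"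
proof -
  have "theta_alt t \<alpha> = (\<Sum>r\<le>CARD('n). \<Sum>s\<le>CARD('n). smul (of_real (t ^ p)) (type_proj r s \<alpha>))"
    unfolding theta_alt_def type_proj_has_type[OF assms] by (intro sum.cong) auto
  also have "\<dots> = smul (of_real (t ^ p)) \<alpha>"
    by (simp only: smul_sum[symmetric] type_proj_decomposition[OF has_type_alternating[OF assms]])
  finally show ?thesis .
qed

lemma theta_alt_mult:
  assumes "alternating \<alpha>" shows "theta_alt s (theta_alt t \<alpha>) = theta_alt (s * t) \<alpha>"
  unfolding theta_alt_def[of t] theta_alt_sum theta_alt_smul theta_alt_has_type[OF type_proj_type[OF assms]]
  by (simp add: theta_alt_def smul_smul power_mult_distrib mult.commute)

lemma theta_alt_one: "alternating \<alpha> \<Longrightarrow> theta_alt 1 \<alpha> = \<alpha>"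
  by (simp add: theta_alt_def type_proj_decomposition)

text \<open>By orthogonality only the diagonal of the double bidegree expansion survives. The
  resulting sum is symmetric in \<alpha> and \<beta> up to conjugation, whence
  \<open>theta_alt_selfadjoint\<close>.\<close>

lemma inner_theta_alt:
  fixes \<alpha> :: "(complex^'n::finite) alt"
  assumes w: "positive_11 w" and \<alpha>: "alternating \<alpha>" and \<beta>: "alternating \<beta>"
  shows "inner_alt w (theta_alt t \<alpha>) \<beta>
    = (\<Sum>p\<le>CARD('n). \<Sum>q\<le>CARD('n). of_real (t ^ p) * inner_alt w (type_proj p q \<alpha>) (type_proj p q \<beta>))"
proof -
  have "inner_alt w (type_proj p q \<alpha>) \<beta> = inner_alt w (type_proj p q \<alpha>) (type_proj p q \<beta>)"
    if pq: "p \<le> CARD('n)" "q \<le> CARD('n)" for p q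
  proof -
    have "inner_alt w (type_proj p q \<alpha>) \<beta>
      = (\<Sum>r\<le>CARD('n). \<Sum>s\<le>CARD('n). inner_alt w (type_proj p q \<alpha>) (type_proj r s \<beta>))"
      using arg_cong[OF type_proj_decomposition[OF \<beta>], of "inner_alt w (type_proj p q \<alpha>)"]
      by (simp only: inner_alt_sum)
    also have "\<dots> = (\<Sum>r\<le>CARD('n). if r = p then \<Sum>s\<le>CARD('n). if s = q then
        inner_alt w (type_proj p q \<alpha>) (type_proj p q \<beta>) else 0 else 0)"
    proof (intro sum.cong refl)
      fix r
      have z: "inner_alt w (type_proj p q \<alpha>) (type_proj r s \<beta>) = 0" if "r \<noteq> p \<or> s \<noteq> q" for s
        using that by (intro inner_alt_type_orthogonal[OF w type_proj_type[OF \<alpha>] type_proj_type[OF \<beta>]]) auto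
      show "(\<Sum>s\<le>CARD('n). inner_alt w (type_proj p q \<alpha>) (type_proj r s \<beta>)) = (if r = p then \<Sum>s\<le>CARD('n). if s = q then
        inner_alt w (type_proj p q \<alpha>) (type_proj p q \<beta>) else 0 else 0)"
      proof (cases "r = p")
        case True
        show ?thesis unfolding True if_P[OF refl] by (intro sum.cong refl) (use z True in auto)
      qed (use z in auto)
    qed
    also have "\<dots> = inner_alt w (type_proj p q \<alpha>) (type_proj p q \<beta>)"
      using pq by simp
    finally show ?thesis .
  qed
  then show ?thesis
    by (simp add: theta_alt_def inner_alt_sum inner_alt_smul del: of_real_power)
qed

lemma inner_alt_cnj: "inner_alt w \<beta> \<alpha> = cnj (inner_alt w \<alpha> \<beta>)"
  by (simp add: inner_alt_def cnj_sum mult.commute)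

lemma theta_alt_selfadjoint:
  assumes w: "positive_11 w" and \<alpha>: "alternating \<alpha>" and \<beta>: "alternating \<beta>"
  shows "inner_alt w (theta_alt t \<alpha>) \<beta> = inner_alt w \<alpha> (theta_alt t \<beta>)"
  unfolding inner_alt_cnj[of w _ "theta_alt t \<beta>"] inner_theta_alt[OF w \<alpha> \<beta>] inner_theta_alt[OF w \<beta> \<alpha>]
  by (simp add: cnj_sum inner_alt_cnj[of w "type_proj _ _ \<alpha>"])

text \<open>Collects the weights \<open>t ^ (2 * p)\<close> into one operator, so that the twisted
  product is handled through the plain one.\<close>

lemma twisted_inner_alt_eq:
  assumes w: "positive_11 w" and \<alpha>: "alternating \<alpha>" and \<beta>: "alternating \<beta>"
  shows "twisted_inner_alt t w \<alpha> \<beta> = inner_alt w (theta_alt (t\<^sup>2) \<alpha>) \<beta>"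
  by (simp add: twisted_inner_alt_def inner_theta_alt[OF assms] bidegree_part_eq \<alpha> \<beta> power_mult)

section \<open>Contraction with a one-form\<close>

text \<open>Contraction with the vector dual to \<open>a\<close> under the complex bilinear
  extension of the metric. It is linear in \<open>a\<close>, so the conjugation belonging to an
  adjoint appears explicitly.\<close>

definition contract :: "(complex^'n::finite) alt \<Rightarrow> (complex^'n \<Rightarrow> complex) \<Rightarrow> (complex^'n) alt \<Rightarrow> (complex^'n) alt" where
  "contract w a \<alpha> = (\<Sum>b\<in>frame_of w. smul (a b) (ctr b \<alpha>))"

lemma bilinear_contract:
  assumes "linear a" "alternating \<alpha>" "linear L"
  shows "bilinear (\<lambda>u v. a u * \<alpha> (L v # vs))"
  unfolding bilinear_def
proof (intro conjI allI)
  fix u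
  show "linear (\<lambda>v. a u * \<alpha> (L v # vs))"
    using linear_compose[OF linear_compose[OF assms(3) alternating_head_linear[OF assms(2)]] linear_times, of "a u"]
    by (simp add: comp_def)
qed (use assms(1) in \<open>auto simp: linear_iff algebra_simps\<close>)

lemma contract_frame:
  assumes w: "positive_11 w" and "orthonormal_frame w B" "linear a" "alternating \<alpha>"
  shows "contract w a \<alpha> = (\<Sum>b\<in>B. smul (a b) (ctr b \<alpha>))"
proof
  fix vs
  show "contract w a \<alpha> vs = (\<Sum>b\<in>B. smul (a b) (ctr b \<alpha>)) vs"
    unfolding contract_def sum_fun_apply smul_apply ctr_apply
    by (rule frame_trace_unique[OF w orthonormal_frame_of[OF w] assms(2)
        bilinear_contract[OF assms(3,4) linear_id, simplified]])
qed

lemma contract_coordinates: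
  assumes "positive_11 w" "linear a" "alternating \<alpha>"
  shows "contract w a \<alpha> vs = (\<Sum>j\<in>UNIV. \<Sum>l\<in>UNIV.
     of_real (gram_inv w j l) * (a (real_basis j) * \<alpha> (real_basis l # vs)))"
  unfolding contract_def sum_fun_apply smul_apply ctr_apply
  by (rule frame_trace[OF assms(1) orthonormal_frame_of[OF assms(1)]
        bilinear_contract[OF assms(2,3) linear_id, simplified]])

lemma contract_alternating: "alternating \<alpha> \<Longrightarrow> alternating (contract w a \<alpha>)"
  unfolding contract_def by (intro alternating_sum alternating_smul alternating_ctr)

lemma contract_degree: "has_degree k \<alpha> \<Longrightarrow> has_degree (k - 1) (contract w a \<alpha>)"
  unfolding contract_def by (intro has_degree_sum has_degree_smul has_degree_ctr)

lemma contract_smul_left: "contract w (\<lambda>v. c * a v) \<alpha> = smul c (contract w a \<alpha>)"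
  by (simp add: contract_def smul_sum smul_smul)

lemma contract_zero [simp]: "contract w a 0 = 0"
  by (simp add: contract_def ctr_zero)

text \<open>A map that commutes with \<open>\<i>\<close> and pulls \<open>w'\<close> back to
  \<open>w\<close> is an isometry; it carries the chosen frame of \<open>w\<close> to some frame of
  \<open>w'\<close>, which computes the same contraction. Chart changes are of this kind.\<close>

lemma contract_pull:
  fixes L :: "complex^'n::finite \<Rightarrow> complex^'n"
  assumes w: "positive_11 w" "positive_11 w'" and L: "linear L" "\<And>v. L (\<i> *s v) = \<i> *s L v"
    and pw: "w = pull L w'" and a: "linear a" and \<alpha>: "alternating \<alpha>"
  shows "contract w (a \<circ> L) (pull L \<alpha>) = pull L (contract w' a \<alpha>)"
proof -
  have iso: "riem w' (L u) (L v) = riem w u v" for u v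
    unfolding pw riem_def pull_def by (simp add: L)
  note im = orthonormal_frame_image[OF orthonormal_frame_of[OF w(1)] w(2) L(1) iso w(1)]
  show ?thesis
    unfolding contract_frame[OF w(2) im(1) a \<alpha>] sum.reindex[OF im(2)]
    by (simp add: contract_def pull_sum pull_smul ctr_pull)
qed

text \<open>The factor \<open>Suc k\<close> is the ratio of the factorials in two consecutive
  degrees. In the step, contraction by \<open>b\<close> either hits the one-form, giving one copy of
  the right side, or passes to \<gamma>, giving \<open>Suc k\<close> copies; the two signs on the
  way cancel.\<close>

lemma frame_sum_wedge_adjoint:
  assumes "alternating \<alpha>"
  shows "frame_sum B (Suc k) (wedge (oneform a) \<gamma>) \<alpha>
    = of_nat (Suc k) * frame_sum B k \<gamma> (\<Sum>b\<in>B. smul (cnj (a b)) (ctr b \<alpha>))"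
  using assms
proof (induction k arbitrary: \<gamma> \<alpha>)
  case 0
  have "frame_sum B (Suc 0) (wedge (oneform a) \<gamma>) \<alpha> = (\<Sum>b\<in>B. a b * (\<gamma> [] * cnj (\<alpha> [b])))"
    by (simp add: ctr_apply oneform_wedge_Cons mult.assoc)
  also have "\<dots> = \<gamma> [] * cnj ((\<Sum>b\<in>B. smul (cnj (a b)) (ctr b \<alpha>)) [])"
    by (simp add: sum_fun_apply smul_apply ctr_apply cnj_sum sum_distrib_left mult_ac)
  finally show ?case by simp
next
  case (Suc k)
  let ?c = "\<lambda>\<alpha>. \<Sum>b\<in>B. smul (cnj (a b)) (ctr b \<alpha>)"
  have c: "?c (ctr v \<alpha>) = - ctr v (?c \<alpha>)" for v
  proof
    fix vs
    have "\<alpha> (v # b # vs) = - \<alpha> (b # v # vs)" for b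
      using fun_cong[OF ctr_anticomm[OF Suc(2), of b v], of vs] by (simp add: ctr_apply)
    then show "?c (ctr v \<alpha>) vs = (- ctr v (?c \<alpha>)) vs"
      by (simp add: sum_fun_apply smul_apply ctr_apply sum_negf)
  qed
  have "frame_sum B (Suc (Suc k)) (wedge (oneform a) \<gamma>) \<alpha>
    = (\<Sum>b\<in>B. frame_sum B (Suc k) (smul (a b) \<gamma> + - wedge (oneform a) (ctr b \<gamma>)) (ctr b \<alpha>))"
    by (simp only: frame_sum.simps(2)[of B "Suc k"] ctr_oneform_wedge diff_conv_add_uminus)
  also have "\<dots> = (\<Sum>b\<in>B. a b * frame_sum B (Suc k) \<gamma> (ctr b \<alpha>))
    - (\<Sum>b\<in>B. frame_sum B (Suc k) (wedge (oneform a) (ctr b \<gamma>)) (ctr b \<alpha>))"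
    by (simp only: frame_sum_add frame_sum_smul frame_sum_minus sum.distrib sum_negf diff_conv_add_uminus)
  also have "(\<Sum>b\<in>B. a b * frame_sum B (Suc k) \<gamma> (ctr b \<alpha>)) = frame_sum B (Suc k) \<gamma> (?c \<alpha>)"
    by (simp only: frame_sum_sum frame_sum_smul complex_cnj_cnj)
  also have "(\<Sum>b\<in>B. frame_sum B (Suc k) (wedge (oneform a) (ctr b \<gamma>)) (ctr b \<alpha>))
    = (\<Sum>b\<in>B. of_nat (Suc k) * frame_sum B k (ctr b \<gamma>) (- ctr b (?c \<alpha>)))"
    by (simp only: Suc(1)[OF alternating_ctr[OF Suc(2)]] c)
  also have "\<dots> = - (of_nat (Suc k) * frame_sum B (Suc k) \<gamma> (?c \<alpha>))"
    by (simp only: frame_sum.simps(2) frame_sum_minus sum_negf sum_distrib_left mult_minus_right)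
  finally show ?case
    by (simp only: of_nat_Suc[of "Suc k"]) (simp only: algebra_simps mult_1 diff_minus_eq_add)
qed

lemma inner_alt_wedge_adjoint:
  fixes w :: "(complex^'n::finite) alt"
  assumes w: "positive_11 w" and \<alpha>: "alternating \<alpha>"
  shows "inner_alt w (wedge (oneform a) \<gamma>) \<alpha> = inner_alt w \<gamma> (contract w (\<lambda>v. cnj (a v)) \<alpha>)"
proof -
  let ?B = "frame_of w" and ?c = "contract w (\<lambda>v. cnj (a v)) \<alpha>"
  have fin: "finite ?B"
    using orthonormal_frame_of[OF w] by (simp add: orthonormal_frame_def)
  obtain m where m: "2 * CARD('n) = Suc m"
    by (metis Suc_pred nat_0_less_mult_iff zero_less_card_finite zero_less_numeral)
  have "inner_alt w (wedge (oneform a) \<gamma>) \<alpha>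
    = (\<Sum>k\<le>m. frame_sum ?B (Suc k) (wedge (oneform a) \<gamma>) \<alpha> / fact (Suc k))"
    unfolding inner_alt_frame_sum[OF w] m sum.atMost_Suc_shift by simp
  also have "\<dots> = (\<Sum>k\<le>m. frame_sum ?B k \<gamma> ?c / fact k)"
  proof (intro sum.cong refl)
    fix k
    have "(of_nat (Suc k) :: complex) \<noteq> 0" by (metis of_nat_eq_0_iff nat.distinct(1))
    then show "frame_sum ?B (Suc k) (wedge (oneform a) \<gamma>) \<alpha> / fact (Suc k) = frame_sum ?B k \<gamma> ?c / fact k"
      unfolding frame_sum_wedge_adjoint[OF \<alpha>] contract_def fact_Suc by (rule mult_divide_mult_cancel_left)
  qed
  also have "\<dots> = inner_alt w \<gamma> ?c"
  proof -
    \<comment> \<open>After the index shift the sum stops one degree early. The missing top term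
      involves \<alpha> on lists of length 2n + 1, where it vanishes.\<close>
    have "?c vs = 0" if "length vs = Suc m" for vs
      unfolding contract_def sum_fun_apply smul_apply ctr_apply
      using that alternating_long_zero[OF \<alpha>] m by (intro sum.neutral ballI) simp
    then have "frame_sum ?B (Suc m) \<gamma> ?c = 0"
      unfolding frame_sum_lists[OF fin] by (intro sum.neutral) auto
    then show ?thesis
      unfolding inner_alt_frame_sum[OF w] m by simp
  qed
  finally show ?thesis .
qed

section \<open>One-forms and their (1, 0) and (0, 1) parts\<close>

lemma oneform_wedge_one: "wedge (oneform a) one_alt = oneform a"
proof
  fix vs show "wedge (oneform a) one_alt vs = oneform a vs"
    by (cases vs; cases "tl vs") (auto simp: oneform_wedge_sum oneform_def one_alt_def intro!: sum.neutral)
qed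

lemma oneform_add: "oneform (\<lambda>v. a v + b v) = oneform a + oneform b"
  and oneform_smul: "oneform (\<lambda>v. c * a v) = smul c (oneform a)"
  by (auto simp: fun_eq_iff oneform_def smul_def)

lemma linear_rotate_complex:
  fixes d :: "complex^'n::finite \<Rightarrow> complex"
  assumes "linear d"
  shows "d (l *s v) = of_real (Re l) * d v + of_real (Im l) * d (\<i> *s v)"
proof -
  have "l *s v = Re l *\<^sub>R v + Im l *\<^sub>R (\<i> *s v)"
    by (simp add: vec_eq_iff vector_scaleR_component complex_eq_iff)
  then show ?thesis
    by (simp only: linear_add[OF assms] linear_cmul[OF assms] scaleR_conv_of_real[where 'a = complex])
qed

lemma smult_i_i: "\<i> *s (\<i> *s v) = - v" for v :: "complex^'n::finite"
  by (simp add: vec_eq_iff flip: mult.assoc)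

definition part10 :: "(complex^'n::finite \<Rightarrow> complex) \<Rightarrow> complex^'n \<Rightarrow> complex" where
  "part10 d v = (d v - \<i> * d (\<i> *s v)) / 2"

definition part01 :: "(complex^'n::finite \<Rightarrow> complex) \<Rightarrow> complex^'n \<Rightarrow> complex" where
  "part01 d v = (d v + \<i> * d (\<i> *s v)) / 2"

lemma part10_01:
  assumes "linear d"
  shows "part10 d v + part01 d v = d v"
    "part10 d (l *s v) = l * part10 d v" "part01 d (l *s v) = cnj l * part01 d v"
    "linear (part10 d)" "linear (part01 d)"
proof -
  have l: "linear (\<lambda>v. d (\<i> *s v))"
    using linear_compose[OF linear_smult assms, of \<i>] by (simp add: comp_def)
  have a: "\<i> *s (l *s v) = l *s (\<i> *s v)" by (simp add: vec_eq_iff)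
  have n: "d (- v) = - d v" for v using assms by (rule linear_neg)
  show "part10 d v + part01 d v = d v"
    by (simp add: part10_def part01_def field_simps)
  have dl: "d (l *s v) = of_real (Re l) * d v + of_real (Im l) * d (\<i> *s v)"
    by (rule linear_rotate_complex[OF assms])
  have dil: "d (\<i> *s (l *s v)) = of_real (Re l) * d (\<i> *s v) - of_real (Im l) * d v"
    unfolding a linear_rotate_complex[OF assms, of l "\<i> *s v"] smult_i_i by (simp add: n)
  show "part10 d (l *s v) = l * part10 d v" "part01 d (l *s v) = cnj l * part01 d v"
    unfolding part10_def part01_def dl dil by (simp_all add: complex_eq_iff algebra_simps)
  show "linear (part10 d)" "linear (part01 d)"
    using assms l unfolding part10_def part01_def linear_iff by (auto simp: algebra_simps add_divide_distrib diff_divide_distrib scaleR_conv_of_real[where 'a = complex])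
qed

lemma part01_cnj: "(\<And>v. d v \<in> \<real>) \<Longrightarrow> cnj (part10 d v) = part01 d v"
  "(\<And>v. d v \<in> \<real>) \<Longrightarrow> cnj (part01 d v) = part10 d v"
  by (auto simp: part10_def part01_def Reals_cnj_iff)

lemma oneform_type:
  assumes "linear d"
  shows "has_type 1 0 (oneform (part10 d))" "has_type 0 1 (oneform (part01 d))"
  using has_type_oneform_wedge[OF part10_01(4)[OF assms] has_type_one_alt]
    has_type_oneform_wedge[OF part10_01(5)[OF assms] has_type_one_alt]
  by (simp_all add: part10_01[OF assms] oneform_wedge_one)

lemma oneform_split: "linear d \<Longrightarrow> oneform d = oneform (part10 d) + oneform (part01 d)"
  by (simp add: part10_01 flip: oneform_add)

lemma bidegree_part_oneform:
  assumes "linear d"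
  shows "bidegree_part 1 0 (oneform d) = oneform (part10 d)"
    "bidegree_part 0 1 (oneform d) = oneform (part01 d)"
  unfolding bidegree_part_eq[OF alternating_oneform[OF assms]] arg_cong[OF oneform_split[OF assms], of "type_proj _ _"]
    type_proj_add type_proj_has_type[OF oneform_type(1)[OF assms]] type_proj_has_type[OF oneform_type(2)[OF assms]]
  by simp_all

text \<open>Wedging with the (1, 0) part raises p by one and so costs a factor t, while the (0, 1)
  part leaves p alone. This is checked on pure types and extended by the type decomposition.\<close>

lemma theta_alt_oneform_wedge:
  assumes d: "linear d" and \<alpha>: "alternating \<alpha>"
  shows "theta_alt t (wedge (oneform d) \<alpha>)
    = wedge (oneform (\<lambda>v. of_real t * part10 d v + part01 d v)) (theta_alt t \<alpha>)"
proof -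
  have 1: "theta_alt t (wedge (oneform (part10 d)) \<beta>) = wedge (oneform (\<lambda>v. of_real t * part10 d v)) (theta_alt t \<beta>)"
    and 2: "theta_alt t (wedge (oneform (part01 d)) \<beta>) = wedge (oneform (part01 d)) (theta_alt t \<beta>)"
    if \<beta>: "has_type p q \<beta>" for p q \<beta>
  proof -
    have "has_type (Suc p) q (wedge (oneform (part10 d)) \<beta>)" "has_type p (Suc q) (wedge (oneform (part01 d)) \<beta>)"
      using has_type_oneform_wedge(1)[OF part10_01(4)[OF d] \<beta>] has_type_oneform_wedge(2)[OF part10_01(5)[OF d] \<beta>]
        part10_01(2,3)[OF d] by blast+
    then show "theta_alt t (wedge (oneform (part10 d)) \<beta>) = wedge (oneform (\<lambda>v. of_real t * part10 d v)) (theta_alt t \<beta>)"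
      "theta_alt t (wedge (oneform (part01 d)) \<beta>) = wedge (oneform (part01 d)) (theta_alt t \<beta>)"
      by (simp_all add: theta_alt_has_type \<beta> theta_alt_has_type[OF \<beta>] wedge_smul_right oneform_smul wedge_smul_left smul_smul mult.commute)
  qed
  have s: "theta_alt t (wedge (oneform d) \<beta>)
    = wedge (oneform (\<lambda>v. of_real t * part10 d v + part01 d v)) (theta_alt t \<beta>)" if "has_type p q \<beta>" for p q \<beta>
    unfolding oneform_split[OF d] wedge_add_left theta_alt_add 1[OF that] 2[OF that] oneform_add ..
  show ?thesis
    unfolding arg_cong[OF type_proj_decomposition[OF \<alpha>, symmetric], of "\<lambda>\<alpha>. theta_alt t (wedge (oneform d) \<alpha>)"]
      arg_cong[OF type_proj_decomposition[OF \<alpha>, symmetric], of "theta_alt t"]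
      wedge_sum_right theta_alt_sum s[OF type_proj_type[OF \<alpha>]] ..
qed

text \<open>Commuting the weight \<open>theta_alt (t\<^sup>2)\<close> past the wedge scales the (1,
  0) part of \<open>d\<close>. The plain adjoint then conjugates, and conjugation exchanges the two
  parts of a real one-form; this is how \<open>t\<^sup>2\<close> comes to stand with
  \<open>part01\<close>.\<close>

lemma twisted_inner_wedge_adjoint:
  assumes w: "positive_11 w" and d: "linear d" "\<And>v. d v \<in> \<real>"
    and \<alpha>: "alternating \<alpha>" and \<beta>: "alternating \<beta>"
  shows "twisted_inner_alt t w (wedge (oneform d) \<alpha>) \<beta>
    = twisted_inner_alt t w \<alpha> (contract w (\<lambda>v. of_real (t\<^sup>2) * part01 d v + part10 d v) \<beta>)"
proof -
  have c: "cnj (of_real (t\<^sup>2) * part10 d v + part01 d v) = of_real (t\<^sup>2) * part01 d v + part10 d v" for v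
    using part01_cnj[of d v, OF d(2)] by simp
  show ?thesis
    unfolding twisted_inner_alt_eq[OF w alternating_wedge[OF alternating_oneform[OF d(1)] \<alpha>] \<beta>]
      theta_alt_oneform_wedge[OF d(1) \<alpha>] inner_alt_wedge_adjoint[OF w \<beta>] c
      twisted_inner_alt_eq[OF w \<alpha> contract_alternating[OF \<beta>]] ..
qed

section \<open>The operator \<open>\<Lambda>\<close>\<close>

text \<open>The termwise adjoint of the expansion of \<open>w\<close> in
  \<open>positive_11_frame\<close>, from which the factor 1/2 is inherited.\<close>

definition frame_Lambda :: "(complex^'n::finite) alt \<Rightarrow> (complex^'n) alt \<Rightarrow> (complex^'n) alt" where
  "frame_Lambda w \<alpha> = smul (1 / 2) (\<Sum>b\<in>frame_of w. ctr (\<i> *s b) (ctr b \<alpha>))"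

lemma contract_ctr:
  assumes w: "positive_11 w" and \<alpha>: "alternating \<alpha>"
  shows "contract w (\<lambda>v. of_real (riem w b v)) \<alpha> = ctr b \<alpha>"
  unfolding contract_def ctr_sum_vec[OF \<alpha>, symmetric] frame_expansion[OF w orthonormal_frame_of[OF w]] ..

text \<open>This is \<open>euler_identity\<close> in degree 2, since contracting \<open>w\<close> by
  \<open>b\<close> gives the one-form dual to \<open>\<i> *s b\<close>. The factor 1/2 is the
  inverse of the degree.\<close>

lemma positive_11_frame:
  assumes w: "positive_11 w"
  shows "w = smul (1 / 2) (\<Sum>b\<in>frame_of w.
    wedge (oneform (\<lambda>v. of_real (riem w b v))) (oneform (\<lambda>v. of_real (riem w (\<i> *s b) v))))"
proof -
  have alt: "alternating w" and deg: "has_degree 2 w"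
    using w has_type_degree[OF bidegree_has_type[of 1 1 w]] by (auto simp: positive_11_def)
  have c: "ctr b w = oneform (\<lambda>v. of_real (riem w (\<i> *s b) v))" for b
    using has_degree_1_oneform[of "ctr b w"] has_degree_ctr[OF deg, of b]
    by (simp add: ctr_apply positive_11_props(4)[OF w])
  show ?thesis
  proof
    fix vs
    have "(\<Sum>b\<in>frame_of w. wedge (oneform (\<lambda>v. of_real (riem w b v))) (ctr b w)) vs = of_nat (length vs) * w vs"
      using orthonormal_frame_of[OF w] frame_expansion[OF w orthonormal_frame_of[OF w]] alt
      by (intro euler_identity) (auto simp: orthonormal_frame_def positive_11_props(2)[OF w])
    then show "w vs = smul (1 / 2) (\<Sum>b\<in>frame_of w.
      wedge (oneform (\<lambda>v. of_real (riem w b v))) (oneform (\<lambda>v. of_real (riem w (\<i> *s b) v)))) vs"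
      using deg unfolding c smul_apply by (cases "length vs = 2") (auto simp: has_degree_def)
  qed
qed

lemma frame_Lambda_adjoint:
  assumes w: "positive_11 w" and \<alpha>: "alternating \<alpha>"
  shows "inner_alt w (wedge w \<gamma>) \<alpha> = inner_alt w \<gamma> (frame_Lambda w \<alpha>)"
proof -
  have "inner_alt w (wedge w \<gamma>) \<alpha> = 1 / 2 * (\<Sum>b\<in>frame_of w. inner_alt w \<gamma> (ctr (\<i> *s b) (ctr b \<alpha>)))"
    by (subst (2) positive_11_frame[OF w])
      (simp add: wedge_smul_left wedge_sum_left inner_alt_smul inner_alt_sum wedge_assoc
        inner_alt_wedge_adjoint[OF w] \<alpha> alternating_ctr contract_ctr[OF w])
  then show ?thesis
    by (simp add: frame_Lambda_def inner_alt_smul inner_alt_sum)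
qed

lemma frame_Lambda_alternating: "alternating \<alpha> \<Longrightarrow> alternating (frame_Lambda w \<alpha>)"
  unfolding frame_Lambda_def by (intro alternating_smul alternating_sum alternating_ctr)

text \<open>Definiteness of the inner product makes an adjoint unique, so the definite description
  is met by the frame formula.\<close>

lemma Lambda_alt_eq:
  assumes w: "positive_11 w" and \<alpha>: "alternating \<alpha>"
  shows "Lambda_alt w \<alpha> = frame_Lambda w \<alpha>"
  unfolding Lambda_alt_def
proof (rule the_equality)
  fix \<beta> assume \<beta>: "alternating \<beta> \<and> (\<forall>\<gamma>. alternating \<gamma> \<longrightarrow> inner_alt w (wedge w \<gamma>) \<alpha> = inner_alt w \<gamma> \<beta>)"
  then show "\<beta> = frame_Lambda w \<alpha>"
    by (intro inner_alt_eqI[OF w]) (auto simp: frame_Lambda_alternating[OF \<alpha>] frame_Lambda_adjoint[OF assms])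
qed (simp add: frame_Lambda_alternating[OF \<alpha>] frame_Lambda_adjoint[OF assms])

text \<open>Contracting \<open>wedge (oneform a) \<alpha>\<close> by \<open>b\<close> and
  \<open>\<i> *s b\<close> leaves two cross terms; a rotation of the frame turns one into the other,
  and their sum absorbs the factor 1/2. The two commutator identities for types (1, 0) and (0, 1)
  are the cases where \<open>a (\<i> *s v)\<close> is a multiple of \<open>a v\<close>.\<close>

lemma Lambda_alt_commutator:
  assumes w: "positive_11 w" and a: "linear a" and \<alpha>: "alternating \<alpha>"
  shows "Lambda_alt w (wedge (oneform a) \<alpha>) - wedge (oneform a) (Lambda_alt w \<alpha>)
    = - contract w (\<lambda>v. a (\<i> *s v)) \<alpha>"
proof
  fix vs
  let ?B = "frame_of w"
  have B: "orthonormal_frame w ?B" by (rule orthonormal_frame_of[OF w])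
  have ia: "linear (\<lambda>v. a (\<i> *s v))"
    using linear_compose[OF linear_smult a, of \<i>] by (simp add: comp_def)
  \<comment> \<open>The trace of one bilinear form over the frame and over its rotation by
    \<open>\<i>\<close>; applying \<open>\<i>\<close> twice produces the sign.\<close>
  have rot: "(\<Sum>b\<in>?B. a b * \<alpha> ((\<i> *s b) # vs)) = - (\<Sum>b\<in>?B. a (\<i> *s b) * \<alpha> (b # vs))"
  proof -
    note R = orthonormal_frame_rotate[OF B w, of \<i>]
    have "(\<Sum>b\<in>?B. a b * \<alpha> ((\<i> *s b) # vs)) = (\<Sum>b\<in>(*s) \<i> ` ?B. a b * \<alpha> ((\<i> *s b) # vs))"
      by (rule frame_trace_unique[OF w B R(1) bilinear_contract[OF a \<alpha> linear_smult]]) simp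
    also have "\<dots> = (\<Sum>b\<in>?B. a (\<i> *s b) * \<alpha> ((\<i> *s (\<i> *s b)) # vs))"
      by (subst sum.reindex) (simp_all add: R comp_def del: vector_smult_assoc)
    also have "\<dots> = - (\<Sum>b\<in>?B. a (\<i> *s b) * \<alpha> (b # vs))"
      unfolding smult_i_i linear_neg[OF alternating_head_linear[OF \<alpha>]] by (simp add: sum_negf)
    finally show ?thesis .
  qed
  have "ctr (\<i> *s b) (ctr b (wedge (oneform a) \<alpha>)) vs = a b * \<alpha> ((\<i> *s b) # vs) - a (\<i> *s b) * \<alpha> (b # vs)
    + wedge (oneform a) (ctr (\<i> *s b) (ctr b \<alpha>)) vs" for b
    by (simp only: ctr_oneform_wedge ctr_diff ctr_smul) (simp add: smul_apply ctr_apply)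
  then have "(\<Sum>b\<in>?B. ctr (\<i> *s b) (ctr b (wedge (oneform a) \<alpha>)) vs)
    = (\<Sum>b\<in>?B. a b * \<alpha> ((\<i> *s b) # vs)) - (\<Sum>b\<in>?B. a (\<i> *s b) * \<alpha> (b # vs))
      + (\<Sum>b\<in>?B. wedge (oneform a) (ctr (\<i> *s b) (ctr b \<alpha>)) vs)"
    by (simp only: sum.distrib sum_subtractf)
  then have "frame_Lambda w (wedge (oneform a) \<alpha>) vs
    = - (\<Sum>b\<in>?B. a (\<i> *s b) * \<alpha> (b # vs)) + wedge (oneform a) (frame_Lambda w \<alpha>) vs"
    unfolding rot frame_Lambda_def wedge_smul_right wedge_sum_right smul_apply sum_fun_apply
    by (simp add: algebra_simps)
  then show "(Lambda_alt w (wedge (oneform a) \<alpha>) - wedge (oneform a) (Lambda_alt w \<alpha>)) vs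
    = (- contract w (\<lambda>v. a (\<i> *s v)) \<alpha>) vs"
    using Lambda_alt_eq[OF w \<alpha>] Lambda_alt_eq[OF w alternating_wedge[OF alternating_oneform[OF a] \<alpha>]]
    by (simp add: contract_def sum_fun_apply smul_apply ctr_apply)
qed

section \<open>Smooth functions\<close>

lemma frechet_derivative_eqI: "(f has_derivative f') (at x) \<Longrightarrow> frechet_derivative f (at x) = f'"
  using frechet_derivative_at by metis

lemma has_frechet_derivative:
  "f differentiable (at x) \<Longrightarrow> (f has_derivative frechet_derivative f (at x)) (at x)"
  by (simp add: frechet_derivative_works)

lemma frechet_derivative_cong_open:
  assumes "open S" "x \<in> S" "\<And>y. y \<in> S \<Longrightarrow> f y = g y" "f differentiable (at x)"
  shows "g differentiable (at x)" "frechet_derivative g (at x) = frechet_derivative f (at x)"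
proof -
  have "(g has_derivative frechet_derivative f (at x)) (at x)"
    using has_frechet_derivative[OF assms(4)] assms(1-3) by (rule has_derivative_transform_within_open)
  then show "g differentiable (at x)" "frechet_derivative g (at x) = frechet_derivative f (at x)"
    by (auto simp: differentiable_def intro: frechet_derivative_eqI)
qed

text \<open>The derivative formulas hold only at points of the open set, so the closure properties
  below transfer regularity along equality on that set.\<close>

lemma Ck_on_cong:
  assumes "open S" "Ck_on k S f" "\<And>y. y \<in> S \<Longrightarrow> f y = g y"
  shows "Ck_on k S g"
  using assms(2,3)
proof (induction k arbitrary: f g)
  case 0
  then show ?case using continuous_on_cong[of S S f g] by simp
next
  case (Suc k)
  have diff: "f differentiable (at x)" if "x \<in> S" for x
    using Suc(2) that by simp
  have "Ck_on k S (\<lambda>x. frechet_derivative g (at x) v)" for v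
  proof (rule Suc(1))
    show "Ck_on k S (\<lambda>x. frechet_derivative f (at x) v)"
      using Suc(2) by simp
    show "frechet_derivative f (at x) v = frechet_derivative g (at x) v" if "x \<in> S" for x
      using frechet_derivative_cong_open(2)[of S x f g, OF assms(1) that Suc(3) diff[OF that]] by simp
  qed
  moreover have "g differentiable (at x)" if "x \<in> S" for x
    using frechet_derivative_cong_open(1)[of S x f g, OF assms(1) that Suc(3) diff[OF that]] by simp
  ultimately show ?case
    by simp
qed

lemma Ck_on_SucD: "Ck_on (Suc k) S f \<Longrightarrow> Ck_on k S f"
proof (induction k arbitrary: f)
  case 0
  then show ?case
    by (auto intro!: continuous_at_imp_continuous_on differentiable_imp_continuous_within)
next
  case (Suc k)
  have "Ck_on k S (\<lambda>x. frechet_derivative f (at x) v)" for v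
    using Suc.prems by (intro Suc.IH) (metis Ck_on.simps(2))
  then show ?case using Suc.prems by simp
qed

lemma Ck_on_const: "Ck_on k S (\<lambda>_. c)"
proof (induction k arbitrary: c)
  case (Suc k)
  have "frechet_derivative (\<lambda>_. c) (at x) = (\<lambda>_. 0)" for x :: 'a
    by (rule frechet_derivative_eqI) (rule has_derivative_const)
  then show ?case using Suc[of 0] by simp
qed simp

lemma Ck_on_add:
  assumes "open S" "Ck_on k S f" "Ck_on k S g"
  shows "Ck_on k S (\<lambda>x. f x + g x)"
  using assms(2,3)
proof (induction k arbitrary: f g)
  case (Suc k)
  have d: "((\<lambda>x. f x + g x) has_derivative
      (\<lambda>v. frechet_derivative f (at x) v + frechet_derivative g (at x) v)) (at x)" if "x \<in> S" for x
    using Suc that by (intro has_derivative_add has_frechet_derivative) auto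
  have "Ck_on k S (\<lambda>x. frechet_derivative (\<lambda>x. f x + g x) (at x) v)" for v
    by (rule Ck_on_cong[OF assms(1) Suc(1)]) (use Suc frechet_derivative_eqI[OF d] in auto)
  then show ?case using d by (auto simp: differentiable_def)
qed (simp add: continuous_on_add)

lemma Ck_on_mult:
  assumes "open S" "Ck_on k S f" "Ck_on k S g"
  shows "Ck_on k S (\<lambda>x. f x * g x)"
  using assms(2,3)
proof (induction k arbitrary: f g)
  case (Suc k)
  have d: "((\<lambda>x. f x * g x) has_derivative
      (\<lambda>v. f x * frechet_derivative g (at x) v + frechet_derivative f (at x) v * g x)) (at x)" if "x \<in> S" for x
    using Suc that by (intro has_derivative_mult has_frechet_derivative) auto
  have "Ck_on k S (\<lambda>x. frechet_derivative (\<lambda>x. f x * g x) (at x) v)" for v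
  proof (rule Ck_on_cong[OF assms(1)])
    show "Ck_on k S (\<lambda>x. f x * frechet_derivative g (at x) v + frechet_derivative f (at x) v * g x)"
      using Suc Ck_on_SucD[OF Suc(2)] Ck_on_SucD[OF Suc(3)] by (intro Ck_on_add[OF assms(1)] Suc(1)) auto
  qed (use frechet_derivative_eqI[OF d] in auto)
  then show ?case using d by (auto simp: differentiable_def)
qed (simp add: continuous_on_mult)

lemma Ck_on_inverse:
  assumes "open S" "Ck_on k S f" "\<And>x. x \<in> S \<Longrightarrow> f x \<noteq> 0"
  shows "Ck_on k S (\<lambda>x. inverse (f x))"
  using assms(2)
proof (induction k)
  case 0
  then show ?case using assms(3) by (simp add: continuous_on_inverse)
next
  case (Suc k)
  have d: "((\<lambda>x. inverse (f x)) has_derivative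
      (\<lambda>v. - (inverse (f x) * frechet_derivative f (at x) v * inverse (f x)))) (at x)" if "x \<in> S" for x
    using Suc that assms(3)[OF that] by (intro Deriv.has_derivative_inverse has_frechet_derivative) auto
  \<comment> \<open>The inverse occurs in its own derivative; one order lower it is covered by the
    induction hypothesis.\<close>
  have k: "Ck_on k S (\<lambda>x. inverse (f x))"
    using Suc Ck_on_SucD by blast
  have "Ck_on k S (\<lambda>x. frechet_derivative (\<lambda>x. inverse (f x)) (at x) v)" for v
  proof (rule Ck_on_cong[OF assms(1)])
    show "Ck_on k S (\<lambda>x. - 1 * (inverse (f x) * frechet_derivative f (at x) v * inverse (f x)))"
      using Suc k by (intro Ck_on_mult[OF assms(1)] Ck_on_const) auto
  qed (use frechet_derivative_eqI[OF d] in auto)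
  then show ?case using d by (auto simp: differentiable_def)
qed

lemma smooth_on_const: "smooth_on S (\<lambda>_. c)"
  by (simp add: smooth_on_def Ck_on_const)

lemma smooth_on_cong:
  "open S \<Longrightarrow> smooth_on S f \<Longrightarrow> (\<And>y. y \<in> S \<Longrightarrow> f y = g y) \<Longrightarrow> smooth_on S g"
  unfolding smooth_on_def using Ck_on_cong by blast

lemma smooth_on_add: "open S \<Longrightarrow> smooth_on S f \<Longrightarrow> smooth_on S g \<Longrightarrow> smooth_on S (\<lambda>x. f x + g x)"
  and smooth_on_mult: "open S \<Longrightarrow> smooth_on S f \<Longrightarrow> smooth_on S g \<Longrightarrow> smooth_on S (\<lambda>x. f x * g x)"
  and smooth_on_inverse: "open S \<Longrightarrow> smooth_on S f \<Longrightarrow> (\<And>x. x \<in> S \<Longrightarrow> f x \<noteq> 0) \<Longrightarrow> smooth_on S (\<lambda>x. inverse (f x))"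
  by (simp_all add: smooth_on_def Ck_on_add Ck_on_mult Ck_on_inverse)

lemma smooth_on_diff: "open S \<Longrightarrow> smooth_on S f \<Longrightarrow> smooth_on S g \<Longrightarrow> smooth_on S (\<lambda>x. f x - g x)"
  using smooth_on_add[of S f "\<lambda>x. -1 * g x"] smooth_on_mult[of S "\<lambda>_. -1" g] smooth_on_const[of S "-1"] by simp

lemma smooth_on_sum:
  assumes "open S" "\<And>i. i \<in> I \<Longrightarrow> smooth_on S (f i)"
  shows "smooth_on S (\<lambda>x. \<Sum>i\<in>I. f i x)"
  using assms(2) by (induction I rule: infinite_finite_induct) (auto intro: smooth_on_add[OF assms(1)] smooth_on_const)

lemma smooth_on_prod:
  assumes "open S" "\<And>i. i \<in> I \<Longrightarrow> smooth_on S (f i)"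
  shows "smooth_on S (\<lambda>x. \<Prod>i\<in>I. f i x)"
  using assms(2) by (induction I rule: infinite_finite_induct) (auto intro: smooth_on_mult[OF assms(1)] smooth_on_const)

lemma smooth_on_power: "open S \<Longrightarrow> smooth_on S f \<Longrightarrow> smooth_on S (\<lambda>x. f x ^ m)"
  by (induction m) (auto intro: smooth_on_mult smooth_on_const)

lemma smooth_on_continuous: "smooth_on S f \<Longrightarrow> continuous_on S f"
  unfolding smooth_on_def by (metis Ck_on.simps(1))

lemma smooth_on_differentiable: "smooth_on S f \<Longrightarrow> x \<in> S \<Longrightarrow> f differentiable (at x)"
  unfolding smooth_on_def by (metis Ck_on.simps(2))

lemma smooth_on_derivative: "smooth_on S f \<Longrightarrow> smooth_on S (\<lambda>x. frechet_derivative f (at x) v)"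
  unfolding smooth_on_def by (metis Ck_on.simps(2))

lemma smooth_on_det:
  fixes M :: "'v::real_normed_vector \<Rightarrow> real^'m^'m::finite"
  assumes "open S" "\<And>i j. smooth_on S (\<lambda>x. complex_of_real (M x $ i $ j))"
  shows "smooth_on S (\<lambda>x. complex_of_real (det (M x)))"
  unfolding det_def of_real_sum of_real_mult of_real_prod
  by (intro smooth_on_sum smooth_on_mult smooth_on_prod smooth_on_const assms)

section \<open>Forms on a Hermitian manifold\<close>

lemma fmult_apply: "fmult f u c x = smul (f x) (u c x)"
  by (simp add: fmult_def smul_def)

lemma dform_sum_apply: "(\<Sum>i\<in>I. u i) c x = (\<Sum>i\<in>I. u i c x)" for u :: "'i \<Rightarrow> ('x, 'n::finite) dform"
  by (simp only: sum_fun_apply)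

definition function_derivative ::
    "('x, 'n::finite) chart \<Rightarrow> ('x \<Rightarrow> complex) \<Rightarrow> 'x \<Rightarrow> complex^'n \<Rightarrow> complex" where
  "function_derivative c f x = frechet_derivative (\<lambda>z. f (chart_inv c z)) (at (snd c x))"

definition chart_derivative ::
    "('x, 'n::finite) chart \<Rightarrow> ('x, 'n) chart \<Rightarrow> 'x \<Rightarrow> complex^'n \<Rightarrow> complex^'n" where
  "chart_derivative c c' x = frechet_derivative (transition c c') (at (snd c x))"

locale compact_hermitian_manifold =
  fixes A :: "('x::t2_space, 'n::finite) chart set"
    and \<omega> :: "('x, 'n) dform"
  assumes atlas: "complex_atlas A"
    and compact_space: "compact (UNIV :: 'x set)"
    and metric: "hermitian_metric A \<omega>"
begin

section \<open>Charts and transition maps\<close>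

lemma chart_homeomorphism: "c \<in> A \<Longrightarrow> homeomorphism (fst c) (chart_image c) (snd c) (chart_inv c)"
  and open_chart: "c \<in> A \<Longrightarrow> open (fst c)"
  and open_chart_image: "c \<in> A \<Longrightarrow> open (chart_image c)"
  and chart_covers: "\<exists>c\<in>A. x \<in> fst c"
  using atlas by (auto simp: complex_atlas_def)

lemma chart_inv_snd [simp]: "c \<in> A \<Longrightarrow> x \<in> fst c \<Longrightarrow> chart_inv c (snd c x) = x"
  using chart_homeomorphism homeomorphism_apply1 by metis

lemma snd_chart_inv: "z \<in> chart_image c \<Longrightarrow> snd c (chart_inv c z) = z"
  by (rule f_inv_into_f)

lemma chart_inv_in: "z \<in> chart_image c \<Longrightarrow> chart_inv c z \<in> fst c"
  by (rule inv_into_into)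

lemma open_overlap:
  assumes "c \<in> A" "c' \<in> A" shows "open (snd c ` (fst c \<inter> fst c'))"
proof -
  have "openin (top_of_set (chart_image c)) (snd c ` (fst c \<inter> fst c'))"
    using homeomorphism_imp_open_map[OF chart_homeomorphism[OF assms(1)], of "fst c \<inter> fst c'"]
      open_chart[OF assms(2)] by (simp add: openin_open_Int)
  then show ?thesis
    using open_chart_image[OF assms(1)] openin_open_eq by blast
qed

lemma chart_derivative:
  assumes "c \<in> A" "c' \<in> A" "x \<in> fst c \<inter> fst c'"
  shows "(transition c c' has_derivative chart_derivative c c' x) (at (snd c x))"
    "linear (chart_derivative c c' x)"
    "chart_derivative c c' x (l *s v) = l *s chart_derivative c c' x v"
proof -
  have "holomorphic_at (transition c c') (snd c x)"
    using atlas assms unfolding complex_atlas_def by blast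
  then obtain L where L: "(transition c c' has_derivative L) (at (snd c x))" "\<And>a v. L (a *s v) = a *s L v"
    unfolding holomorphic_at_def by blast
  moreover have "chart_derivative c c' x = L"
    unfolding chart_derivative_def by (rule frechet_derivative_eqI[OF L(1)])
  ultimately show "(transition c c' has_derivative chart_derivative c c' x) (at (snd c x))"
    "linear (chart_derivative c c' x)"
    "chart_derivative c c' x (l *s v) = l *s chart_derivative c c' x v"
    using has_derivative_linear by auto
qed

lemma transition_snd:
  assumes "c \<in> A" "x \<in> fst c" shows "transition c c' (snd c x) = snd c' x"
  using assms by (simp add: transition_def)

lemma function_derivative_chart:
  assumes f: "smooth_function A f" and c: "c \<in> A" "c' \<in> A" "x \<in> fst c \<inter> fst c'"
  shows "function_derivative c f x v = function_derivative c' f x (chart_derivative c c' x v)"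
proof -
  have x': "snd c' x \<in> chart_image c'" using c by auto
  have "((\<lambda>z. f (chart_inv c' z)) has_derivative function_derivative c' f x) (at (transition c c' (snd c x)))"
    unfolding function_derivative_def transition_snd[OF c(1) IntD1[OF c(3)]]
    using f c(2) x' by (intro has_frechet_derivative smooth_on_differentiable) (auto simp: smooth_function_def)
  from diff_chain_at[OF chart_derivative(1)[OF c] this]
  have "((\<lambda>z. f (chart_inv c' (transition c c' z))) has_derivative
      function_derivative c' f x \<circ> chart_derivative c c' x) (at (snd c x))"
    by (simp add: comp_def)
  then have "((\<lambda>z. f (chart_inv c z)) has_derivative
      function_derivative c' f x \<circ> chart_derivative c c' x) (at (snd c x))"
    by (rule has_derivative_transform_within_open[OF _ open_overlap[OF c(1,2)]])
      (use c in \<open>auto simp: transition_snd\<close>)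
  then show ?thesis
    unfolding function_derivative_def[of c] by (simp add: frechet_derivative_eqI)
qed

section \<open>Smooth forms and their algebra\<close>

lemma smooth_formsD:
  assumes "u \<in> smooth_forms A k"
  shows "\<not> (c \<in> A \<and> x \<in> fst c) \<Longrightarrow> u c x = 0"
    "alternating (u c x)" "has_degree k (u c x)"
    "c \<in> A \<Longrightarrow> c' \<in> A \<Longrightarrow> x \<in> fst c \<inter> fst c' \<Longrightarrow> u c x = pull (chart_derivative c c' x) (u c' x)"
    "c \<in> A \<Longrightarrow> smooth_on (chart_image c) (\<lambda>z. u c (chart_inv c z) vs)"
proof -
  have f: "(\<forall>c x. \<not> (c \<in> A \<and> x \<in> fst c) \<longrightarrow> u c x = 0) \<and>
     (\<forall>c x. alternating (u c x) \<and> has_degree k (u c x)) \<and>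
     (\<forall>c\<in>A. \<forall>c'\<in>A. \<forall>x \<in> fst c \<inter> fst c'. \<forall>vs. u c x vs = pull (chart_derivative c c' x) (u c' x) vs) \<and>
     (\<forall>c\<in>A. \<forall>vs. smooth_on (chart_image c) (\<lambda>z. u c (chart_inv c z) vs))"
    using assms unfolding smooth_forms_def pull_def chart_derivative_def by (rule CollectD)
  show "\<not> (c \<in> A \<and> x \<in> fst c) \<Longrightarrow> u c x = 0" "alternating (u c x)" "has_degree k (u c x)"
    "c \<in> A \<Longrightarrow> smooth_on (chart_image c) (\<lambda>z. u c (chart_inv c z) vs)"
    using f by blast+
  show "c \<in> A \<Longrightarrow> c' \<in> A \<Longrightarrow> x \<in> fst c \<inter> fst c' \<Longrightarrow> u c x = pull (chart_derivative c c' x) (u c' x)"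
    by (rule ext) (use f in blast)
qed

lemma smooth_formsI:
  assumes "\<And>c x. \<not> (c \<in> A \<and> x \<in> fst c) \<Longrightarrow> u c x = 0"
    "\<And>c x. c \<in> A \<Longrightarrow> x \<in> fst c \<Longrightarrow> alternating (u c x)"
    "\<And>c x. c \<in> A \<Longrightarrow> x \<in> fst c \<Longrightarrow> has_degree k (u c x)"
    "\<And>c c' x. c \<in> A \<Longrightarrow> c' \<in> A \<Longrightarrow> x \<in> fst c \<inter> fst c' \<Longrightarrow> u c x = pull (chart_derivative c c' x) (u c' x)"
    "\<And>c vs. c \<in> A \<Longrightarrow> smooth_on (chart_image c) (\<lambda>z. u c (chart_inv c z) vs)"
  shows "u \<in> smooth_forms A k"
proof -
  have "alternating (u c x) \<and> has_degree k (u c x)" for c x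
    using assms(1-3)[of c x] by (metis alternating_zero has_degree_zero)
  then have "(\<forall>c x. \<not> (c \<in> A \<and> x \<in> fst c) \<longrightarrow> u c x = 0) \<and>
     (\<forall>c x. alternating (u c x) \<and> has_degree k (u c x)) \<and>
     (\<forall>c\<in>A. \<forall>c'\<in>A. \<forall>x \<in> fst c \<inter> fst c'. \<forall>vs. u c x vs = pull (chart_derivative c c' x) (u c' x) vs) \<and>
     (\<forall>c\<in>A. \<forall>vs. smooth_on (chart_image c) (\<lambda>z. u c (chart_inv c z) vs))"
    using assms(1,4,5) by metis
  then show ?thesis
    unfolding smooth_forms_def mem_Collect_eq pull_def chart_derivative_def .
qed

lemma smooth_forms_zero: "0 \<in> smooth_forms A k"
  by (rule smooth_formsI) (auto simp: smooth_on_const)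

lemma smooth_forms_add:
  assumes "u \<in> smooth_forms A k" "v \<in> smooth_forms A k" shows "u + v \<in> smooth_forms A k"
proof (rule smooth_formsI)
  fix c x assume z: "\<not> (c \<in> A \<and> x \<in> fst c)"
  show "(u + v) c x = 0"
    by (simp only: plus_fun_apply smooth_formsD(1)[OF assms(1) z] smooth_formsD(1)[OF assms(2) z] add_0_left)
next
  fix c c' x assume "c \<in> A" "c' \<in> A" "x \<in> fst c \<inter> fst c'"
  then show "(u + v) c x = pull (chart_derivative c c' x) ((u + v) c' x)"
    using smooth_formsD(4)[OF assms(1)] smooth_formsD(4)[OF assms(2)] by (simp only: plus_fun_apply pull_add)
next
  fix c vs assume "c \<in> A"
  then show "smooth_on (chart_image c) (\<lambda>z. (u + v) c (chart_inv c z) vs)"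
    using smooth_on_add[OF open_chart_image smooth_formsD(5)[OF assms(1)] smooth_formsD(5)[OF assms(2)]] by simp
qed (simp_all only: plus_fun_apply alternating_add has_degree_add smooth_formsD(2,3)[OF assms(1)] smooth_formsD(2,3)[OF assms(2)])

lemma smooth_forms_fmult:
  assumes "smooth_function A f" "u \<in> smooth_forms A k" shows "fmult f u \<in> smooth_forms A k"
proof (rule smooth_formsI)
  fix c x assume z: "\<not> (c \<in> A \<and> x \<in> fst c)"
  show "fmult f u c x = 0"
    by (simp only: fmult_apply smooth_formsD(1)[OF assms(2) z] smul_zero)
next
  fix c c' x assume "c \<in> A" "c' \<in> A" "x \<in> fst c \<inter> fst c'"
  then show "fmult f u c x = pull (chart_derivative c c' x) (fmult f u c' x)"
    using smooth_formsD(4)[OF assms(2)] by (simp only: fmult_apply pull_smul)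
next
  fix c vs assume c: "c \<in> A"
  have "smooth_on (chart_image c) (\<lambda>z. f (chart_inv c z))"
    using assms(1) c by (simp add: smooth_function_def)
  from smooth_on_mult[OF open_chart_image[OF c] this smooth_formsD(5)[OF assms(2) c]]
  show "smooth_on (chart_image c) (\<lambda>z. fmult f u c (chart_inv c z) vs)"
    by (simp add: fmult_def)
qed (simp_all only: fmult_apply alternating_smul has_degree_smul smooth_formsD(2,3)[OF assms(2)])

lemma smooth_forms_sum: "(\<And>i. i \<in> I \<Longrightarrow> u i \<in> smooth_forms A k) \<Longrightarrow> (\<Sum>i\<in>I. u i) \<in> smooth_forms A k"
  by (induction I rule: infinite_finite_induct) (simp_all only: sum.infinite sum.empty sum.insert smooth_forms_zero smooth_forms_add insert_iff simp_thms)

lemma smooth_function_const: "smooth_function A (\<lambda>_. a)"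
  by (simp add: smooth_function_def smooth_on_const)

lemma smooth_function_power: "smooth_function A f \<Longrightarrow> smooth_function A (\<lambda>x. f x ^ m)"
  by (simp add: smooth_function_def smooth_on_power open_chart_image)

lemma smooth_function_inverse:
  "smooth_function A f \<Longrightarrow> (\<And>x. f x \<noteq> 0) \<Longrightarrow> smooth_function A (\<lambda>x. inverse (f x))"
  by (simp add: smooth_function_def smooth_on_inverse open_chart_image)

lemma smooth_forms_diff:
  assumes "u \<in> smooth_forms A k" "v \<in> smooth_forms A k" shows "u - v \<in> smooth_forms A k"
proof -
  have "u - v = u + fmult (\<lambda>_. -1) v"
    by (simp add: fun_eq_iff fmult_def)
  then show ?thesis
    using smooth_forms_add[OF assms(1) smooth_forms_fmult[OF smooth_function_const assms(2)]] by metis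
qed

lemma pq_part_apply:
  assumes "u \<in> smooth_forms A k" shows "pq_part p q u c x = type_proj p q (u c x)"
  by (simp add: pq_part_def bidegree_part_eq smooth_formsD(2)[OF assms])

text \<open>For fixed arguments the projection is a finite linear combination of values of
  \<open>U\<close> at rotated arguments.\<close>

lemma type_proj_smooth:
  assumes "open S" "\<And>vs. smooth_on S (\<lambda>z. U z vs)"
  shows "smooth_on S (\<lambda>z. type_proj p q (U z) vs)"
proof (cases "length vs = p + q")
  case True
  show ?thesis
    unfolding type_proj_def Let_def if_P[OF True] divide_inverse
    by (intro smooth_on_mult[OF assms(1)] smooth_on_sum[OF assms(1)] smooth_on_const assms(2))
qed (simp add: type_proj_degree smooth_on_const)

lemma smooth_forms_pq_part:
  assumes u: "u \<in> smooth_forms A k" shows "pq_part p q u \<in> smooth_forms A k"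
proof (rule smooth_formsI)
  fix c x assume z: "\<not> (c \<in> A \<and> x \<in> fst c)"
  show "pq_part p q u c x = 0"
    unfolding pq_part_apply[OF u] smooth_formsD(1)[OF u z] by (rule type_proj_zero)
next
  fix c x
  show "alternating (pq_part p q u c x)"
    unfolding pq_part_apply[OF u] by (intro has_type_alternating[OF type_proj_type] smooth_formsD[OF u])
  show "has_degree k (pq_part p q u c x)"
    unfolding pq_part_apply[OF u] using smooth_formsD(3)[OF u, of c x] by (auto simp: has_degree_def type_proj_def)
next
  fix c c' x assume c: "c \<in> A" "c' \<in> A" "x \<in> fst c \<inter> fst c'"
  show "pq_part p q u c x = pull (chart_derivative c c' x) (pq_part p q u c' x)"
    unfolding pq_part_apply[OF u] smooth_formsD(4)[OF u c] by (intro type_proj_pull chart_derivative c)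
next
  fix c vs assume c: "c \<in> A"
  show "smooth_on (chart_image c) (\<lambda>z. pq_part p q u c (chart_inv c z) vs)"
    unfolding pq_part_apply[OF u] by (intro type_proj_smooth open_chart_image smooth_formsD(5)[OF u] c)
qed

lemma theta_apply:
  assumes "u \<in> smooth_forms A k" shows "theta f u c x = theta_alt (f x) (u c x)"
  unfolding theta_def dform_sum_apply fmult_apply pq_part_apply[OF assms] theta_alt_def ..

text \<open>The variant for forms that are only known to be alternating at the point, such as
  \<open>ext_d A u\<close>.\<close>

lemma theta_pointwise: "alternating (u c x) \<Longrightarrow> theta f u c x = theta_alt (f x) (u c x)"
  by (simp add: theta_def dform_sum_apply fmult_apply pq_part_def bidegree_part_eq theta_alt_def)

lemma smooth_forms_theta:
  assumes "smooth_function A (\<lambda>x. of_real (f x))" "u \<in> smooth_forms A k"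
  shows "theta f u \<in> smooth_forms A k"
  unfolding theta_def
  by (intro smooth_forms_sum smooth_forms_fmult smooth_forms_pq_part assms)
    (simp add: smooth_function_power[OF assms(1)])

section \<open>Smoothness of the metric coefficients and of contractions\<close>

lemma metric_positive: "c \<in> A \<Longrightarrow> x \<in> fst c \<Longrightarrow> positive_11 (\<omega> c x)"
  and metric_smooth_form: "\<omega> \<in> smooth_forms A 2"
  using metric by (auto simp: hermitian_metric_def)

text \<open>Up to moving \<open>\<i>\<close> to the first argument, a Gram entry is a value of
  \<omega> at constant vectors, which is smooth because \<omega> is a smooth form.\<close>

lemma gram_smooth:
  assumes c: "c \<in> A"
  shows "smooth_on (chart_image c) (\<lambda>z. of_real (gram (\<omega> c (chart_inv c z)) $ i $ j))"
proof (rule smooth_on_cong[OF open_chart_image[OF c] smooth_formsD(5)[OF metric_smooth_form c]])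
  fix z assume z: "z \<in> chart_image c"
  have "of_real (riem (\<omega> c (chart_inv c z)) u v) = - \<omega> c (chart_inv c z) [\<i> *s u, v]" for u v
  proof -
    note p = positive_11_props[OF metric_positive[OF c chart_inv_in[OF z]]]
    have "\<omega> c (chart_inv c z) [\<i> *s u, v] = of_real (riem (\<omega> c (chart_inv c z)) (- u) v)"
      using p(4)[of "\<i> *s u" v] unfolding smult_i_i .
    then show ?thesis
      using bilinear_lneg[OF p(1)] by simp
  qed
  moreover have "alternating (\<omega> c (chart_inv c z))" by (rule smooth_formsD(2)[OF metric_smooth_form])
  ultimately show "\<omega> c (chart_inv c z) [- (\<i> *s real_basis i), real_basis j] =
      of_real (gram (\<omega> c (chart_inv c z)) $ i $ j)"
    using linear_neg[OF alternating_head_linear, of "\<omega> c (chart_inv c z)"] by (simp add: gram_def)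
qed

lemma gram_det_nonzero: "c \<in> A \<Longrightarrow> z \<in> chart_image c \<Longrightarrow> det (gram (\<omega> c (chart_inv c z))) \<noteq> 0"
  by (rule gram_inverse(1)[OF metric_positive orthonormal_frame_of[OF metric_positive]]) (auto simp: chart_inv_in)

lemma gram_inv_smooth:
  assumes c: "c \<in> A"
  shows "smooth_on (chart_image c) (\<lambda>z. of_real (gram_inv (\<omega> c (chart_inv c z)) j l))"
proof -
  have "smooth_on (chart_image c) (\<lambda>z. of_real ((\<chi> a b. if b = j then axis l 1 $ a
      else gram (\<omega> c (chart_inv c z)) $ a $ b) $ i $ i'))" for i i'
    using gram_smooth[OF c, of i i'] by (cases "i' = j") (auto simp: smooth_on_const)
  then show ?thesis
    unfolding gram_inv_def divide_inverse of_real_mult of_real_inverse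
    using gram_det_nonzero[OF c] gram_smooth[OF c] open_chart_image[OF c]
    by (intro smooth_on_mult smooth_on_inverse smooth_on_det) auto
qed

lemma function_derivative_smooth:
  assumes f: "smooth_function A f" and c: "c \<in> A"
  shows "smooth_on (chart_image c) (\<lambda>z. function_derivative c f (chart_inv c z) v)"
proof (rule smooth_on_cong[OF open_chart_image[OF c] smooth_on_derivative])
  show "smooth_on (chart_image c) (\<lambda>z. f (chart_inv c z))"
    using assms by (simp add: smooth_function_def)
  show "frechet_derivative (\<lambda>z. f (chart_inv c z)) (at z) v = function_derivative c f (chart_inv c z) v"
    if "z \<in> chart_image c" for z
    by (simp only: function_derivative_def snd_chart_inv[OF that])
qed

lemma function_has_derivative:
  assumes f: "smooth_function A f" and c: "c \<in> A" "x \<in> fst c"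
  shows "((\<lambda>z. f (chart_inv c z)) has_derivative function_derivative c f x) (at (snd c x))"
  unfolding function_derivative_def
  using assms by (intro has_frechet_derivative smooth_on_differentiable) (auto simp: smooth_function_def)

lemma function_derivative_linear:
  assumes f: "smooth_function A f" and c: "c \<in> A" "x \<in> fst c"
  shows "linear (function_derivative c f x)"
  using has_derivative_linear[OF function_has_derivative[OF assms]] .

lemma function_derivative_real:
  assumes f: "smooth_function A (\<lambda>x. of_real (g x))" and c: "c \<in> A" "x \<in> fst c"
  shows "function_derivative c (\<lambda>x. of_real (g x)) x v \<in> \<real>"
proof -
  let ?d = "function_derivative c (\<lambda>x. complex_of_real (g x)) x"
  have "((\<lambda>z. Im (of_real (g (chart_inv c z)))) has_derivative (\<lambda>v. Im (?d v))) (at (snd c x))"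
    using function_has_derivative[OF assms] by (rule has_derivative_Im)
  then have "((\<lambda>z. 0) has_derivative (\<lambda>v. Im (?d v))) (at (snd c x))" by simp
  then have "(\<lambda>v. Im (?d v)) = (\<lambda>v. 0)"
    using has_derivative_unique has_derivative_const by blast
  then show ?thesis
    by (metis complex_is_Real_iff)
qed

lemma ext_d_function_form:
  assumes f: "smooth_function A f" and c: "c \<in> A" "x \<in> fst c"
  shows "ext_d A (function_form A f) c x = oneform (function_derivative c f x)"
proof
  fix vs
  show "ext_d A (function_form A f) c x vs = oneform (function_derivative c f x) vs"
  proof (cases "length vs = 1")
    case True
    then obtain v where v: "vs = [v]" by (auto simp: length_Suc_conv)
    have "frechet_derivative (\<lambda>z. function_form A f c (chart_inv c z) []) (at (snd c x))
      = function_derivative c f x"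
      unfolding function_derivative_def
    proof (rule frechet_derivative_cong_open(2)[OF open_chart_image[OF c(1)]])
      show "f (chart_inv c y) = function_form A f c (chart_inv c y) []" if "y \<in> chart_image c" for y
        using chart_inv_in[OF that] c by (simp add: function_form_def)
    qed (use function_has_derivative[OF assms] c in \<open>auto simp: differentiable_def\<close>)
    then show ?thesis
      using c by (simp add: ext_d_def v oneform_def)
  next
    case False
    have z: "function_form A f c y us = 0" if "us \<noteq> []" for y us
      using that by (simp add: function_form_def)
    have "frechet_derivative (\<lambda>z. function_form A f c (chart_inv c z) (take j vs @ drop (Suc j) vs)) (at (snd c x)) v = 0"
      if "j < length vs" for j v
    proof -
      have "length (take j vs @ drop (Suc j) vs) \<noteq> 0"
        using False that by simp
      then have ne: "take j vs @ drop (Suc j) vs \<noteq> []"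
        by (simp only: length_0_conv not_False_eq_True)
      show ?thesis
        unfolding z[OF ne] frechet_derivative_eqI[OF has_derivative_const] ..
    qed
    then show ?thesis
      using False by (simp add: ext_d_def oneform_def)
  qed
qed

text \<open>Chart changes are covered by \<open>contract_pull\<close>, where holomorphy of the
  transitions enters. Smoothness is read off \<open>contract_coordinates\<close>, in which the
  chosen frame no longer occurs.\<close>

lemma smooth_forms_contract:
  assumes u: "u \<in> smooth_forms A k"
    and lin: "\<And>c x. c \<in> A \<Longrightarrow> x \<in> fst c \<Longrightarrow> linear (a c x)"
    and comp: "\<And>c c' x v. c \<in> A \<Longrightarrow> c' \<in> A \<Longrightarrow> x \<in> fst c \<inter> fst c' \<Longrightarrow> a c x v = a c' x (chart_derivative c c' x v)"
    and smooth: "\<And>c v. c \<in> A \<Longrightarrow> smooth_on (chart_image c) (\<lambda>z. a c (chart_inv c z) v)"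
  shows "(\<lambda>c x. if c \<in> A \<and> x \<in> fst c then contract (\<omega> c x) (a c x) (u c x) else 0) \<in> smooth_forms A (k - 1)"
proof (rule smooth_formsI)
  fix c x assume "c \<in> A" "x \<in> fst c"
  then show "alternating (if c \<in> A \<and> x \<in> fst c then contract (\<omega> c x) (a c x) (u c x) else 0)"
    and "has_degree (k - 1) (if c \<in> A \<and> x \<in> fst c then contract (\<omega> c x) (a c x) (u c x) else 0)"
    by (simp_all add: contract_alternating contract_degree smooth_formsD(2,3)[OF u])
next
  fix c c' x assume c: "c \<in> A" "c' \<in> A" "x \<in> fst c \<inter> fst c'"
  let ?L = "chart_derivative c c' x"
  have e: "a c x = a c' x \<circ> ?L"
    using comp[OF c] by (simp add: fun_eq_iff)
  have "contract (\<omega> c x) (a c' x \<circ> ?L) (pull ?L (u c' x)) = pull ?L (contract (\<omega> c' x) (a c' x) (u c' x))"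
  proof (rule contract_pull)
    show "positive_11 (\<omega> c x)" "positive_11 (\<omega> c' x)" "linear (a c' x)"
      using c metric_positive lin by auto
    show "linear ?L" "?L (\<i> *s v) = \<i> *s ?L v" for v
      using chart_derivative[OF c] by auto
    show "\<omega> c x = pull ?L (\<omega> c' x)"
      by (rule smooth_formsD(4)[OF metric_smooth_form c])
  qed (rule smooth_formsD[OF u])
  then show "(if c \<in> A \<and> x \<in> fst c then contract (\<omega> c x) (a c x) (u c x) else 0) =
    pull ?L (if c' \<in> A \<and> x \<in> fst c' then contract (\<omega> c' x) (a c' x) (u c' x) else 0)"
    using c by (simp only: e smooth_formsD(4)[OF u c, symmetric] Int_iff simp_thms if_True)
next
  fix c vs assume c: "c \<in> A"
  show "smooth_on (chart_image c) (\<lambda>z. (if c \<in> A \<and> chart_inv c z \<in> fst c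
      then contract (\<omega> c (chart_inv c z)) (a c (chart_inv c z)) (u c (chart_inv c z)) else 0) vs)"
  proof (rule smooth_on_cong[OF open_chart_image[OF c]])
    show "smooth_on (chart_image c) (\<lambda>z. \<Sum>j\<in>UNIV. \<Sum>l\<in>UNIV. of_real (gram_inv (\<omega> c (chart_inv c z)) j l) *
       (a c (chart_inv c z) (real_basis j) * u c (chart_inv c z) (real_basis l # vs)))"
      by (intro smooth_on_sum smooth_on_mult open_chart_image c gram_inv_smooth smooth smooth_formsD(5)[OF u])
    fix z assume z: "z \<in> chart_image c"
    then show "(\<Sum>j\<in>UNIV. \<Sum>l\<in>UNIV. of_real (gram_inv (\<omega> c (chart_inv c z)) j l) *
       (a c (chart_inv c z) (real_basis j) * u c (chart_inv c z) (real_basis l # vs))) =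
      (if c \<in> A \<and> chart_inv c z \<in> fst c
      then contract (\<omega> c (chart_inv c z)) (a c (chart_inv c z)) (u c (chart_inv c z)) else 0) vs"
      using contract_coordinates[OF metric_positive[OF c chart_inv_in[OF z]] lin[OF c chart_inv_in[OF z]] smooth_formsD(2)[OF u]]
        chart_inv_in[OF z] c by simp
  qed
qed auto

end

section \<open>Integration\<close>

text \<open>The set where \<open>f\<close> is nonzero is open and null, hence empty.\<close>

lemma zero_set_integral_open:
  fixes f :: "'v::euclidean_space \<Rightarrow> real"
  assumes U: "open U" and int: "set_integrable lborel U f" and cont: "continuous_on U f"
    and nonneg: "\<And>x. x \<in> U \<Longrightarrow> 0 \<le> f x" and zero: "(LINT x:U|lborel. f x) = 0" and x: "x \<in> U"
  shows "f x = 0"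
proof (rule ccontr)
  assume "f x \<noteq> 0"
  define V where "V = {y \<in> U. f y \<noteq> 0}"
  have "open V"
    unfolding V_def using continuous_open_preimage[OF cont U open_Compl[OF closed_singleton[of 0]]] by (simp add: vimage_def Int_def)
  have "AE y in lborel. indicator U y *\<^sub>R f y = 0"
    using int zero nonneg unfolding set_integrable_def set_lebesgue_integral_def
    by (subst (asm) integral_nonneg_eq_0_iff_AE) (auto simp: indicator_def)
  then have "AE y in lborel. y \<notin> V"
    by (rule eventually_mono) (auto simp: V_def)
  then have "AE y in lebesgue. y \<notin> V"
    by (rule AE_completion)
  then have "V \<in> null_sets lebesgue"
    using \<open>open V\<close> by (subst (asm) AE_iff_null_sets[symmetric]) auto
  then have "negligible V"
    by (simp add: negligible_iff_null_sets)
  moreover have "x \<in> V"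
    using x \<open>f x \<noteq> 0\<close> by (simp add: V_def)
  ultimately show False
    using open_not_negligible[OF \<open>open V\<close>] by blast
qed

context compact_hermitian_manifold
begin

text \<open>A tent function on a coordinate ball; continuity is all that a partition of unity asks
  for. The ball corresponds to a compact set \<open>K\<close>, closed because the space is
  Hausdorff, so the tent glues with zero on the complement of \<open>K\<close>.\<close>

lemma bump_function:
  assumes c: "c \<in> A" and x: "x \<in> fst c"
  shows "\<exists>f :: 'x \<Rightarrow> real. continuous_on UNIV f \<and> (\<forall>y. 0 \<le> f y) \<and> 0 < f x \<and> closure {y. f y \<noteq> 0} \<subseteq> fst c"
proof -
  obtain r where r: "0 < r" "cball (snd c x) r \<subseteq> chart_image c"
    using open_chart_image[OF c] x by (metis image_eqI open_contains_cball)
  define K where "K = chart_inv c ` cball (snd c x) r"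
  define f where "f y = (if y \<in> fst c then max 0 (r - dist (snd c y) (snd c x)) else 0)" for y
  have hom: "continuous_on (fst c) (snd c)" "continuous_on (chart_image c) (chart_inv c)"
    using chart_homeomorphism[OF c] by (auto simp: homeomorphism_def)
  have "compact K"
    unfolding K_def by (rule compact_continuous_image[OF continuous_on_subset[OF hom(2) r(2)] compact_cball])
  then have "closed K" by (rule compact_imp_closed)
  have Kc: "K \<subseteq> fst c"
    unfolding K_def by (intro image_subsetI chart_inv_in) (use r(2) in blast)
  have f0: "f y = 0" if "y \<notin> K" for y
  proof (rule ccontr)
    assume "f y \<noteq> 0"
    then have y: "y \<in> fst c" "dist (snd c x) (snd c y) \<le> r"
      by (auto simp: f_def dist_commute split: if_splits)
    then have "y \<in> K"
      unfolding K_def using chart_inv_snd[OF c y(1)] by (intro image_eqI[of _ _ "snd c y"]) auto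
    then show False using that by blast
  qed
  have "continuous_on (fst c \<union> - K) f"
  proof (rule continuous_on_open_Un)
    have "continuous_on (fst c) (\<lambda>y. max 0 (r - dist (snd c y) (snd c x)))"
      by (intro continuous_intros hom)
    then show "continuous_on (fst c) f"
      by (rule continuous_on_eq) (simp add: f_def)
    show "continuous_on (- K) f"
      using f0 continuous_on_eq[of "- K" "\<lambda>_. 0" f] by simp
  qed (use open_chart[OF c] \<open>closed K\<close> in auto)
  moreover have "fst c \<union> - K = UNIV" using Kc by blast
  moreover have "closure {y. f y \<noteq> 0} \<subseteq> K"
    using f0 \<open>closed K\<close> by (intro closure_minimal) blast+
  ultimately show ?thesis
    using r(1) x Kc by (intro exI[of _ f]) (auto simp: f_def)
qed

text \<open>Gives content to the \<open>SOME\<close> in \<open>integral_vol\<close>. The bumps are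
  indexed by points, a partition by charts, so the finitely many bumps selected by compactness are
  grouped by their charts before normalising.\<close>

lemma partition_of_unity_exists: "\<exists>\<rho>. partition_of_unity A \<rho>"
proof -
  obtain ch where ch: "\<And>x. ch x \<in> A" "\<And>x. x \<in> fst (ch x)"
    using chart_covers by metis
  obtain f :: "'x \<Rightarrow> 'x \<Rightarrow> real" where f: "\<And>x. continuous_on UNIV (f x)" "\<And>x y. 0 \<le> f x y" "\<And>x. 0 < f x x"
    "\<And>x. closure {y. f x y \<noteq> 0} \<subseteq> fst (ch x)"
  proof -
    define f where "f x = (SOME f :: 'x \<Rightarrow> real. continuous_on UNIV f \<and> (\<forall>y. 0 \<le> f y) \<and> 0 < f x \<and>
      closure {y. f y \<noteq> 0} \<subseteq> fst (ch x))" for x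
    have "continuous_on UNIV (f x) \<and> (\<forall>y. 0 \<le> f x y) \<and> 0 < f x x \<and> closure {y. f x y \<noteq> 0} \<subseteq> fst (ch x)" for x
      unfolding f_def by (rule someI_ex[OF bump_function[OF ch]])
    then show ?thesis using that by blast
  qed
  have op: "open {y. 0 < f x y}" for x
    using open_Collect_less[OF continuous_on_const f(1)] .
  have cov: "UNIV \<subseteq> (\<Union>x\<in>UNIV. {y. 0 < f x y})"
    using f(3) by blast
  obtain F where F: "finite F" "UNIV \<subseteq> (\<Union>x\<in>F. {y. 0 < f x y})"
    by (rule compactE_image[OF compact_space op cov])
  define s where "s y = (\<Sum>x\<in>F. f x y)" for y
  have s: "0 < s y" for y
  proof -
    obtain x where "x \<in> F" "0 < f x y" using F(2) by blast
    then show ?thesis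
      unfolding s_def using f(2) F(1) by (intro sum_pos2[of F x]) auto
  qed
  define \<rho> where "\<rho> c y = (\<Sum>x\<in>{x\<in>F. ch x = c}. f x y) / s y" for c y
  have \<rho>0: "\<rho> c = 0" if "c \<notin> ch ` F" for c
  proof -
    have "{x\<in>F. ch x = c} = {}" using that by blast
    then show ?thesis by (simp only: \<rho>_def fun_eq_iff sum.empty div_0 zero_fun_apply simp_thms)
  qed
  have sub: "{c. \<rho> c \<noteq> 0} \<subseteq> ch ` F" using \<rho>0 by blast
  have "(\<Sum>c | \<rho> c \<noteq> 0. \<rho> c y) = 1" for y
  proof -
    have "(\<Sum>c | \<rho> c \<noteq> 0. \<rho> c y) = (\<Sum>c\<in>ch ` F. \<rho> c y)"
      using sub F(1) by (intro sum.mono_neutral_left) auto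
    also have "\<dots> = (\<Sum>c\<in>ch ` F. \<Sum>x\<in>{x\<in>F. ch x = c}. f x y) / s y"
      by (simp add: \<rho>_def sum_divide_distrib)
    also have "\<dots> = 1"
      using s[of y] by (subst sum.image_gen[OF F(1), symmetric]) (simp add: s_def)
    finally show ?thesis .
  qed
  moreover have "continuous_on UNIV (\<rho> c)" for c
    unfolding \<rho>_def s_def using s f(1) by (intro continuous_intros) (auto simp: s_def less_le)
  moreover have "0 \<le> \<rho> c y" for c y
    unfolding \<rho>_def using s[of y] f(2) by (intro divide_nonneg_pos sum_nonneg) auto
  moreover have "closure {y. \<rho> c y \<noteq> 0} \<subseteq> fst c" for c
  proof -
    have "{y. \<rho> c y \<noteq> 0} \<subseteq> (\<Union>x\<in>{x\<in>F. ch x = c}. closure {y. f x y \<noteq> 0})"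
    proof
      fix y assume "y \<in> {y. \<rho> c y \<noteq> 0}"
      then obtain x where "x \<in> {x\<in>F. ch x = c}" "f x y \<noteq> 0"
        unfolding \<rho>_def using sum.neutral[of "{x\<in>F. ch x = c}" "\<lambda>x. f x y"] by fastforce
      then show "y \<in> (\<Union>x\<in>{x\<in>F. ch x = c}. closure {y. f x y \<noteq> 0})"
        using closure_subset[of "{y. f x y \<noteq> 0}"] by blast
    qed
    moreover have "closed (\<Union>x\<in>{x\<in>F. ch x = c}. closure {y. f x y \<noteq> 0})"
      using F(1) by (intro closed_UN) auto
    ultimately have "closure {y. \<rho> c y \<noteq> 0} \<subseteq> (\<Union>x\<in>{x\<in>F. ch x = c}. closure {y. f x y \<noteq> 0})"
      by (rule closure_minimal)
    then show ?thesis using f(4) by blast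
  qed
  ultimately have "partition_of_unity A \<rho>"
    unfolding partition_of_unity_def using sub F(1) ch(1) by (auto intro: finite_subset)
  then show ?thesis by (rule exI[of _ \<rho>])
qed

section \<open>The integral in charts\<close>

definition \<rho> :: "('x, 'n) chart \<Rightarrow> 'x \<Rightarrow> real" where
  "\<rho> = (SOME \<rho>. partition_of_unity A \<rho>)"

lemma partition: "partition_of_unity A \<rho>"
  unfolding \<rho>_def using partition_of_unity_exists by (rule someI_ex)

lemma partition_chart: "\<rho> c \<noteq> 0 \<Longrightarrow> c \<in> A"
  and partition_nonneg: "0 \<le> \<rho> c x"
  and partition_closure: "closure {x. \<rho> c x \<noteq> 0} \<subseteq> fst c"
  and partition_continuous: "continuous_on S (\<rho> c)"
  using partition[unfolded partition_of_unity_def] continuous_on_subset[OF _ subset_UNIV, of "\<rho> c" S] by blast+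

lemma partition_pos: "\<exists>c\<in>A. x \<in> fst c \<and> 0 < \<rho> c x"
proof -
  have "(\<Sum>c | \<rho> c \<noteq> 0. \<rho> c x) = 1"
    using partition by (simp add: partition_of_unity_def)
  then obtain c where "\<rho> c \<noteq> 0" "\<rho> c x \<noteq> 0"
    by (metis (mono_tags, lifting) mem_Collect_eq sum.neutral zero_neq_one)
  then show ?thesis
    using partition_nonneg[of c x] partition_chart[of c] partition_closure[of c] closure_subset[of "{x. \<rho> c x \<noteq> 0}"]
    by (intro bexI[of _ c]) auto
qed

definition integrand :: "(('x, 'n) chart \<Rightarrow> 'x \<Rightarrow> complex) \<Rightarrow> ('x, 'n) chart \<Rightarrow> complex^'n \<Rightarrow> complex" where
  "integrand f c z = of_real (\<rho> c (chart_inv c z) * vol_density (\<omega> c (chart_inv c z))) * f c (chart_inv c z)"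

lemma integral_vol_eq:
  "integral_vol A \<omega> f = (\<Sum>c | \<rho> c \<noteq> 0. (LINT z:chart_image c|lborel. integrand f c z))"
  unfolding integral_vol_def Let_def \<rho>_def[symmetric] integrand_def ..

definition chart_continuous :: "(('x, 'n) chart \<Rightarrow> 'x \<Rightarrow> complex) \<Rightarrow> bool" where
  "chart_continuous f \<longleftrightarrow> (\<forall>c\<in>A. continuous_on (chart_image c) (\<lambda>z. f c (chart_inv c z)))"

lemma integral_vol_cong:
  assumes "\<And>c x. c \<in> A \<Longrightarrow> x \<in> fst c \<Longrightarrow> f c x = g c x"
  shows "integral_vol A \<omega> f = integral_vol A \<omega> g"
  unfolding integral_vol_eq
proof (intro sum.cong refl set_lebesgue_integral_cong allI impI)
  fix c assume "c \<in> {c. \<rho> c \<noteq> 0}"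
  then have c: "c \<in> A" using partition_chart by simp
  show "chart_image c \<in> sets lborel"
    using open_chart_image[OF c] by simp
  show "integrand f c z = integrand g c z" if "z \<in> chart_image c" for z
    using assms[OF c chart_inv_in[OF that]] by (simp add: integrand_def)
qed

lemma vol_density_gram: "vol_density w = sqrt \<bar>det (gram w)\<bar>"
  by (simp add: vol_density_def gram_def)

lemma chart_inv_continuous: "c \<in> A \<Longrightarrow> continuous_on (chart_image c) (chart_inv c)"
  using chart_homeomorphism by (auto simp: homeomorphism_def)

lemma weight_continuous:
  assumes c: "c \<in> A"
  shows "continuous_on (chart_image c) (\<lambda>z. \<rho> c (chart_inv c z) * vol_density (\<omega> c (chart_inv c z)))"
proof -
  have "continuous_on (chart_image c) (\<lambda>z. complex_of_real (det (gram (\<omega> c (chart_inv c z)))))"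
    using smooth_on_det[OF open_chart_image[OF c] gram_smooth[OF c]] by (rule smooth_on_continuous)
  then have "continuous_on (chart_image c) (\<lambda>z. Re (complex_of_real (det (gram (\<omega> c (chart_inv c z))))))"
    by (rule continuous_on_Re)
  then have "continuous_on (chart_image c) (\<lambda>z. det (gram (\<omega> c (chart_inv c z))))" by simp
  moreover have "continuous_on (chart_image c) (\<lambda>z. \<rho> c (chart_inv c z))"
    by (rule continuous_on_compose2[OF partition_continuous[of UNIV] chart_inv_continuous[OF c]]) simp
  ultimately show ?thesis
    unfolding vol_density_gram by (intro continuous_intros)
qed

lemma integrand_continuous:
  "chart_continuous f \<Longrightarrow> c \<in> A \<Longrightarrow> continuous_on (chart_image c) (integrand f c)"
  unfolding integrand_def chart_continuous_def
  by (intro continuous_on_mult continuous_on_of_real weight_continuous) auto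

text \<open>A chart image need not be bounded, nor the integrand bounded on it a priori, but the
  weight \<open>\<rho> c\<close> vanishes off the compact image \<open>K\<close> of its support, and
  there continuity suffices.\<close>

lemma integrand_integrable:
  assumes f: "chart_continuous f" and c: "c \<in> A"
  shows "set_integrable lborel (chart_image c) (integrand f c)"
proof -
  define K where "K = snd c ` closure {x. \<rho> c x \<noteq> 0}"
  have "compact (closure {x. \<rho> c x \<noteq> 0})"
    using compact_Int_closed[OF compact_space] by simp
  moreover have "continuous_on (closure {x. \<rho> c x \<noteq> 0}) (snd c)"
    by (rule continuous_on_subset[OF homeomorphism_cont1[OF chart_homeomorphism[OF c]] partition_closure])
  ultimately have "compact K"
    unfolding K_def by (intro compact_continuous_image)
  moreover have KU: "K \<subseteq> chart_image c"
    unfolding K_def by (rule image_mono[OF partition_closure])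
  ultimately have "integrable lborel (\<lambda>z. indicator K z *\<^sub>R integrand f c z)"
    using continuous_on_subset[OF integrand_continuous[OF f c]] by (intro borel_integrable_compact)
  moreover have "indicator (chart_image c) z *\<^sub>R integrand f c z = indicator K z *\<^sub>R integrand f c z" for z
  proof (cases "z \<in> chart_image c \<and> z \<notin> K")
    case True
    have "\<rho> c (chart_inv c z) = 0"
    proof (rule ccontr)
      assume "\<rho> c (chart_inv c z) \<noteq> 0"
      then have "chart_inv c z \<in> closure {x. \<rho> c x \<noteq> 0}"
        by (intro subsetD[OF closure_subset] CollectI)
      then have "snd c (chart_inv c z) \<in> K"
        unfolding K_def by (rule imageI)
      then show False
        using True by (simp only: snd_chart_inv simp_thms)
    qed
    then show ?thesis by (simp add: integrand_def)
  qed (use KU in \<open>auto simp: indicator_def\<close>)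
  ultimately show ?thesis
    by (simp only: set_integrable_def)
qed

lemma integral_vol_diff:
  assumes "chart_continuous f" "chart_continuous g"
  shows "integral_vol A \<omega> (\<lambda>c x. f c x - g c x) = integral_vol A \<omega> f - integral_vol A \<omega> g"
proof -
  have i: "integrand (\<lambda>c x. f c x - g c x) c z = integrand f c z - integrand g c z" for c z
    by (simp add: integrand_def algebra_simps)
  show ?thesis
    unfolding integral_vol_eq sum_subtractf[symmetric] i
  proof (rule sum.cong[OF refl])
    fix c assume "c \<in> {c. \<rho> c \<noteq> 0}"
    then have "c \<in> A" using partition_chart by simp
    then show "(LINT z:chart_image c|lborel. integrand f c z - integrand g c z) =
      (LINT z:chart_image c|lborel. integrand f c z) - (LINT z:chart_image c|lborel. integrand g c z)"
      by (intro set_integral_diff(2) integrand_integrable assms)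
  qed
qed

lemma vol_density_pos: "c \<in> A \<Longrightarrow> x \<in> fst c \<Longrightarrow> 0 < vol_density (\<omega> c x)"
  using gram_det_nonzero[of c "snd c x"] by (simp add: vol_density_gram)

text \<open>Every chart contributes a nonnegative amount, so each contribution is zero. The
  conclusion reaches only the points where the weight of the chart is positive.\<close>

lemma integral_vol_zero:
  assumes f: "chart_continuous f" and nonneg: "\<And>c x. c \<in> A \<Longrightarrow> x \<in> fst c \<Longrightarrow> f c x \<in> \<real> \<and> 0 \<le> Re (f c x)"
    and zero: "integral_vol A \<omega> f = 0" and c: "c \<in> A" "x \<in> fst c" "0 < \<rho> c x"
  shows "f c x = 0"
proof -
  define q where "q c z = Re (integrand f c z)" for c z
  have q: "integrand f c z = of_real (q c z)" "0 \<le> q c z" if c: "c \<in> A" "z \<in> chart_image c" for c z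
  proof -
    have n: "f c (chart_inv c z) \<in> \<real>" "0 \<le> Re (f c (chart_inv c z))"
      using nonneg[OF c(1) chart_inv_in[OF c(2)]] by auto
    show "integrand f c z = of_real (q c z)"
      using n(1) unfolding q_def integrand_def by (simp add: Reals_mult)
    have "q c z = (\<rho> c (chart_inv c z) * vol_density (\<omega> c (chart_inv c z))) * Re (f c (chart_inv c z))"
      by (simp add: q_def integrand_def)
    then show "0 \<le> q c z"
      using n(2) partition_nonneg[of c] vol_density_pos[OF c(1) chart_inv_in[OF c(2)]] by simp
  qed
  have int: "set_integrable lborel (chart_image c) (q c)" if "c \<in> A" for c
    using integrable_Re[OF integrand_integrable[OF f that, unfolded set_integrable_def]]
    by (simp add: set_integrable_def q_def)
  have pos: "0 \<le> (LINT z:chart_image c|lborel. q c z)" if "c \<in> A" for c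
    unfolding set_lebesgue_integral_def using q(2)[OF that]
    by (intro Bochner_Integration.integral_nonneg) (auto simp: indicator_def)
  have "(LINT z:chart_image c|lborel. integrand f c z) = of_real (LINT z:chart_image c|lborel. q c z)" if "c \<in> A" for c
    unfolding set_integral_complex_of_real[symmetric]
    using open_chart_image[OF that] q(1)[OF that] by (intro set_lebesgue_integral_cong) auto
  then have "complex_of_real (\<Sum>c | \<rho> c \<noteq> 0. (LINT z:chart_image c|lborel. q c z)) = 0"
    unfolding zero[symmetric] integral_vol_eq of_real_sum by (intro sum.cong refl) (simp add: partition_chart)
  then have "(\<Sum>c | \<rho> c \<noteq> 0. (LINT z:chart_image c|lborel. q c z)) = 0"
    by (simp only: of_real_eq_0_iff)
  then have zq: "(LINT z:chart_image c|lborel. q c z) = 0"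
  proof (rule sum_nonneg_0[rotated 2])
    show "finite {c. \<rho> c \<noteq> 0}"
      using partition by (simp add: partition_of_unity_def)
    show "c \<in> {c. \<rho> c \<noteq> 0}"
      using c(3) by auto
  qed (simp add: pos partition_chart)
  have cont: "continuous_on (chart_image c) (q c)"
    unfolding q_def by (intro continuous_on_Re integrand_continuous f c)
  have "snd c x \<in> chart_image c"
    using c(2) by (rule imageI)
  from zero_set_integral_open[OF open_chart_image[OF c(1)] int[OF c(1)] cont q(2)[OF c(1)] zq this]
  have "q c (snd c x) = 0" .
  then have "integrand f c (snd c x) = 0"
    using q(1)[OF c(1), of "snd c x"] c by simp
  then show ?thesis
    using c vol_density_pos[OF c(1,2)] by (simp add: integrand_def)
qed

text \<open>The regularity seen by integrals. Exterior derivatives are placed in this class: for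
  them alternation and continuous coefficients are established, while compatibility between charts
  is not claimed.\<close>

definition coeff_continuous :: "('x, 'n) dform \<Rightarrow> bool" where
  "coeff_continuous u \<longleftrightarrow> (\<forall>c\<in>A. (\<forall>x. alternating (u c x)) \<and>
     (\<forall>vs. continuous_on (chart_image c) (\<lambda>z. u c (chart_inv c z) vs)))"

lemma smooth_forms_coeff_continuous: "u \<in> smooth_forms A k \<Longrightarrow> coeff_continuous u"
  unfolding coeff_continuous_def by (intro ballI conjI allI smooth_formsD(2) smooth_on_continuous smooth_formsD(5))

text \<open>The chosen frame may jump from point to point. Each slot is therefore rewritten by
  \<open>frame_trace\<close> with the inverse Gram matrix and constant coordinate vectors, whose
  coefficients are continuous.\<close>

lemma frame_sum_continuous:
  assumes c: "c \<in> A" and "\<And>x. alternating (u x)" "\<And>x. alternating (v x)"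
    and "\<And>vs. continuous_on (chart_image c) (\<lambda>z. u (chart_inv c z) vs)"
    and "\<And>vs. continuous_on (chart_image c) (\<lambda>z. v (chart_inv c z) vs)"
  shows "continuous_on (chart_image c)
    (\<lambda>z. frame_sum (frame_of (\<omega> c (chart_inv c z))) k (u (chart_inv c z)) (v (chart_inv c z)))"
  using assms(2-5)
proof (induction k arbitrary: u v)
  case 0
  then show ?case by (auto intro!: continuous_intros)
next
  case (Suc k)
  have "continuous_on (chart_image c) (\<lambda>z. \<Sum>j\<in>UNIV. \<Sum>l\<in>UNIV. of_real (gram_inv (\<omega> c (chart_inv c z)) j l) *
    frame_sum (frame_of (\<omega> c (chart_inv c z))) k (ctr (real_basis j) (u (chart_inv c z))) (ctr (real_basis l) (v (chart_inv c z))))"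
  proof (intro continuous_on_sum continuous_on_mult smooth_on_continuous[OF gram_inv_smooth[OF c]])
    fix j l :: "'n \<times> bool"
    show "continuous_on (chart_image c) (\<lambda>z. frame_sum (frame_of (\<omega> c (chart_inv c z))) k
      (ctr (real_basis j) (u (chart_inv c z))) (ctr (real_basis l) (v (chart_inv c z))))"
    proof (rule Suc(1))
      show "alternating (ctr (real_basis j) (u x))" "alternating (ctr (real_basis l) (v x))" for x
        by (intro alternating_ctr Suc(2,3))+
    qed (simp_all only: ctr_apply Suc(4,5))
  qed
  then show ?case
  proof (rule continuous_on_eq)
    fix z assume z: "z \<in> chart_image c"
    have w: "positive_11 (\<omega> c (chart_inv c z))"
      by (rule metric_positive[OF c chart_inv_in[OF z]])
    show "(\<Sum>j\<in>UNIV. \<Sum>l\<in>UNIV. of_real (gram_inv (\<omega> c (chart_inv c z)) j l) *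
      frame_sum (frame_of (\<omega> c (chart_inv c z))) k (ctr (real_basis j) (u (chart_inv c z))) (ctr (real_basis l) (v (chart_inv c z))))
      = frame_sum (frame_of (\<omega> c (chart_inv c z))) (Suc k) (u (chart_inv c z)) (v (chart_inv c z))"
      unfolding frame_sum.simps(2)
      by (rule frame_trace[OF w orthonormal_frame_of[OF w] bilinear_frame_sum, symmetric]) (use Suc in auto)
  qed
qed

lemma inner_continuous:
  assumes "coeff_continuous u" "coeff_continuous v"
  shows "chart_continuous (\<lambda>c x. inner_alt (\<omega> c x) (u c x) (v c x))"
  unfolding chart_continuous_def
proof
  fix c assume c: "c \<in> A"
  have "continuous_on (chart_image c) (\<lambda>z. \<Sum>k\<le>2 * CARD('n).
    frame_sum (frame_of (\<omega> c (chart_inv c z))) k (u c (chart_inv c z)) (v c (chart_inv c z)) / fact k)"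
    using assms c unfolding coeff_continuous_def
    by (intro continuous_on_sum continuous_on_divide continuous_on_const frame_sum_continuous[of c "u c" "v c"]) auto
  then show "continuous_on (chart_image c)
    (\<lambda>z. inner_alt (\<omega> c (chart_inv c z)) (u c (chart_inv c z)) (v c (chart_inv c z)))"
    by (rule continuous_on_eq) (simp add: inner_alt_frame_sum metric_positive[OF c] chart_inv_in)
qed

lemma coeff_continuous_theta:
  assumes f: "smooth_function A (\<lambda>x. of_real (f x))" and u: "coeff_continuous u"
  shows "coeff_continuous (\<lambda>c x. theta_alt (f x) (u c x))"
  unfolding coeff_continuous_def
proof (intro ballI conjI allI)
  fix c x assume "c \<in> A"
  then show "alternating (theta_alt (f x) (u c x))"
    using u by (simp add: theta_alt_alternating coeff_continuous_def)
next
  fix c vs assume c: "c \<in> A"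
  have "continuous_on (chart_image c) (\<lambda>z. complex_of_real (f (chart_inv c z)))"
    by (rule smooth_on_continuous) (use f c in \<open>simp add: smooth_function_def\<close>)
  moreover have "continuous_on (chart_image c) (\<lambda>z. type_proj p q (u c (chart_inv c z)) vs)" for p q
  proof (cases "length vs = p + q")
    case True
    show ?thesis
      unfolding type_proj_def Let_def if_P[OF True] divide_inverse
      using u c by (intro continuous_on_mult continuous_on_sum continuous_on_const) (auto simp: coeff_continuous_def)
  qed (simp add: type_proj_degree)
  ultimately show "continuous_on (chart_image c) (\<lambda>z. theta_alt (f (chart_inv c z)) (u c (chart_inv c z)) vs)"
    unfolding theta_alt_def sum_fun_apply smul_apply of_real_power
    by (intro continuous_on_sum continuous_on_mult continuous_on_power)
qed

end

section \<open>Exterior derivative at a point\<close>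

text \<open>The formula of \<open>ext_d\<close> freed from the chart: contracting \<open>U\<close>
  with a constant vector gives a family of the same kind, to which an induction hypothesis
  applies.\<close>

definition point_d :: "('v::real_normed_vector \<Rightarrow> 'v alt) \<Rightarrow> 'v \<Rightarrow> 'v alt" where
  "point_d U z vs = (\<Sum>j<length vs. (-1) ^ j *
     frechet_derivative (\<lambda>y. U y (take j vs @ drop (Suc j) vs)) (at z) (vs ! j))"

lemma point_d_Nil [simp]: "point_d U z [] = 0"
  by (simp add: point_d_def)

text \<open>Cartan's formula for a constant vector field.\<close>

lemma point_d_Cons:
  "point_d U z (v # vs) = frechet_derivative (\<lambda>y. U y vs) (at z) v - point_d (\<lambda>y. ctr v (U y)) z vs"
  by (simp add: point_d_def sum.lessThan_Suc_shift ctr_apply sum_negf del: sum.lessThan_Suc)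

definition pointwise_alternating :: "'v::real_normed_vector \<Rightarrow> ('v \<Rightarrow> 'v alt) \<Rightarrow> bool" where
  "pointwise_alternating z U \<longleftrightarrow> (\<forall>y. alternating (U y)) \<and> (\<forall>vs. (\<lambda>y. U y vs) differentiable (at z))"

lemma pointwise_alternating_ctr: "pointwise_alternating z U \<Longrightarrow> pointwise_alternating z (\<lambda>y. ctr v (U y))"
  unfolding pointwise_alternating_def by (intro conjI allI) (simp_all only: alternating_ctr ctr_apply simp_thms)

lemma point_d_add:
  assumes "\<And>vs. (\<lambda>y. U y vs) differentiable (at z)" "\<And>vs. (\<lambda>y. V y vs) differentiable (at z)"
  shows "point_d (\<lambda>y. U y + V y) z vs = point_d U z vs + point_d V z vs"
proof -
  have "frechet_derivative (\<lambda>y. U y us + V y us) (at z)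
    = (\<lambda>v. frechet_derivative (\<lambda>y. U y us) (at z) v + frechet_derivative (\<lambda>y. V y us) (at z) v)" for us
    by (intro frechet_derivative_eqI has_derivative_add has_frechet_derivative assms)
  then show ?thesis
    by (simp add: point_d_def sum.distrib algebra_simps)
qed

lemma point_d_smul:
  assumes "\<And>vs. (\<lambda>y. U y vs) differentiable (at z)"
  shows "point_d (\<lambda>y. smul c (U y)) z vs = c * point_d U z vs"
proof -
  have "frechet_derivative (\<lambda>y. c * U y us) (at z)
    = (\<lambda>v. c * frechet_derivative (\<lambda>y. U y us) (at z) v)" for us
    by (intro frechet_derivative_eqI has_derivative_mult_right has_frechet_derivative assms)
  then show ?thesis
    by (simp add: point_d_def smul_apply sum_distrib_left mult_ac)
qed

text \<open>Induction along the arguments by Cartan's formula, absorbing the leading vectors into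
  \<open>U\<close> until the slots in question come first. There the two derivative terms belonging
  to \<open>v # v\<close> cancel, and the rest is a double contraction.\<close>

lemma alternating_point_d:
  assumes "pointwise_alternating z U"
  shows "alternating (point_d U z)"
proof (rule alternatingI_adjacent)
  fix xs ys
  show "linear (\<lambda>v. point_d U z (xs @ v # ys))"
    using assms
  proof (induction xs arbitrary: U)
    case Nil
    have U: "alternating (U y)" "(\<lambda>y. U y vs) differentiable (at z)" for y vs
      using Nil by (auto simp: pointwise_alternating_def)
    have D: "(\<lambda>y. ctr v (U y) vs) differentiable (at z)" for v vs
      unfolding ctr_apply by (rule U)
    have "linear (\<lambda>v. frechet_derivative (\<lambda>y. U y ys) (at z) v)"
      using linear_frechet_derivative[OF U(2)] .
    moreover have "linear (\<lambda>v. point_d (\<lambda>y. ctr v (U y)) z ys)"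
      by (rule linearI) (simp_all only: ctr_linear[OF U(1)] point_d_add[OF D D] point_d_smul[OF D] scaleR_conv_of_real)
    ultimately show ?case
      by (simp add: point_d_Cons linear_compose_sub)
  next
    case (Cons x xs)
    have U: "alternating (U y)" "(\<lambda>y. U y vs) differentiable (at z)" for y vs
      using Cons(2) by (auto simp: pointwise_alternating_def)
    have "linear (\<lambda>v. frechet_derivative (\<lambda>y. U y (xs @ v # ys)) (at z) x)"
    proof (rule linearI)
      fix a b and r :: real
      have "frechet_derivative (\<lambda>y. U y (xs @ (a + b) # ys)) (at z) = (\<lambda>v. frechet_derivative (\<lambda>y. U y (xs @ a # ys)) (at z) v
        + frechet_derivative (\<lambda>y. U y (xs @ b # ys)) (at z) v)"
        unfolding linear_add[OF alternating_linear[OF U(1)]]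
        by (intro frechet_derivative_eqI has_derivative_add has_frechet_derivative U)
      then show "frechet_derivative (\<lambda>y. U y (xs @ (a + b) # ys)) (at z) x = frechet_derivative (\<lambda>y. U y (xs @ a # ys)) (at z) x
        + frechet_derivative (\<lambda>y. U y (xs @ b # ys)) (at z) x" by simp
      have "frechet_derivative (\<lambda>y. U y (xs @ (r *\<^sub>R a) # ys)) (at z)
        = (\<lambda>v. r *\<^sub>R frechet_derivative (\<lambda>y. U y (xs @ a # ys)) (at z) v)"
        unfolding linear_cmul[OF alternating_linear[OF U(1)]]
        by (intro frechet_derivative_eqI has_derivative_scaleR_right has_frechet_derivative U)
      then show "frechet_derivative (\<lambda>y. U y (xs @ (r *\<^sub>R a) # ys)) (at z) x
        = r *\<^sub>R frechet_derivative (\<lambda>y. U y (xs @ a # ys)) (at z) x" by simp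
    qed
    then show ?case
      using Cons(1)[OF pointwise_alternating_ctr[OF Cons(2), of x]] by (simp add: point_d_Cons linear_compose_sub)
  qed
next
  fix xs v ys
  show "point_d U z (xs @ v # v # ys) = 0"
    using assms
  proof (induction xs arbitrary: U)
    case Nil
    then have "ctr v (ctr v (U y)) = 0" for y
      by (intro ctr_ctr_same) (simp add: pointwise_alternating_def)
    then have "point_d (\<lambda>y. ctr v (ctr v (U y))) z ys = 0"
      by (simp add: point_d_def frechet_derivative_eqI[OF has_derivative_const])
    then show ?case
      by (simp add: point_d_Cons ctr_apply[of v "U _"])
  next
    case (Cons x xs)
    have "(\<lambda>y. U y (xs @ v # v # ys)) = (\<lambda>y. 0)"
      using Cons(2) by (auto simp: pointwise_alternating_def alternating_def)
    then have "frechet_derivative (\<lambda>y. U y (xs @ v # v # ys)) (at z) x = 0"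
      by (simp add: frechet_derivative_eqI[OF has_derivative_const])
    then show ?case
      using Cons(1)[OF pointwise_alternating_ctr[OF Cons(2), of x]] by (simp add: point_d_Cons)
  qed
qed

text \<open>Both sides are sums over the omitted argument, and the product rule matches them term by
  term.\<close>

lemma point_d_product:
  assumes f: "f differentiable (at z)" and U: "\<And>vs. (\<lambda>y. U y vs) differentiable (at z)"
  shows "point_d (\<lambda>y. smul (f y) (U y)) z
    = wedge (oneform (frechet_derivative f (at z))) (U z) + smul (f z) (point_d U z)"
proof
  fix vs
  have "frechet_derivative (\<lambda>y. f y * U y us) (at z) = (\<lambda>v. f z * frechet_derivative (\<lambda>y. U y us) (at z) v
     + frechet_derivative f (at z) v * U z us)" for us
    by (intro frechet_derivative_eqI has_derivative_mult has_frechet_derivative f U)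
  then show "point_d (\<lambda>y. smul (f y) (U y)) z vs
    = (wedge (oneform (frechet_derivative f (at z))) (U z) + smul (f z) (point_d U z)) vs"
    by (simp add: point_d_def smul_apply oneform_wedge_sum sum_distrib_left sum.distrib[symmetric] algebra_simps)
qed

context compact_hermitian_manifold
begin

lemma ext_d_point_d:
  "ext_d A u c x = (if c \<in> A \<and> x \<in> fst c then point_d (\<lambda>z. u c (chart_inv c z)) (snd c x) else 0)"
  unfolding ext_d_def point_d_def
  by (cases "c \<in> A \<and> x \<in> fst c") (simp_all only: simp_thms if_True if_False zero_fun_def)

lemma smooth_forms_differentiable:
  assumes "u \<in> smooth_forms A k" "c \<in> A" "x \<in> fst c"
  shows "(\<lambda>z. u c (chart_inv c z) vs) differentiable (at (snd c x))"
  by (rule smooth_on_differentiable[OF smooth_formsD(5)[OF assms(1,2)] imageI[OF assms(3)]])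

lemma ext_d_alternating:
  assumes u: "u \<in> smooth_forms A k" shows "alternating (ext_d A u c x)"
proof (cases "c \<in> A \<and> x \<in> fst c")
  case True
  then have "pointwise_alternating (snd c x) (\<lambda>z. u c (chart_inv c z))"
    using smooth_formsD(2)[OF u] smooth_forms_differentiable[OF u] by (simp add: pointwise_alternating_def)
  then show ?thesis
    unfolding ext_d_point_d if_P[OF True] by (rule alternating_point_d)
next
  case False
  show ?thesis
    unfolding ext_d_point_d if_not_P[OF False] by (rule alternating_zero)
qed

lemma ext_d_coeff_continuous:
  assumes u: "u \<in> smooth_forms A k" shows "coeff_continuous (ext_d A u)"
  unfolding coeff_continuous_def
proof (intro ballI conjI allI ext_d_alternating[OF u])
  fix c vs assume c: "c \<in> A"
  have "continuous_on (chart_image c) (\<lambda>z. \<Sum>j<length vs. (-1) ^ j *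
    frechet_derivative (\<lambda>y. u c (chart_inv c y) (take j vs @ drop (Suc j) vs)) (at z) (vs ! j))"
    by (intro continuous_on_sum continuous_on_mult continuous_on_const smooth_on_continuous smooth_on_derivative
        smooth_formsD(5)[OF u] c)
  then show "continuous_on (chart_image c) (\<lambda>z. ext_d A u c (chart_inv c z) vs)"
    by (rule continuous_on_eq) (simp add: ext_d_def chart_inv_in snd_chart_inv c)
qed

lemma ext_d_fmult:
  assumes f: "smooth_function A f" and u: "u \<in> smooth_forms A k" and c: "c \<in> A" "x \<in> fst c"
  shows "ext_d A (fmult f u) c x
    = wedge (oneform (function_derivative c f x)) (u c x) + smul (f x) (ext_d A u c x)"
proof -
  have "(\<lambda>z. f (chart_inv c z)) differentiable (at (snd c x))"
    using function_has_derivative[OF f c] by (auto simp: differentiable_def)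
  from point_d_product[OF this smooth_forms_differentiable[OF u c]] show ?thesis
    using c unfolding ext_d_point_d function_derivative_def by (simp add: fmult_apply)
qed

text \<open>Every point lies in some chart of positive weight, and the transformation rule carries
  the vanishing from there to the other charts.\<close>

lemma smooth_forms_eq_zero:
  assumes h: "h \<in> smooth_forms A k" and z: "\<And>c x. c \<in> A \<Longrightarrow> x \<in> fst c \<Longrightarrow> 0 < \<rho> c x \<Longrightarrow> h c x = 0"
  shows "h = 0"
proof (intro ext)
  fix c x vs
  have "h c x = 0"
  proof (cases "c \<in> A \<and> x \<in> fst c")
    case True
    obtain c' where c': "c' \<in> A" "x \<in> fst c'" "0 < \<rho> c' x"
      using partition_pos by blast
    then have "h c x = pull (chart_derivative c c' x) (h c' x)"
      using True by (intro smooth_formsD(4)[OF h]) auto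
    then show ?thesis
      unfolding z[OF c'] by (simp only: pull_zero)
  qed (rule smooth_formsD(1)[OF h])
  then show "h c x vs = 0 c x vs"
    by (simp only: zero_fun_apply)
qed

lemma L2_inner_definite:
  assumes h: "h \<in> smooth_forms A k" and z: "L2_inner A \<omega> h h = 0"
  shows "h = 0"
proof (rule smooth_forms_eq_zero[OF h])
  fix c x assume c: "c \<in> A" "x \<in> fst c" "0 < \<rho> c x"
  have "inner_alt (\<omega> c x) (h c x) (h c x) = 0"
    by (rule integral_vol_zero[OF inner_continuous[OF smooth_forms_coeff_continuous[OF h] smooth_forms_coeff_continuous[OF h]]
          _ z[unfolded L2_inner_def] c]) (simp add: inner_alt_nonneg)
  then show "h c x = 0"
    by (rule inner_alt_definite[OF metric_positive[OF c(1,2)] smooth_formsD(2)[OF h]])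
qed

lemma L2_inner_diff:
  assumes "u \<in> smooth_forms A k" "v \<in> smooth_forms A k" "w \<in> smooth_forms A k"
  shows "L2_inner A \<omega> u (v - w) = L2_inner A \<omega> u v - L2_inner A \<omega> u w"
  unfolding L2_inner_def
  by (subst integral_vol_diff[symmetric]) (auto intro!: inner_continuous smooth_forms_coeff_continuous[OF assms(1)]
      smooth_forms_coeff_continuous[OF assms(2)] smooth_forms_coeff_continuous[OF assms(3)] simp: inner_alt_diff)

end

section \<open>The twisted inner product on forms\<close>

locale twisted_manifold = compact_hermitian_manifold A \<omega>
  for A :: "('x::t2_space, 'n::finite) chart set" and \<omega> +
  fixes \<eta> :: "'x \<Rightarrow> real"
  assumes eta_smooth: "smooth_function A (\<lambda>x. complex_of_real (\<eta> x))"
    and eta_pos: "0 < \<eta> x"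
begin

lemma eta_nonzero [simp]: "\<eta> x \<noteq> 0"
  using eta_pos[of x] by simp

lemma eta_power_smooth: "smooth_function A (\<lambda>x. complex_of_real (\<eta> x ^ m))"
  using smooth_function_power[OF eta_smooth] by simp

lemma eta_inverse_smooth: "smooth_function A (\<lambda>x. complex_of_real (inverse (\<eta> x)))"
  using smooth_function_inverse[OF eta_smooth] by simp

lemma eta_power_inverse_smooth: "smooth_function A (\<lambda>x. complex_of_real (1 / \<eta> x ^ m))"
  using smooth_function_power[OF eta_inverse_smooth, of m] by (simp add: field_simps)

lemma twisted_integrand:
  assumes "c \<in> A" "x \<in> fst c" "alternating (u c x)" "alternating (v c x)"
  shows "twisted_inner_alt (\<eta> x) (\<omega> c x) (u c x) (v c x) * of_real (1 / \<eta> x ^ (2 * CARD('n)))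
    = inner_alt (\<omega> c x) (theta_alt ((\<eta> x)\<^sup>2) (u c x)) (v c x) * of_real (1 / \<eta> x ^ (2 * CARD('n)))"
  using twisted_inner_alt_eq[OF metric_positive[OF assms(1,2)] assms(3,4)] by simp

lemma twisted_L2_eq:
  assumes "coeff_continuous u" "coeff_continuous v"
  shows "twisted_L2_inner A \<omega> \<eta> u v = integral_vol A \<omega>
    (\<lambda>c x. inner_alt (\<omega> c x) (theta_alt ((\<eta> x)\<^sup>2) (u c x)) (v c x) * of_real (1 / \<eta> x ^ (2 * CARD('n))))"
  unfolding twisted_L2_inner_def
  by (rule integral_vol_cong, rule twisted_integrand) (use assms in \<open>auto simp: coeff_continuous_def\<close>)

lemma twisted_continuous:
  assumes "coeff_continuous u" "coeff_continuous v"
  shows "chart_continuous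
    (\<lambda>c x. inner_alt (\<omega> c x) (theta_alt ((\<eta> x)\<^sup>2) (u c x)) (v c x) * of_real (1 / \<eta> x ^ (2 * CARD('n))))"
  unfolding chart_continuous_def
proof (intro ballI continuous_on_mult)
  fix c assume c: "c \<in> A"
  show "continuous_on (chart_image c) (\<lambda>z. complex_of_real (1 / \<eta> (chart_inv c z) ^ (2 * CARD('n))))"
    by (rule smooth_on_continuous) (use eta_power_inverse_smooth c in \<open>simp add: smooth_function_def\<close>)
  show "continuous_on (chart_image c) (\<lambda>z. inner_alt (\<omega> c (chart_inv c z))
     (theta_alt ((\<eta> (chart_inv c z))\<^sup>2) (u c (chart_inv c z))) (v c (chart_inv c z)))"
    using inner_continuous[OF coeff_continuous_theta[OF eta_power_smooth[of 2] assms(1)] assms(2)] c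
    unfolding chart_continuous_def by blast
qed

lemma twisted_L2_diff_left:
  assumes u: "coeff_continuous u" "coeff_continuous u'" "coeff_continuous (u - u')" and v: "coeff_continuous v"
  shows "twisted_L2_inner A \<omega> \<eta> (u - u') v = twisted_L2_inner A \<omega> \<eta> u v - twisted_L2_inner A \<omega> \<eta> u' v"
proof -
  have d: "inner_alt w (theta_alt t (\<alpha> - \<beta>)) \<gamma> = inner_alt w (theta_alt t \<alpha>) \<gamma> - inner_alt w (theta_alt t \<beta>) \<gamma>"
    for w \<alpha> \<beta> \<gamma> and t :: real
    using inner_alt_add(1)[of w "theta_alt t (\<alpha> - \<beta>)" "theta_alt t \<beta>" \<gamma>] theta_alt_add[of t "\<alpha> - \<beta>" \<beta>] by simp
  show ?thesis
    unfolding twisted_L2_eq[OF u(1) v] twisted_L2_eq[OF u(2) v] twisted_L2_eq[OF u(3) v]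
    by (subst integral_vol_diff[OF twisted_continuous[OF u(1) v] twisted_continuous[OF u(2) v], symmetric])
      (simp only: minus_apply d left_diff_distrib)
qed

lemma twisted_L2_diff_right:
  assumes u: "coeff_continuous u" and v: "coeff_continuous v" "coeff_continuous v'" "coeff_continuous (v - v')"
  shows "twisted_L2_inner A \<omega> \<eta> u (v - v') = twisted_L2_inner A \<omega> \<eta> u v - twisted_L2_inner A \<omega> \<eta> u v'"
  unfolding twisted_L2_eq[OF u v(1)] twisted_L2_eq[OF u v(2)] twisted_L2_eq[OF u v(3)]
  by (subst integral_vol_diff[OF twisted_continuous[OF u v(1)] twisted_continuous[OF u v(2)], symmetric])
    (simp only: minus_apply inner_alt_diff left_diff_distrib)

text \<open>As \<open>theta_alt ((\<eta> x)\<^sup>2)\<close> is the square of the selfadjoint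
  \<open>theta_alt (\<eta> x)\<close>, the integrand is a squared norm. Its vanishing passes to
  \<open>h\<close> because \<open>theta_alt (\<eta> x)\<close> is invertible for positive
  \<eta>.\<close>

lemma twisted_L2_definite:
  assumes h: "h \<in> smooth_forms A k" and z: "twisted_L2_inner A \<omega> \<eta> h h = 0"
  shows "h = 0"
proof (rule smooth_forms_eq_zero[OF h])
  fix c x assume c: "c \<in> A" "x \<in> fst c" "0 < \<rho> c x"
  note hc = smooth_forms_coeff_continuous[OF h]
  have e: "inner_alt (\<omega> c x) (theta_alt ((\<eta> x)\<^sup>2) (h c x)) (h c x)
      = inner_alt (\<omega> c x) (theta_alt (\<eta> x) (h c x)) (theta_alt (\<eta> x) (h c x))"
    if c: "c \<in> A" "x \<in> fst c" for c x
    unfolding power2_eq_square theta_alt_mult[OF smooth_formsD(2)[OF h], symmetric]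
    by (rule theta_alt_selfadjoint[OF metric_positive[OF c]]) (intro theta_alt_alternating smooth_formsD(2)[OF h])+
  have "inner_alt (\<omega> c x) (theta_alt ((\<eta> x)\<^sup>2) (h c x)) (h c x) * of_real (1 / \<eta> x ^ (2 * CARD('n))) = 0"
  proof (rule integral_vol_zero[OF twisted_continuous[OF hc hc] _ z[unfolded twisted_L2_eq[OF hc hc]] c])
    fix c x assume c: "c \<in> A" "x \<in> fst c"
    show "inner_alt (\<omega> c x) (theta_alt ((\<eta> x)\<^sup>2) (h c x)) (h c x) * of_real (1 / \<eta> x ^ (2 * CARD('n))) \<in> \<real> \<and>
      0 \<le> Re (inner_alt (\<omega> c x) (theta_alt ((\<eta> x)\<^sup>2) (h c x)) (h c x) * of_real (1 / \<eta> x ^ (2 * CARD('n))))"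
    proof -
      have "0 \<le> Re (a * of_real r)" if "0 \<le> Re a" "0 \<le> r" for a and r :: real
        using that by simp
      then show ?thesis
        unfolding e[OF c] using eta_pos[of x]
        by (intro conjI Reals_mult Reals_of_real inner_alt_nonneg) (auto simp: inner_alt_nonneg)
    qed
  qed
  then have "inner_alt (\<omega> c x) (theta_alt (\<eta> x) (h c x)) (theta_alt (\<eta> x) (h c x)) = 0"
    unfolding e[OF c(1,2)] by simp
  then have "theta_alt (\<eta> x) (h c x) = 0"
    by (rule inner_alt_definite[OF metric_positive[OF c(1,2)] theta_alt_alternating[OF smooth_formsD(2)[OF h]]])
  then have "theta_alt (inverse (\<eta> x)) (theta_alt (\<eta> x) (h c x)) = 0"
    by (simp only: theta_alt_zero)
  then show "h c x = 0"
    unfolding theta_alt_mult[OF smooth_formsD(2)[OF h]] left_inverse[OF eta_nonzero]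
      theta_alt_one[OF smooth_formsD(2)[OF h]] .
qed

text \<open>The \<open>\<omega>\<^sub>\<eta>\<close>-adjoint of \<open>df \<and> _\<close>.\<close>

definition twisted_contract :: "('x \<Rightarrow> complex) \<Rightarrow> ('x, 'n) dform \<Rightarrow> ('x, 'n) dform" where
  "twisted_contract f u = (\<lambda>c x. if c \<in> A \<and> x \<in> fst c then contract (\<omega> c x)
     (\<lambda>v. of_real ((\<eta> x)\<^sup>2) * part01 (function_derivative c f x) v + part10 (function_derivative c f x) v) (u c x)
     else 0)"

text \<open>Derivatives of chart changes commute with \<open>\<i>\<close>, so they respect
  \<open>part10\<close> and \<open>part01\<close> separately; otherwise weighting the parts
  differently would depend on the chart.\<close>

lemma smooth_forms_twisted_contract:
  assumes f: "smooth_function A f" and u: "u \<in> smooth_forms A k"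
  shows "twisted_contract f u \<in> smooth_forms A (k - 1)"
  unfolding twisted_contract_def
proof (rule smooth_forms_contract[OF u])
  fix c x assume c: "c \<in> A" "x \<in> fst c"
  note l = part10_01(4,5)[OF function_derivative_linear[OF f c]]
  show "linear (\<lambda>v. of_real ((\<eta> x)\<^sup>2) * part01 (function_derivative c f x) v + part10 (function_derivative c f x) v)"
    using l by (intro linear_compose_add linear_compose[OF _ linear_times, unfolded comp_def])
next
  fix c c' x v assume c: "c \<in> A" "c' \<in> A" "x \<in> fst c \<inter> fst c'"
  show "of_real ((\<eta> x)\<^sup>2) * part01 (function_derivative c f x) v + part10 (function_derivative c f x) v
    = of_real ((\<eta> x)\<^sup>2) * part01 (function_derivative c' f x) (chart_derivative c c' x v)
      + part10 (function_derivative c' f x) (chart_derivative c c' x v)"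
    unfolding part01_def part10_def function_derivative_chart[OF f c] chart_derivative(3)[OF c] ..
next
  fix c v assume c: "c \<in> A"
  have "smooth_on (chart_image c) (\<lambda>z. complex_of_real ((\<eta> (chart_inv c z))\<^sup>2))"
    using eta_power_smooth[of 2] c by (simp add: smooth_function_def)
  then show "smooth_on (chart_image c) (\<lambda>z. of_real ((\<eta> (chart_inv c z))\<^sup>2) *
      part01 (function_derivative c f (chart_inv c z)) v + part10 (function_derivative c f (chart_inv c z)) v)"
    unfolding part01_def part10_def divide_inverse
    using function_derivative_smooth[OF f c] open_chart_image[OF c]
    by (intro smooth_on_add smooth_on_mult smooth_on_diff smooth_on_const)
qed

lemma twisted_L2_cong:
  assumes "\<And>c x. c \<in> A \<Longrightarrow> x \<in> fst c \<Longrightarrow>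
    twisted_inner_alt (\<eta> x) (\<omega> c x) (u c x) (v c x) = twisted_inner_alt (\<eta> x) (\<omega> c x) (u' c x) (v' c x)"
  shows "twisted_L2_inner A \<omega> \<eta> u v = twisted_L2_inner A \<omega> \<eta> u' v'"
  unfolding twisted_L2_inner_def by (rule integral_vol_cong) (simp add: assms)

end

section \<open>The Leibniz rule for the twisted adjoint\<close>

locale twisted_adjoint = twisted_manifold A \<omega> \<eta>
  for A :: "('x::t2_space, 'n::finite) chart set" and \<omega> \<eta> +
  fixes k :: nat and dstar :: "('x, 'n) dform \<Rightarrow> ('x, 'n) dform"
  assumes dstar: "formal_adjoint A (twisted_L2_inner A \<omega> \<eta>) (int k) (ext_d A) dstar"
begin

lemma dstar_smooth: "u \<in> smooth_forms A (int k) \<Longrightarrow> dstar u \<in> smooth_forms A (int k - 1)"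
  and dstar_add: "u \<in> smooth_forms A (int k) \<Longrightarrow> v \<in> smooth_forms A (int k) \<Longrightarrow> dstar (u + v) = dstar u + dstar v"
  and dstar_fmult: "u \<in> smooth_forms A (int k) \<Longrightarrow> dstar (fmult (\<lambda>_. a) u) = fmult (\<lambda>_. a) (dstar u)"
  and dstar_adjoint: "u \<in> smooth_forms A (int k - 1) \<Longrightarrow> v \<in> smooth_forms A (int k) \<Longrightarrow>
    twisted_L2_inner A \<omega> \<eta> (ext_d A u) v = twisted_L2_inner A \<omega> \<eta> u (dstar v)"
  using dstar unfolding formal_adjoint_def linear_operator_def by blast+

lemma dstar_zero: "dstar 0 = 0"
  using dstar_fmult[OF smooth_forms_zero, of 0] by (simp add: fmult_def zero_fun_def)

lemma dstar_sum:
  assumes "finite I" "\<And>i. i \<in> I \<Longrightarrow> u i \<in> smooth_forms A (int k)"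
  shows "dstar (\<Sum>i\<in>I. u i) = (\<Sum>i\<in>I. dstar (u i))"
  using assms
proof (induction I rule: finite_induct)
  case (insert i I)
  then show ?case
    using dstar_add[of "u i" "\<Sum>i\<in>I. u i"] smooth_forms_sum[of I u] by (simp only: sum.insert insert_iff simp_thms)
qed (simp only: sum.empty dstar_zero)

text \<open>Paired with a test form \<open>u\<close>, this is the product rule for
  \<open>ext_d A (fmult f u)\<close> with \<open>f\<close> given by \<open>g\<close>. That
  \<open>g\<close> is real is used twice: multiplication by it is selfadjoint, and its differential
  is real as \<open>twisted_inner_wedge_adjoint\<close> demands.\<close>

lemma dstar_product:
  assumes f: "smooth_function A (\<lambda>x. of_real (g x))" and v: "v \<in> smooth_forms A (int k)"
  shows "dstar (fmult (\<lambda>x. of_real (g x)) v)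
    = fmult (\<lambda>x. of_real (g x)) (dstar v) - twisted_contract (\<lambda>x. of_real (g x)) v"
proof -
  let ?f = "\<lambda>x. complex_of_real (g x)"
  let ?tw = "twisted_L2_inner A \<omega> \<eta>"
  let ?G = "twisted_contract ?f v"
  let ?a = "dstar (fmult ?f v)" and ?b = "fmult ?f (dstar v)"
  have fv: "fmult ?f v \<in> smooth_forms A (int k)"
    by (rule smooth_forms_fmult[OF f v])
  have G: "?G \<in> smooth_forms A (int k - 1)"
    by (rule smooth_forms_twisted_contract[OF f v])
  have b: "?b \<in> smooth_forms A (int k - 1)"
    by (rule smooth_forms_fmult[OF f dstar_smooth[OF v]])
  have a: "?a \<in> smooth_forms A (int k - 1)"
    by (rule dstar_smooth[OF fv])
  have bG: "?b - ?G \<in> smooth_forms A (int k - 1)"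
    by (rule smooth_forms_diff[OF b G])
  have abG: "?a - (?b - ?G) \<in> smooth_forms A (int k - 1)"
    by (rule smooth_forms_diff[OF a bG])
  note cc = smooth_forms_coeff_continuous
  have "?tw u (?a - (?b - ?G)) = 0" if u: "u \<in> smooth_forms A (int k - 1)" for u
  proof -
    have fu: "fmult ?f u \<in> smooth_forms A (int k - 1)"
      by (rule smooth_forms_fmult[OF f u])
    have smul_tw: "twisted_inner_alt t w (smul (of_real r) \<alpha>) \<beta> = twisted_inner_alt t w \<alpha> (smul (of_real r) \<beta>)"
      if "positive_11 w" "alternating \<alpha>" "alternating \<beta>" for t w r and \<alpha> \<beta> :: "(complex^'n) alt"
      using that by (simp add: twisted_inner_alt_eq alternating_smul theta_alt_smul inner_alt_smul)
    have 1: "?tw u ?a = ?tw (fmult ?f (ext_d A u)) v"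
      unfolding dstar_adjoint[OF u fv, symmetric]
      by (rule twisted_L2_cong) (simp only: fmult_apply smul_tw metric_positive ext_d_alternating[OF u] smooth_formsD(2)[OF v])
    have 2: "?tw u ?b = ?tw (ext_d A (fmult ?f u)) v"
      unfolding dstar_adjoint[OF fu v]
      by (rule twisted_L2_cong)
        (simp only: fmult_apply smul_tw metric_positive smooth_formsD(2)[OF u] smooth_formsD(2)[OF dstar_smooth[OF v]])
    \<comment> \<open>Additivity of the integral needs continuity of the two derivative terms
      separately, since their difference alone is a pointwise wedge.\<close>
    have fd: "coeff_continuous (fmult ?f (ext_d A u))"
      unfolding coeff_continuous_def
    proof (intro ballI conjI allI)
      fix c x show "alternating (fmult ?f (ext_d A u) c x)"
        unfolding fmult_apply by (intro alternating_smul ext_d_alternating[OF u])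
    next
      fix c vs assume c: "c \<in> A"
      have "continuous_on (chart_image c) (\<lambda>z. ?f (chart_inv c z))"
        by (rule smooth_on_continuous) (use f c in \<open>simp add: smooth_function_def\<close>)
      then show "continuous_on (chart_image c) (\<lambda>z. fmult ?f (ext_d A u) c (chart_inv c z) vs)"
        using ext_d_coeff_continuous[OF u] c unfolding fmult_def coeff_continuous_def
        by (intro continuous_on_mult) auto
    qed
    note dfu = ext_d_coeff_continuous[OF fu]
    have diff: "coeff_continuous (ext_d A (fmult ?f u) - fmult ?f (ext_d A u))"
      using dfu fd unfolding coeff_continuous_def by (auto intro!: alternating_diff continuous_on_diff simp: minus_apply)
    \<comment> \<open>The derivatives of \<open>u\<close> cancel in this difference; what remains is
      the wedge with the differential, whose adjoint is known at each point.\<close>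
    have "?tw u ?G = ?tw (ext_d A (fmult ?f u) - fmult ?f (ext_d A u)) v"
    proof (rule twisted_L2_cong)
      fix c x assume c: "c \<in> A" "x \<in> fst c"
      have "(ext_d A (fmult ?f u) - fmult ?f (ext_d A u)) c x
        = wedge (oneform (function_derivative c ?f x)) (u c x)"
        using ext_d_fmult[OF f u c] by (simp add: minus_apply fmult_apply)
      then show "twisted_inner_alt (\<eta> x) (\<omega> c x) (u c x) (?G c x) =
        twisted_inner_alt (\<eta> x) (\<omega> c x) ((ext_d A (fmult ?f u) - fmult ?f (ext_d A u)) c x) (v c x)"
        using c unfolding twisted_contract_def
        by (simp only: simp_thms if_True) (rule twisted_inner_wedge_adjoint[OF metric_positive[OF c]
            function_derivative_linear[OF f c] function_derivative_real[OF f c]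
            smooth_formsD(2)[OF u] smooth_formsD(2)[OF v], symmetric])
    qed
    also have "\<dots> = ?tw u ?b - ?tw u ?a"
      unfolding 1 2 by (rule twisted_L2_diff_left[OF dfu fd diff cc[OF v]])
    finally show ?thesis
      unfolding twisted_L2_diff_right[OF cc[OF u] cc[OF a] cc[OF bG] cc[OF abG]]
        twisted_L2_diff_right[OF cc[OF u] cc[OF b] cc[OF G] cc[OF bG]] by simp
  qed
  then have "?a - (?b - ?G) = 0"
    using twisted_L2_definite[OF abG] abG by blast
  then show ?thesis
    by (simp only: right_minus_eq)
qed

end

text \<open>Links the sum over \<open>p \<le> k\<close> with q = k - p used by \<open>T_star\<close>
  to the sum over the square p, q \<le> n used for bidegrees: both forms have the same
  components.\<close>

lemma type_proj_degree_decomposition: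
  fixes \<alpha> :: "(complex^'n::finite) alt"
  assumes \<alpha>: "alternating \<alpha>" "has_degree (int k) \<alpha>"
  shows "(\<Sum>p\<le>k. type_proj p (k - p) \<alpha>) = \<alpha>"
proof -
  let ?S = "\<Sum>p\<le>k. type_proj p (k - p) \<alpha>"
  have "type_proj r s ?S = type_proj r s \<alpha>" for r s
  proof -
    have "type_proj r s ?S = (\<Sum>p\<le>k. if p = r then if s = k - r then type_proj r s \<alpha> else 0 else 0)"
      unfolding type_proj_sum by (intro sum.cong refl) (auto simp: type_proj_has_type[OF type_proj_type[OF \<alpha>(1)]])
    also have "\<dots> = (if r + s = k then type_proj r s \<alpha> else 0)"
      by (auto simp: sum.delta)
    also have "\<dots> = type_proj r s \<alpha>"
    proof (cases "r + s = k")
      case False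
      have "type_proj r s \<alpha> vs = 0" for vs
      proof (cases "length vs = r + s")
        case True
        then have "\<alpha> (map L vs) = 0" for L
          using \<alpha>(2) False by (simp add: has_degree_def flip: of_nat_add)
        then show ?thesis by (simp add: type_proj_def)
      qed (rule type_proj_degree)
      then show ?thesis using False by (simp add: fun_eq_iff)
    qed simp
    finally show ?thesis .
  qed
  moreover have "alternating ?S"
    by (intro alternating_sum has_type_alternating[OF type_proj_type[OF \<alpha>(1)]])
  ultimately show ?thesis
    using type_proj_decomposition[of ?S] type_proj_decomposition[OF \<alpha>(1)] by simp
qed

lemma linear_operatorI:
  assumes "\<And>u. u \<in> V \<Longrightarrow> T u \<in> W" "\<And>u v. u \<in> V \<Longrightarrow> v \<in> V \<Longrightarrow> T (u + v) = T u + T v"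
    "\<And>a u. u \<in> V \<Longrightarrow> T (fmult (\<lambda>_. a) u) = fmult (\<lambda>_. a) (T u)"
  shows "linear_operator V W T"
  using assms by (simp add: linear_operator_def)

lemma fmult_add: "fmult f (u + v) = fmult f u + fmult f v"
  and fmult_fmult: "fmult f (fmult g u) = fmult (\<lambda>x. f x * g x) u"
  and fmult_one: "fmult (\<lambda>_. 1) u = u"
  by (simp_all add: fmult_def fun_eq_iff algebra_simps)

lemma fmult_commute: "fmult f (fmult g u) = fmult g (fmult f u)"
  by (simp add: fmult_fmult mult.commute)

lemma fmult_sum: "fmult f (\<Sum>i\<in>I. u i) = (\<Sum>i\<in>I. fmult f (u i))"
  by (intro ext) (simp only: fmult_def sum_fun_apply sum_distrib_left)

section \<open>Powers of the twisting function and the commutator\<close>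

context twisted_manifold
begin

lemma function_derivative_power:
  assumes c: "c \<in> A" "x \<in> fst c"
  shows "function_derivative c (\<lambda>x. of_real (\<eta> x ^ m)) x v
    = of_real (of_nat m * \<eta> x ^ (m - 1)) * function_derivative c (\<lambda>x. of_real (\<eta> x)) x v"
proof -
  have "((\<lambda>z. complex_of_real (\<eta> (chart_inv c z)) ^ m) has_derivative
    (\<lambda>v. of_nat m * function_derivative c (\<lambda>x. of_real (\<eta> x)) x v
      * complex_of_real (\<eta> (chart_inv c (snd c x))) ^ (m - 1))) (at (snd c x))"
    by (rule has_derivative_power[OF function_has_derivative[OF eta_smooth c]])
  from frechet_derivative_eqI[OF this] show ?thesis
    unfolding function_derivative_def[of c "\<lambda>x. of_real (\<eta> x ^ m)"] using c by simp
qed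

definition unit_contract :: "('x, 'n) dform \<Rightarrow> ('x, 'n) dform" where
  "unit_contract = twisted_contract (\<lambda>x. complex_of_real (\<eta> x))"

text \<open>The chain rule, with linearity of the contraction in the one-form, refers every power of
  \<eta> to the single contraction by its differential.\<close>

lemma twisted_contract_power:
  "twisted_contract (\<lambda>x. of_real (\<eta> x ^ m)) u = fmult (\<lambda>x. of_real (of_nat m * \<eta> x ^ (m - 1))) (unit_contract u)"
proof (intro ext)
  fix c x vs
  show "twisted_contract (\<lambda>x. of_real (\<eta> x ^ m)) u c x vs
    = fmult (\<lambda>x. of_real (of_nat m * \<eta> x ^ (m - 1))) (unit_contract u) c x vs"
  proof (cases "c \<in> A \<and> x \<in> fst c")
    case True
    let ?r = "complex_of_real (of_nat m * \<eta> x ^ (m - 1))"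
    let ?d = "function_derivative c (\<lambda>x. complex_of_real (\<eta> x)) x"
    have e: "of_real ((\<eta> x)\<^sup>2) * part01 (function_derivative c (\<lambda>x. of_real (\<eta> x ^ m)) x) v
        + part10 (function_derivative c (\<lambda>x. of_real (\<eta> x ^ m)) x) v
      = ?r * (of_real ((\<eta> x)\<^sup>2) * part01 ?d v + part10 ?d v)" for v
      using function_derivative_power[of c x m] True by (simp add: part01_def part10_def field_simps)
    show ?thesis
      using True unfolding twisted_contract_def unit_contract_def fmult_apply by (simp only: simp_thms if_True e contract_smul_left)
  next
    case False
    then show ?thesis
      unfolding twisted_contract_def unit_contract_def fmult_apply by (simp only: if_False smul_zero)
  qed
qed

text \<open>The coefficients of \<open>a\<close> are made for the twist. Evaluated at
  \<open>\<i> *s v\<close>, its two parts acquire the factors \<open>\<i>\<close> and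
  \<open>- \<i>\<close>, so that the sign between them disappears and a common -1 cancels the one in
  \<open>Lambda_alt_commutator\<close>. Taking out 1/\<eta> leaves the weights
  \<open>(\<eta> x)\<^sup>2\<close> and 1 of the twisted adjoint.\<close>

lemma commutator_contract:
  assumes w: "w \<in> smooth_forms A k"
    and a: "a = fmult (\<lambda>_. \<i>) (fmult (\<lambda>x. 1 / complex_of_real (\<eta> x)) (del_function A (\<lambda>x. complex_of_real (\<eta> x)))
        - fmult (\<lambda>x. complex_of_real (\<eta> x)) (delbar_function A (\<lambda>x. complex_of_real (\<eta> x))))"
  shows "graded_commutator (-2) 1 (Lambda A \<omega>) (wedge_form a) w
    = fmult (\<lambda>x. 1 / complex_of_real (\<eta> x)) (unit_contract w)"
proof (intro ext)
  fix c x vs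
  let ?h = "\<lambda>x. complex_of_real (\<eta> x)"
  \<comment> \<open>The degrees -2 and 1 have an even product, so the graded commutator is the
    ordinary one.\<close>
  have g: "graded_commutator (-2) 1 (Lambda A \<omega>) (wedge_form a) w c x
    = Lambda A \<omega> (wedge_form a w) c x - wedge (a c x) (Lambda A \<omega> w c x)"
    by (simp add: graded_commutator_def fmult_one wedge_form_def minus_apply)
  have "graded_commutator (-2) 1 (Lambda A \<omega>) (wedge_form a) w c x
    = fmult (\<lambda>x. 1 / ?h x) (unit_contract w) c x"
  proof (cases "c \<in> A \<and> x \<in> fst c")
    case False
    then show ?thesis
      unfolding g Lambda_def fmult_apply unit_contract_def twisted_contract_def
      by (simp only: if_False wedge_zero_right smul_zero diff_zero)
  next
    case True
    then have c: "c \<in> A" "x \<in> fst c" by auto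
    let ?d = "function_derivative c ?h x"
    have lin: "linear ?d" by (rule function_derivative_linear[OF eta_smooth c])
    define b where "b v = \<i> * (1 / ?h x * part10 ?d v - ?h x * part01 ?d v)" for v
    have d: "del_function A ?h c x = oneform (part10 ?d)" "delbar_function A ?h c x = oneform (part01 ?d)"
      by (simp_all only: del_function_def delbar_function_def pq_part_def ext_d_function_form[OF eta_smooth c]
          bidegree_part_oneform[OF lin])
    have ab: "a c x = oneform b"
      unfolding a fmult_apply minus_apply d by (auto simp: fun_eq_iff b_def oneform_def smul_apply minus_apply)
    have "linear b"
      unfolding b_def using part10_01(4,5)[OF lin]
      by (intro linear_compose_sub linear_compose[OF _ linear_times, unfolded comp_def])
    have bi: "b (\<i> *s v) = - (1 / ?h x) * (of_real ((\<eta> x)\<^sup>2) * part01 ?d v + part10 ?d v)" for v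
      unfolding b_def part10_01(2,3)[OF lin] by (simp add: power2_eq_square field_simps)
    have "Lambda_alt (\<omega> c x) (wedge (oneform b) (w c x)) - wedge (oneform b) (Lambda_alt (\<omega> c x) (w c x))
      = - contract (\<omega> c x) (\<lambda>v. b (\<i> *s v)) (w c x)"
      by (rule Lambda_alt_commutator[OF metric_positive[OF c] \<open>linear b\<close> smooth_formsD(2)[OF w]])
    also have "\<dots> = smul (1 / ?h x) (contract (\<omega> c x) (\<lambda>v. of_real ((\<eta> x)\<^sup>2) * part01 ?d v + part10 ?d v) (w c x))"
      unfolding bi contract_smul_left by (simp add: fun_eq_iff smul_apply)
    finally show ?thesis
      using True unfolding g Lambda_def fmult_apply unit_contract_def twisted_contract_def wedge_form_def ab
      by (simp only: if_True simp_thms)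
  qed
  then show "graded_commutator (-2) 1 (Lambda A \<omega>) (wedge_form a) w c x vs
    = fmult (\<lambda>x. 1 / ?h x) (unit_contract w) c x vs"
    by (rule fun_cong)
qed

lemma theta_add:
  assumes "u \<in> smooth_forms A m" "v \<in> smooth_forms A m" shows "theta f (u + v) = theta f u + theta f v"
  by (intro ext) (simp only: plus_fun_apply theta_apply[OF smooth_forms_add[OF assms]] theta_apply[OF assms(1)]
      theta_apply[OF assms(2)] theta_alt_add)

lemma theta_fmult:
  assumes "u \<in> smooth_forms A m" shows "theta f (fmult (\<lambda>_. a) u) = fmult (\<lambda>_. a) (theta f u)"
  by (intro ext) (simp only: fmult_apply theta_apply[OF smooth_forms_fmult[OF smooth_function_const assms]]
      theta_apply[OF assms] theta_alt_smul)

lemma theta_type: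
  assumes "u \<in> smooth_forms A m" "\<And>c x. has_type p q (u c x)"
  shows "theta f u = fmult (\<lambda>x. of_real (f x ^ p)) u"
  by (intro ext) (simp only: theta_apply[OF assms(1)] theta_alt_has_type[OF assms(2)] fmult_apply)

end

section \<open>The operators of the formula as one conjugated adjoint\<close>

context twisted_adjoint
begin

text \<open>The expression does not involve p, so the operators for the various bidegrees become
  restrictions of a single linear operator.\<close>

definition conjugate_dstar :: "('x, 'n) dform \<Rightarrow> ('x, 'n) dform" where
  "conjugate_dstar u = fmult (\<lambda>x. of_real (1 / \<eta> x ^ (2 * CARD('n))))
     (dstar (fmult (\<lambda>x. of_real (\<eta> x ^ (2 * CARD('n)))) u))"

lemma conjugate_dstar_linear:
  "linear_operator (smooth_forms A (int k)) (smooth_forms A (int k - 1)) conjugate_dstar"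
proof (rule linear_operatorI)
  note s = smooth_forms_fmult[OF eta_power_smooth]
  show "conjugate_dstar u \<in> smooth_forms A (int k - 1)" if "u \<in> smooth_forms A (int k)" for u
    unfolding conjugate_dstar_def by (intro smooth_forms_fmult eta_power_inverse_smooth dstar_smooth eta_power_smooth that)
  show "conjugate_dstar (u + v) = conjugate_dstar u + conjugate_dstar v"
    if "u \<in> smooth_forms A (int k)" "v \<in> smooth_forms A (int k)" for u v
    unfolding conjugate_dstar_def by (simp only: fmult_add dstar_add s that)
  show "conjugate_dstar (fmult (\<lambda>_. a) u) = fmult (\<lambda>_. a) (conjugate_dstar u)"
    if "u \<in> smooth_forms A (int k)" for a u
    unfolding conjugate_dstar_def
    by (simp only: fmult_commute[of _ "\<lambda>_. a"] dstar_fmult[OF s[OF that]])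
qed

lemma conjugate_dstar_zero: "conjugate_dstar 0 = 0"
proof -
  have z: "fmult f 0 = 0" for f and A :: "('x, 'n) chart set"
    by (simp add: fmult_def zero_fun_def)
  show ?thesis
    unfolding conjugate_dstar_def z dstar_zero ..
qed

text \<open>Splitting the power 2n as \<open>2 * p + m\<close>, the part \<open>2 * p\<close> is the
  square of \<open>theta\<close> and the rest goes through \<open>dstar_product\<close>.
  Differentiating the m-th power of \<eta> yields the coefficient m, which is 2(n - p), and lowers
  the exponent by one, whence the factor 1/\<eta>.\<close>

lemma T_p_star_eq:
  assumes u: "u \<in> smooth_forms A (int k)" and ty: "\<And>c x. has_type p q (u c x)"
  shows "T_p_star A \<omega> \<eta> dstar p u = conjugate_dstar u"
proof -
  let ?n = "CARD('n)"
  define w where "w = theta \<eta> (theta \<eta> u)"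
  have th: "theta \<eta> u \<in> smooth_forms A (int k)"
    by (rule smooth_forms_theta[OF eta_smooth u])
  have ty': "has_type p q (theta \<eta> u c x)" for c x
    unfolding theta_type[OF u ty] fmult_apply by (rule has_type_smul[OF ty])
  have "w = fmult (\<lambda>x. of_real (\<eta> x ^ p)) (theta \<eta> u)"
    unfolding w_def by (rule theta_type[OF th ty'])
  then have w: "w = fmult (\<lambda>x. of_real (\<eta> x ^ (2 * p))) u"
    unfolding theta_type[OF u ty] by (simp add: fmult_fmult mult_2 power_add)
  have ws: "w \<in> smooth_forms A (int k)"
    unfolding w by (rule smooth_forms_fmult[OF eta_power_smooth u])
  have T: "T_p_star A \<omega> \<eta> dstar p u = fmult (\<lambda>x. 1 / of_real (\<eta> x) ^ (2 * p))
     (dstar w - fmult (\<lambda>_. 2 * (of_nat ?n - of_nat p)) (fmult (\<lambda>x. 1 / of_real (\<eta> x)) (unit_contract w)))"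
    unfolding T_p_star_def Let_def w_def[symmetric] commutator_contract[OF ws refl] ..
  show ?thesis
  \<comment> \<open>For p above n the form is zero. Otherwise the truncated difference
    \<open>?n - p\<close> is the true one, which the exponent m relies on.\<close>
  proof (cases "p \<le> ?n")
    case False
    have "u c x = 0" for c x
      using bidegree_large[OF has_type_bidegree[OF ty]] False by (simp add: not_le)
    then have u0: "u = 0"
      by (intro ext) (simp only: zero_fun_apply)
    have w0: "w = 0"
      unfolding w u0 by (simp add: fmult_def zero_fun_def)
    have "unit_contract 0 = 0"
      unfolding unit_contract_def twisted_contract_def
      by (intro ext) (simp only: zero_fun_apply contract_zero if_cancel)
    then have "T_p_star A \<omega> \<eta> dstar p u = 0"
      unfolding T w0 dstar_zero by (simp add: fmult_def zero_fun_def fun_eq_iff)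
    then show ?thesis
      unfolding u0 conjugate_dstar_zero .
  next
    case True
    define m where "m = 2 * (?n - p)"
    have m: "2 * ?n = 2 * p + m" using True by (simp add: m_def)
    have "fmult (\<lambda>x. of_real (\<eta> x ^ (2 * ?n))) u = fmult (\<lambda>x. of_real (\<eta> x ^ m)) w"
      unfolding w m by (simp add: fmult_fmult power_add mult.commute)
    then have "conjugate_dstar u = fmult (\<lambda>x. of_real (1 / \<eta> x ^ (2 * ?n)))
      (fmult (\<lambda>x. of_real (\<eta> x ^ m)) (dstar w)
        - fmult (\<lambda>x. of_real (of_nat m * \<eta> x ^ (m - 1))) (unit_contract w))"
      unfolding conjugate_dstar_def by (simp only: dstar_product[OF eta_power_smooth ws] twisted_contract_power)
    also have "\<dots> = T_p_star A \<omega> \<eta> dstar p u"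
    proof (intro ext)
      fix c x vs
      let ?t = "complex_of_real (\<eta> x)"
      have 1: "1 / ?t ^ (2 * ?n) * ?t ^ m = 1 / ?t ^ (2 * p)"
        unfolding m by (simp add: power_add)
      have 2: "1 / ?t ^ (2 * ?n) * (of_nat m * ?t ^ (m - 1)) = 1 / ?t ^ (2 * p) * (2 * (of_nat ?n - of_nat p) * (1 / ?t))"
      \<comment> \<open>For m = 0 the exponent \<open>m - 1\<close> is truncated to 0, but then p =
        n and both sides vanish through their coefficients.\<close>
      proof (cases m)
        case 0
        then have "?n = p" using True by (simp add: m_def)
        then show ?thesis using 0 by simp
      next
        case (Suc j)
        have "(of_nat m :: complex) = 2 * (of_nat ?n - of_nat p)"
          using True by (simp add: m_def of_nat_diff)
        moreover have "1 / ?t ^ (2 * ?n) * ?t ^ (m - 1) = 1 / ?t ^ (2 * p) * (1 / ?t)"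
          unfolding m Suc by (simp add: power_add)
        ultimately show ?thesis
          by (simp only: mult.left_commute[of _ "of_nat m"]) (simp only: mult_ac)
      qed
      have "fmult (\<lambda>x. of_real (1 / \<eta> x ^ (2 * ?n))) (fmult (\<lambda>x. of_real (\<eta> x ^ m)) (dstar w)
          - fmult (\<lambda>x. of_real (of_nat m * \<eta> x ^ (m - 1))) (unit_contract w)) c x vs
        = 1 / ?t ^ (2 * ?n) * ?t ^ m * dstar w c x vs
          - 1 / ?t ^ (2 * ?n) * (of_nat m * ?t ^ (m - 1)) * unit_contract w c x vs"
        by (simp add: fmult_def minus_apply right_diff_distrib)
      also have "\<dots> = T_p_star A \<omega> \<eta> dstar p u c x vs"
        unfolding 1 2 T fmult_def minus_apply
        by (simp only: right_diff_distrib[of "1 / ?t ^ (2 * p)"] mult.assoc)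
      finally show "fmult (\<lambda>x. of_real (1 / \<eta> x ^ (2 * ?n))) (fmult (\<lambda>x. of_real (\<eta> x ^ m)) (dstar w)
          - fmult (\<lambda>x. of_real (of_nat m * \<eta> x ^ (m - 1))) (unit_contract w)) c x vs
        = T_p_star A \<omega> \<eta> dstar p u c x vs" .
    qed
    finally show ?thesis ..
  qed
qed

text \<open>Since the summands come from one additive operator, summing over the bidegree parts of
  \<open>u\<close> reassembles its value at \<open>u\<close>.\<close>

lemma T_star_eq:
  assumes u: "u \<in> smooth_forms A (int k)"
  shows "T_star A \<omega> \<eta> dstar k u = conjugate_dstar u"
proof -
  have "T_p_star A \<omega> \<eta> dstar p (pq_part p (k - p) u) = conjugate_dstar (pq_part p (k - p) u)" for p
    by (rule T_p_star_eq[OF smooth_forms_pq_part[OF u], where q = "k - p"])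
      (simp only: pq_part_apply[OF u] type_proj_type[OF smooth_formsD(2)[OF u]])
  then have "T_star A \<omega> \<eta> dstar k u = (\<Sum>p\<le>k. conjugate_dstar (pq_part p (k - p) u))"
    by (simp only: T_star_def)
  also have "\<dots> = conjugate_dstar (\<Sum>p\<le>k. pq_part p (k - p) u)"
    unfolding conjugate_dstar_def fmult_sum
    by (subst dstar_sum) (auto simp only: fmult_sum finite_atMost intro!: smooth_forms_fmult eta_power_smooth smooth_forms_pq_part u)
  also have "(\<Sum>p\<le>k. pq_part p (k - p) u) = u"
    by (intro ext) (simp only: dform_sum_apply pq_part_apply[OF u]
        type_proj_degree_decomposition[OF smooth_formsD(2,3)[OF u]])
  finally show ?thesis .
qed

lemma T_p_star_linear:
  assumes "p + q = k"
  shows "linear_operator (smooth_pq_forms A p q) (smooth_forms A (int k - 1)) (T_p_star A \<omega> \<eta> dstar p)"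
proof -
  have D: "u \<in> smooth_forms A (int k)" "T_p_star A \<omega> \<eta> dstar p u = conjugate_dstar u"
    if "u \<in> smooth_pq_forms A p q" for u
  proof -
    show u: "u \<in> smooth_forms A (int k)"
      using that assms by (simp add: smooth_pq_forms_def)
    show "T_p_star A \<omega> \<eta> dstar p u = conjugate_dstar u"
      using that by (intro T_p_star_eq[OF u] bidegree_has_type) (auto simp: smooth_pq_forms_def)
  qed
  have add: "u + v \<in> smooth_pq_forms A p q" if "u \<in> smooth_pq_forms A p q" "v \<in> smooth_pq_forms A p q" for u v
    using that unfolding smooth_pq_forms_def by (auto simp only: mem_Collect_eq plus_fun_apply intro!: smooth_forms_add bidegree_add)
  have fm: "fmult (\<lambda>_. a) u \<in> smooth_pq_forms A p q" if "u \<in> smooth_pq_forms A p q" for a u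
    using that unfolding smooth_pq_forms_def
    by (auto simp only: mem_Collect_eq fmult_apply intro!: smooth_forms_fmult smooth_function_const bidegree_smul)
  note L = conjugate_dstar_linear[unfolded linear_operator_def]
  show ?thesis
    using L by (intro linear_operatorI) (simp_all only: D add fm)
qed

section \<open>The adjoint of the twisted differential\<close>

lemma theta_inv_smooth: "u \<in> smooth_forms A m \<Longrightarrow> theta_inv \<eta> u \<in> smooth_forms A m"
  unfolding theta_inv_def by (rule smooth_forms_theta[OF eta_inverse_smooth])

definition D_eta_star :: "('x, 'n) dform \<Rightarrow> ('x, 'n) dform" where
  "D_eta_star = theta \<eta> \<circ> T_star A \<omega> \<eta> dstar k \<circ> theta_inv \<eta>"

lemma D_eta_star_eq:
  "u \<in> smooth_forms A (int k) \<Longrightarrow> D_eta_star u = theta \<eta> (conjugate_dstar (theta_inv \<eta> u))"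
  by (simp add: D_eta_star_def T_star_eq theta_inv_smooth)

lemma D_eta_star_linear:
  "linear_operator (smooth_forms A (int k)) (smooth_forms A (int k - 1)) D_eta_star"
proof (rule linear_operatorI)
  note L = conjugate_dstar_linear[unfolded linear_operator_def]
  have cs: "conjugate_dstar (theta_inv \<eta> u) \<in> smooth_forms A (int k - 1)" if "u \<in> smooth_forms A (int k)" for u
    using L theta_inv_smooth[OF that] by blast
  show "D_eta_star u \<in> smooth_forms A (int k - 1)" if "u \<in> smooth_forms A (int k)" for u
    unfolding D_eta_star_eq[OF that] by (rule smooth_forms_theta[OF eta_smooth cs[OF that]])
  show "D_eta_star (u + v) = D_eta_star u + D_eta_star v"
    if uv: "u \<in> smooth_forms A (int k)" "v \<in> smooth_forms A (int k)" for u v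
  proof -
    have "theta_inv \<eta> (u + v) = theta_inv \<eta> u + theta_inv \<eta> v"
      unfolding theta_inv_def by (rule theta_add[OF uv])
    moreover have "conjugate_dstar (theta_inv \<eta> u + theta_inv \<eta> v)
      = conjugate_dstar (theta_inv \<eta> u) + conjugate_dstar (theta_inv \<eta> v)"
      using L theta_inv_smooth[OF uv(1)] theta_inv_smooth[OF uv(2)] by blast
    ultimately show ?thesis
      by (simp only: D_eta_star_eq uv smooth_forms_add theta_add[OF cs[OF uv(1)] cs[OF uv(2)]])
  qed
  show "D_eta_star (fmult (\<lambda>_. a) u) = fmult (\<lambda>_. a) (D_eta_star u)"
    if u: "u \<in> smooth_forms A (int k)" for a u
  proof -
    have "theta_inv \<eta> (fmult (\<lambda>_. a) u) = fmult (\<lambda>_. a) (theta_inv \<eta> u)"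
      unfolding theta_inv_def by (rule theta_fmult[OF u])
    moreover have "conjugate_dstar (fmult (\<lambda>_. a) (theta_inv \<eta> u)) = fmult (\<lambda>_. a) (conjugate_dstar (theta_inv \<eta> u))"
      using L theta_inv_smooth[OF u] by blast
    ultimately show ?thesis
      by (simp only: D_eta_star_eq u smooth_forms_fmult[OF smooth_function_const u] theta_fmult[OF cs[OF u]])
  qed
qed

text \<open>The adjoint identity of \<open>dstar\<close> is applied once, to
  \<open>theta_inv \<eta> u\<close> and to \<open>theta_inv \<eta> v\<close> scaled by the 2n-th
  power of \<eta>. On either side of it the integrands agree at each point, and only the
  selfadjointness of \<open>theta_alt\<close> is involved.\<close>

lemma D_eta_star_adjoint:
  assumes u: "u \<in> smooth_forms A (int k - 1)" and v: "v \<in> smooth_forms A (int k)"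
  shows "L2_inner A \<omega> (D_eta A \<eta> u) v = L2_inner A \<omega> u (D_eta_star v)"
proof -
  let ?N = "2 * CARD('n)"
  let ?u = "theta_inv \<eta> u" and ?v = "fmult (\<lambda>x. of_real (\<eta> x ^ ?N)) (theta_inv \<eta> v)"
  have u': "?u \<in> smooth_forms A (int k - 1)" by (rule theta_inv_smooth[OF u])
  have v': "theta_inv \<eta> v \<in> smooth_forms A (int k)" by (rule theta_inv_smooth[OF v])
  have v'': "?v \<in> smooth_forms A (int k)" by (rule smooth_forms_fmult[OF eta_power_smooth v'])
  have dv: "dstar ?v \<in> smooth_forms A (int k - 1)" by (rule dstar_smooth[OF v''])
  have cv: "conjugate_dstar (theta_inv \<eta> v) \<in> smooth_forms A (int k - 1)"
    using conjugate_dstar_linear v' unfolding linear_operator_def by blast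
  have inv: "theta_alt (\<eta> x) (theta_alt (inverse (\<eta> x)) \<alpha>) = \<alpha>" if "alternating \<alpha>" for x and \<alpha> :: "(complex^'n) alt"
    by (simp add: theta_alt_mult theta_alt_one that)
  \<comment> \<open>The scaling of \<open>?v\<close> cancels the density of the twisted volume. Of
    the two factors in \<open>theta_alt ((\<eta> x)\<^sup>2)\<close>, one completes
    \<open>D_eta\<close> and the other, moved to the right, cancels
    \<open>theta_inv\<close>.\<close>
  have "L2_inner A \<omega> (D_eta A \<eta> u) v = twisted_L2_inner A \<omega> \<eta> (ext_d A ?u) ?v"
    unfolding L2_inner_def twisted_L2_inner_def
  proof (rule integral_vol_cong)
    fix c x assume c: "c \<in> A" "x \<in> fst c"
    let ?w = "\<omega> c x" and ?t = "\<eta> x" and ?\<beta> = "ext_d A ?u c x" and ?\<gamma> = "theta_alt (inverse (\<eta> x)) (v c x)"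
    have w: "positive_11 ?w" by (rule metric_positive[OF c])
    have \<beta>: "alternating ?\<beta>" by (rule ext_d_alternating[OF u'])
    have \<gamma>: "alternating ?\<gamma>" by (rule theta_alt_alternating[OF smooth_formsD(2)[OF v]])
    have "twisted_inner_alt ?t ?w ?\<beta> (?v c x) * of_real (1 / ?t ^ ?N)
      = inner_alt ?w (theta_alt (?t\<^sup>2) ?\<beta>) (smul (of_real (?t ^ ?N)) ?\<gamma>) * of_real (1 / ?t ^ ?N)"
      unfolding twisted_integrand[where u = "ext_d A ?u" and v = ?v, OF c \<beta> smooth_formsD(2)[OF v'']]
      by (simp only: fmult_apply theta_inv_def theta_apply[OF v])
    also have "\<dots> = inner_alt ?w (theta_alt (?t\<^sup>2) ?\<beta>) ?\<gamma>"
      by (simp add: inner_alt_smul)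
    also have "\<dots> = inner_alt ?w (theta_alt ?t ?\<beta>) (theta_alt ?t ?\<gamma>)"
      unfolding power2_eq_square theta_alt_mult[OF \<beta>, symmetric]
      by (rule theta_alt_selfadjoint[OF w theta_alt_alternating[OF \<beta>] \<gamma>])
    also have "\<dots> = inner_alt ?w (D_eta A \<eta> u c x) (v c x)"
      unfolding inv[OF smooth_formsD(2)[OF v]] D_eta_def comp_def theta_pointwise[of "ext_d A ?u" c x, OF \<beta>] ..
    finally show "inner_alt ?w (D_eta A \<eta> u c x) (v c x)
      = twisted_inner_alt ?t ?w ?\<beta> (?v c x) * of_real (1 / ?t ^ ?N)" ..
  qed
  also have "\<dots> = twisted_L2_inner A \<omega> \<eta> ?u (dstar ?v)"
    by (rule dstar_adjoint[OF u' v''])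
  also have "\<dots> = L2_inner A \<omega> u (D_eta_star v)"
    unfolding L2_inner_def twisted_L2_inner_def
  proof (rule integral_vol_cong)
    fix c x assume c: "c \<in> A" "x \<in> fst c"
    let ?w = "\<omega> c x" and ?t = "\<eta> x" and ?\<delta> = "dstar ?v c x"
    have w: "positive_11 ?w" by (rule metric_positive[OF c])
    note \<alpha> = smooth_formsD(2)[OF u]
    have \<delta>: "alternating ?\<delta>" by (rule smooth_formsD(2)[OF dv])
    \<comment> \<open>Here one of the two factors cancels \<open>theta_inv\<close> on
      \<open>u\<close>. The other moves to the right and becomes the outer \<open>theta\<close> of
      the adjoint, while the density becomes the outer factor of
      \<open>conjugate_dstar\<close>.\<close>
    have i: "theta_alt (?t\<^sup>2) (theta_alt (inverse ?t) (u c x)) = theta_alt ?t (u c x)"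
      by (simp add: theta_alt_mult[OF \<alpha>] power2_eq_square mult.assoc)
    have "twisted_inner_alt ?t ?w (?u c x) ?\<delta> * of_real (1 / ?t ^ ?N)
      = inner_alt ?w (theta_alt ?t (u c x)) ?\<delta> * of_real (1 / ?t ^ ?N)"
      unfolding twisted_integrand[where u = ?u and v = "dstar ?v", OF c smooth_formsD(2)[OF u'] \<delta>]
      by (simp only: theta_inv_def theta_apply[OF u] i)
    also have "\<dots> = inner_alt ?w (u c x) (smul (of_real (1 / ?t ^ ?N)) (theta_alt ?t ?\<delta>))"
      unfolding theta_alt_selfadjoint[OF w \<alpha> \<delta>] inner_alt_smul by simp
    also have "smul (of_real (1 / ?t ^ ?N)) (theta_alt ?t ?\<delta>) = D_eta_star v c x"
    proof -
      have "conjugate_dstar (theta_inv \<eta> v) c x = smul (of_real (1 / ?t ^ ?N)) ?\<delta>"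
        unfolding conjugate_dstar_def by (rule fmult_apply)
      then show ?thesis
        unfolding D_eta_star_eq[OF v] theta_apply[OF cv] by (simp only: theta_alt_smul)
    qed
    finally show "twisted_inner_alt ?t ?w (?u c x) ?\<delta> * of_real (1 / ?t ^ ?N)
      = inner_alt ?w (u c x) (D_eta_star v c x)" .
  qed
  finally show ?thesis .
qed

lemma D_eta_star_unique:
  assumes D: "formal_adjoint A (L2_inner A \<omega>) (int k) (D_eta A \<eta>) Dstar" and v: "v \<in> smooth_forms A (int k)"
  shows "Dstar v = D_eta_star v"
proof -
  have Dv: "Dstar v \<in> smooth_forms A (int k - 1)"
    and adj: "L2_inner A \<omega> (D_eta A \<eta> u) v = L2_inner A \<omega> u (Dstar v)" if "u \<in> smooth_forms A (int k - 1)" for u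
    using D v that unfolding formal_adjoint_def linear_operator_def by blast+
  \<comment> \<open>The preceding fact was obtained in the presence of a test form \<open>u\<close>;
    the zero form discharges that condition.\<close>
  have Dv: "Dstar v \<in> smooth_forms A (int k - 1)"
    using Dv smooth_forms_zero by blast
  have Ev: "D_eta_star v \<in> smooth_forms A (int k - 1)"
    using D_eta_star_linear v unfolding linear_operator_def by blast
  let ?h = "Dstar v - D_eta_star v"
  have h: "?h \<in> smooth_forms A (int k - 1)" by (rule smooth_forms_diff[OF Dv Ev])
  have "L2_inner A \<omega> ?h ?h = 0"
    unfolding L2_inner_diff[OF h Dv Ev] adj[OF h, symmetric] D_eta_star_adjoint[OF h v] by simp
  then have "?h = 0" by (rule L2_inner_definite[OF h])
  then show ?thesis by (simp only: right_minus_eq)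
qed

end

theorem proposition2p6:
  fixes A :: "('x::t2_space, 'n::finite) chart set"
    and \<omega> :: "('x, 'n) dform"
    and \<eta> :: "'x \<Rightarrow> real"
    and k :: nat
    and dstar :: "('x, 'n) dform \<Rightarrow> ('x, 'n) dform"
  assumes "compact (UNIV :: 'x set)"
    and "complex_atlas A"
    and "hermitian_metric A \<omega>"
    and "smooth_function A (\<lambda>x. complex_of_real (\<eta> x))"
    and "\<forall>x. 0 < \<eta> x"
    and "k \<le> 2 * CARD('n)"
    and "formal_adjoint A (twisted_L2_inner A \<omega> \<eta>) (int k) (ext_d A) dstar"
  shows "(\<forall>p q. p + q = k \<longrightarrow>
            linear_operator (smooth_pq_forms A p q) (smooth_forms A (int k - 1))
              (T_p_star A \<omega> \<eta> dstar p)) \<and>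
         linear_operator (smooth_forms A (int k)) (smooth_forms A (int k - 1))
           (T_star A \<omega> \<eta> dstar k) \<and>
         formal_adjoint A (L2_inner A \<omega>) (int k) (D_eta A \<eta>)
           (theta \<eta> \<circ> T_star A \<omega> \<eta> dstar k \<circ> theta_inv \<eta>) \<and>
         (\<forall>Dstar. formal_adjoint A (L2_inner A \<omega>) (int k) (D_eta A \<eta>) Dstar \<longrightarrow>
            (\<forall>u \<in> smooth_forms A (int k).
               Dstar u = (theta \<eta> \<circ> T_star A \<omega> \<eta> dstar k \<circ> theta_inv \<eta>) u))"
proof -
  interpret twisted_adjoint A \<omega> \<eta> k dstar
    using assms by unfold_locales auto
  have "linear_operator (smooth_forms A (int k)) (smooth_forms A (int k - 1)) (T_star A \<omega> \<eta> dstar k)"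
    using conjugate_dstar_linear[unfolded linear_operator_def]
    by (intro linear_operatorI)
      (simp_all only: T_star_eq smooth_forms_add smooth_forms_fmult[OF smooth_function_const])
  moreover have "formal_adjoint A (L2_inner A \<omega>) (int k) (D_eta A \<eta>) D_eta_star"
    unfolding formal_adjoint_def using D_eta_star_linear D_eta_star_adjoint by blast
  ultimately show ?thesis
    using T_p_star_linear D_eta_star_unique unfolding D_eta_star_def by blast
qed

end
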